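(* Let $G(s)$ and $\bar G(s)$ be $m\times m$ transfer function matrices. Suppose that $\bar G(s)$ is strictly negative imaginary (SNI) and that $G(s)$ is strictly proper and negative imaginary (NI) with $G_2=0$ and $G_1\neq0$. Suppose also that $\mathcal N(G_1^T)\subseteq\mathcal N(G_0^T)$, where $\mathcal N(\cdot)$ denotes the null space of a matrix. Let $F_1$ be the matrix obtained from the singular value decomposition of $G_1$ as described in the context. Then the positive-feedback interconnection $[G(s),\bar G(s)]$ is internally stable if and only if $$F_1^T\bar G(0)F_1<0 .$$
   Context: Conventions. Transfer function matrices are square, real, rational and proper, $G(s)=C(sI-A)^{-1}B+D$ with real $A,B,C,D$; $G$ is strictly proper if $G(\infty)=D=0$. $M^*$ is the conjugate transpose; $>0,\ \ge 0,\ <0$ denote (Hermitian/symmetric) positive definiteness, positive semidefiniteness, negative definiteness. NI. A square $G(s)$ is NI if: (1) $G(s)$ has no pole in $\mathrm{Re}[s]>0$; (2) for all $\omega>0$ such that $j\omega$ is not a pole of $G(s)$, $j(G(j\omega)-G(j\omega)^* )\ge 0$; (3) if $s=j\omega_0$ with $\omega_0>0$ is a pole of $G(s)$, it is a simple pole and $K=\lim_{s\to j\omega_0}(s-j\omega_0)jG(s)$ is Hermitian and positive semidefinite; (4) if $s=0$ is a pole of $G(s)$, then $\lim_{s\to0}s^kG(s)=0$ for all $k\ge 3$ and $\lim_{s\to 0}s^2G(s)$ is Hermitian and positive semidefinite. SNI. A square $\bar G(s)$ is SNI if it has no pole in $\mathrm{Re}[s]\ge 0$ and $j(\bar G(j\omega)-\bar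 G(j\omega)^* )>0$ for all $\omega>0$. Internal stability. Let $G$ have minimal realization $(A,B,C,D)$ and $\bar G$ minimal realization $(\bar A,\bar B,\bar C,\bar D)$ with $I-D\bar D$ nonsingular. The positive feedback interconnection $[G(s),\bar G(s)]$ is internally stable if $$\breve A=\begin{bmatrix}A+B\bar D(I-D\bar D)^{-1}C & B\bar C+B\bar D(I-D\bar D)^{-1}D\bar C \\ \bar B(I-D\bar D)^{-1}C & \bar A+\bar B(I-D\bar D)^{-1}D\bar C\end{bmatrix}$$ is Hurwitz (all eigenvalues in the open left half plane). Matrices attached to an NI $G$: $G_2=\lim_{s\to0}s^2G(s)$, $G_1=\lim_{s\to0}s\left(G(s)-\frac{G_2}{s^2}\right)$, $G_0=\lim_{s\to0}\left(G(s)-\frac{G_2}{s^2}-\frac{G_1}{s}\right)$. Definition of $F_1$: take a singular value decomposition $G_1=\begin{bmatrix}\tilde F_1 & \tilde F_2\end{bmatrix}\begin{bmatrix}S_2 & 0 \\ 0 & 0\end{bmatrix}\begin{bmatrix}V_1^T \\ V_2^T\end{bmatrix}$ with $[\tilde F_1\ \tilde F_2]$ and $[V_1\ V_2]$ orthogonal and $S_2>0$, and set $F_1=\tilde F_1S_2$, so that $G_1=F_1V_1^T$ and $F_1$, $V_1$ each have orthogonal columns. *)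

theory Defs
  imports
    "HOL-Complex_Analysis.Complex_Analysis"
    "Jordan_Normal_Form.Matrix_Kernel"
    "Jordan_Normal_Form.Char_Poly"
    "Jordan_Normal_Form.Schur_Decomposition"
begin

abbreviation cmat :: "real mat \<Rightarrow> complex mat" where
  "cmat \<equiv> map_mat complex_of_real"

text \<open>A total inverse on matrices over a field; it is meaningful for invertible matrices only.\<close>

definition minv :: "'a::field mat \<Rightarrow> 'a mat" where
  "minv M = the (mat_inverse M)"


definition hermitian_mat :: "complex mat \<Rightarrow> bool" where
  "hermitian_mat M \<longleftrightarrow> mat_adjoint M = M"

text \<open>The scalar product \<open>(M *\<^sub>v x) \<bullet>c x\<close> is $x^* M x$, which is real for Hermitian \<open>M\<close>.\<close>

definition psd_mat :: "complex mat \<Rightarrow> bool" where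
  "psd_mat M \<longleftrightarrow> hermitian_mat M \<and>
     (\<forall>x \<in> carrier_vec (dim_row M). Re ((M *\<^sub>v x) \<bullet>c x) \<ge> 0)"

definition pd_mat :: "complex mat \<Rightarrow> bool" where
  "pd_mat M \<longleftrightarrow> hermitian_mat M \<and>
     (\<forall>x \<in> carrier_vec (dim_row M). x \<noteq> 0\<^sub>v (dim_row M) \<longrightarrow> Re ((M *\<^sub>v x) \<bullet>c x) > 0)"

definition nd_mat :: "complex mat \<Rightarrow> bool" where
  "nd_mat M \<longleftrightarrow> hermitian_mat M \<and>
     (\<forall>x \<in> carrier_vec (dim_row M). x \<noteq> 0\<^sub>v (dim_row M) \<longrightarrow> Re ((M *\<^sub>v x) \<bullet>c x) < 0)"


definition state_space ::
  "nat \<Rightarrow> nat \<Rightarrow> real mat \<Rightarrow> real mat \<Rightarrow> real mat \<Rightarrow> real mat \<Rightarrow> bool" where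
  "state_space m n A B C D \<longleftrightarrow>
     A \<in> carrier_mat n n \<and> B \<in> carrier_mat n m \<and> C \<in> carrier_mat m n \<and> D \<in> carrier_mat m m"

text \<open>
  \<open>transfer A B C D s\<close> is $C(sI-A)^{-1}B+D$. Its value is meaningless when \<open>s\<close> is an eigenvalue
  of \<open>A\<close>, where $sI-A$ is singular; for a minimal realization these are exactly the poles.
\<close>

definition transfer ::
  "real mat \<Rightarrow> real mat \<Rightarrow> real mat \<Rightarrow> real mat \<Rightarrow> complex \<Rightarrow> complex mat" where
  "transfer A B C D s =
     cmat C * minv (s \<cdot>\<^sub>m 1\<^sub>m (dim_row A) - cmat A) * cmat B + cmat D"

text \<open>
  A realization is minimal if no realization of the same rational matrix has a smaller state
  dimension. Two realizations define the same rational matrix if their transfer functions agree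
  wherever both formulas are meaningful, that is, off a finite set.
\<close>

definition same_transfer ::
  "real mat \<Rightarrow> real mat \<Rightarrow> real mat \<Rightarrow> real mat \<Rightarrow>
   real mat \<Rightarrow> real mat \<Rightarrow> real mat \<Rightarrow> real mat \<Rightarrow> bool" where
  "same_transfer A B C D A' B' C' D' \<longleftrightarrow>
     (\<forall>s. \<not> eigenvalue (cmat A) s \<longrightarrow> \<not> eigenvalue (cmat A') s \<longrightarrow>
        transfer A B C D s = transfer A' B' C' D' s)"

definition minimal_realization ::
  "nat \<Rightarrow> nat \<Rightarrow> real mat \<Rightarrow> real mat \<Rightarrow> real mat \<Rightarrow> real mat \<Rightarrow> bool" where
  "minimal_realization m n A B C D \<longleftrightarrow> state_space m n A B C D \<and>
     (\<forall>n' A' B' C' D'. state_space m n' A' B' C' D' \<longrightarrow>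
        same_transfer A B C D A' B' C' D' \<longrightarrow> n \<le> n')"


definition has_pole_at :: "nat \<Rightarrow> (complex \<Rightarrow> complex mat) \<Rightarrow> complex \<Rightarrow> bool" where
  "has_pole_at m G z \<longleftrightarrow> (\<exists>i<m. \<exists>j<m. is_pole (\<lambda>s. G s $$ (i, j)) z)"

text \<open>The order of a pole of a matrix is the largest order of that pole among the entries; \<open>zorder\<close>
  is negative at poles.\<close>

definition has_simple_pole_at :: "nat \<Rightarrow> (complex \<Rightarrow> complex mat) \<Rightarrow> complex \<Rightarrow> bool" where
  "has_simple_pole_at m G z \<longleftrightarrow> has_pole_at m G z \<and>
     (\<forall>i<m. \<forall>j<m. is_pole (\<lambda>s. G s $$ (i, j)) z \<longrightarrow> zorder (\<lambda>s. G s $$ (i, j)) z = -1)"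

definition mat_tendsto ::
  "nat \<Rightarrow> ('a \<Rightarrow> complex mat) \<Rightarrow> complex mat \<Rightarrow> 'a filter \<Rightarrow> bool" where
  "mat_tendsto m F L net \<longleftrightarrow> L \<in> carrier_mat m m \<and>
     (\<forall>i<m. \<forall>j<m. ((\<lambda>s. F s $$ (i, j)) \<longlongrightarrow> L $$ (i, j)) net)"

definition NI :: "nat \<Rightarrow> (complex \<Rightarrow> complex mat) \<Rightarrow> bool" where
  "NI m G \<longleftrightarrow>
     (\<forall>s. Re s > 0 \<longrightarrow> \<not> has_pole_at m G s) \<and>
     (\<forall>w::real. w > 0 \<longrightarrow> \<not> has_pole_at m G (\<i> * of_real w) \<longrightarrow>
        psd_mat (\<i> \<cdot>\<^sub>m (G (\<i> * of_real w) - mat_adjoint (G (\<i> * of_real w))))) \<and>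
     (\<forall>w::real. w > 0 \<longrightarrow> has_pole_at m G (\<i> * of_real w) \<longrightarrow>
        has_simple_pole_at m G (\<i> * of_real w) \<and>
        (\<exists>K. mat_tendsto m (\<lambda>s. ((s - \<i> * of_real w) * \<i>) \<cdot>\<^sub>m G s) K (at (\<i> * of_real w)) \<and>
             psd_mat K)) \<and>
     (has_pole_at m G 0 \<longrightarrow>
        (\<forall>k\<ge>3. mat_tendsto m (\<lambda>s. s ^ k \<cdot>\<^sub>m G s) (0\<^sub>m m m) (at 0)) \<and>
        (\<exists>L. mat_tendsto m (\<lambda>s. s ^ 2 \<cdot>\<^sub>m G s) L (at 0) \<and> psd_mat L))"

definition SNI :: "nat \<Rightarrow> (complex \<Rightarrow> complex mat) \<Rightarrow> bool" where
  "SNI m G \<longleftrightarrow>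
     (\<forall>s. Re s \<ge> 0 \<longrightarrow> \<not> has_pole_at m G s) \<and>
     (\<forall>w::real. w > 0 \<longrightarrow>
        pd_mat (\<i> \<cdot>\<^sub>m (G (\<i> * of_real w) - mat_adjoint (G (\<i> * of_real w)))))"

text \<open>
  The matrices $G_2, G_1, G_0$ of the expansion of $G$ at \<open>0\<close>. They are real because $G$ is a real
  rational matrix.
\<close>

definition expansion_at_0 ::
  "nat \<Rightarrow> (complex \<Rightarrow> complex mat) \<Rightarrow> real mat \<Rightarrow> real mat \<Rightarrow> real mat \<Rightarrow> bool" where
  "expansion_at_0 m G G2 G1 G0 \<longleftrightarrow>
     G2 \<in> carrier_mat m m \<and> G1 \<in> carrier_mat m m \<and> G0 \<in> carrier_mat m m \<and>
     mat_tendsto m (\<lambda>s. s ^ 2 \<cdot>\<^sub>m G s) (cmat G2) (at 0) \<and>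
     mat_tendsto m (\<lambda>s. s \<cdot>\<^sub>m (G s - (1 / s ^ 2) \<cdot>\<^sub>m cmat G2)) (cmat G1) (at 0) \<and>
     mat_tendsto m (\<lambda>s. G s - (1 / s ^ 2) \<cdot>\<^sub>m cmat G2 - (1 / s) \<cdot>\<^sub>m cmat G1) (cmat G0) (at 0)"


definition append_cols :: "'a::zero mat \<Rightarrow> 'a mat \<Rightarrow> 'a mat" where
  "append_cols X Y = four_block_mat X Y (0\<^sub>m 0 (dim_col X)) (0\<^sub>m 0 (dim_col Y))"

text \<open>The library's \<open>orthogonal_mat\<close> does not require the columns to have norm 1.\<close>

definition orthonormal_mat :: "nat \<Rightarrow> real mat \<Rightarrow> bool" where
  "orthonormal_mat m U \<longleftrightarrow>
     U \<in> carrier_mat m m \<and> transpose_mat U * U = 1\<^sub>m m \<and> U * transpose_mat U = 1\<^sub>m m"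

definition is_svd ::
  "nat \<Rightarrow> nat \<Rightarrow> real mat \<Rightarrow> real mat \<Rightarrow> real mat \<Rightarrow> real mat \<Rightarrow> real mat \<Rightarrow> real mat \<Rightarrow> bool" where
  "is_svd m r M U1 U2 S V1 V2 \<longleftrightarrow>
     r \<le> m \<and>
     U1 \<in> carrier_mat m r \<and> U2 \<in> carrier_mat m (m - r) \<and>
     V1 \<in> carrier_mat m r \<and> V2 \<in> carrier_mat m (m - r) \<and>
     orthonormal_mat m (append_cols U1 U2) \<and> orthonormal_mat m (append_cols V1 V2) \<and>
     S \<in> carrier_mat r r \<and> diagonal_mat S \<and> (\<forall>i<r. S $$ (i, i) > 0) \<and>
     M = append_cols U1 U2
         * four_block_mat S (0\<^sub>m r (m - r)) (0\<^sub>m (m - r) r) (0\<^sub>m (m - r) (m - r))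
         * (transpose_mat V1 @\<^sub>r transpose_mat V2)"


definition hurwitz :: "real mat \<Rightarrow> bool" where
  "hurwitz M \<longleftrightarrow> (\<forall>z. eigenvalue (cmat M) z \<longrightarrow> Re z < 0)"

definition closed_loop ::
  "real mat \<Rightarrow> real mat \<Rightarrow> real mat \<Rightarrow> real mat \<Rightarrow>
   real mat \<Rightarrow> real mat \<Rightarrow> real mat \<Rightarrow> real mat \<Rightarrow> real mat" where
  "closed_loop A B C D A' B' C' D' =
     (let E = minv (1\<^sub>m (dim_row D) - D * D') in
      four_block_mat
        (A + B * D' * E * C)  (B * C' + B * D' * E * D * C')
        (B' * E * C)          (A' + B' * E * D * C'))"

definition internally_stable ::
  "real mat \<Rightarrow> real mat \<Rightarrow> real mat \<Rightarrow> real mat \<Rightarrow>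
   real mat \<Rightarrow> real mat \<Rightarrow> real mat \<Rightarrow> real mat \<Rightarrow> bool" where
  "internally_stable A B C D A' B' C' D' \<longleftrightarrow>
     invertible_mat (1\<^sub>m (dim_row D) - D * D') \<and> hurwitz (closed_loop A B C D A' B' C' D')"

end

theory Submission
  imports Defs
begin

text \<open>
  The matrix \<open>s G(s)\<close> is positive real on the right half plane: its Hermitian part is nonnegative
  on the imaginary axis, its poles there have nonnegative residues, and the minimum principle
  carries the sign inside. On the null space of \<open>G\<^sub>1\<close> the hypothesis on \<open>G\<^sub>0\<close> makes
  \<open>- G(s) / s\<close> positive real as well, so \<open>G\<close> vanishes there and takes its values in the
  range of \<open>G\<^sub>1\<close>. The Hermitian part of \<open>(G'(s) - G'(0)) / s\<close> is nonpositive.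

  An eigenvalue \<open>z\<close> of the closed loop with \<open>Re z > 0\<close> yields \<open>y = G(z) u\<close> and \<open>u = G'(z) y\<close>
  with \<open>y \<noteq> 0\<close> in the range of \<open>G\<^sub>1\<close>, and the sign conditions combine to
  \<open>y\<^sup>* G'(0) y \<ge> 0\<close>; on the axis one argues with limits. Conversely, if the loop is stable, its
  transfer matrix \<open>X\<close> is again negative imaginary and has no poles, so
  \<open>s X(s)\<close> is positive real and \<open>X(0) \<ge> 0\<close>. For \<open>y\<close> in the range of \<open>G\<^sub>1\<close> one has
  \<open>X(0) G'(0) y = - y\<close>, whence \<open>y\<^sup>* G'(0) y \<le> 0\<close>, and equality would produce the
  closed-loop eigenvalue \<open>0\<close>.
\<close>

unbundle no vec_syntax

text \<open>\<open>NI\<close> allows poles of \<open>G\<close> on the imaginary axis, so an axis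
  eigenvalue of the loop may be a point where \<open>transfer\<close> has no meaningful value. There
  the state equation \<open>z x = A x + B u\<close> takes over, and \<open>u\<^sup>* C x\<close>
  replaces \<open>u\<^sup>* G(z) u\<close>. No Lyapunov matrix is constructed. For a fixed vector
  \<open>x\<close> the scalar function \<open>x\<^sup>* G(s) x\<close> is studied by function
  theory; mixed forms are recovered because a form with semidefinite Hermitian part whose real part
  vanishes at \<open>x\<close> has \<open>x\<close> in the kernel of that Hermitian part. Passing
  from poles to eigenvalues takes controllability and observability, whereas minimality only
  compares state dimensions: a proper invariant subspace would allow a compression along an
  orthonormal basis. Controllability then serves as an induction principle: what holds for the
  inputs \<open>B u\<close>, is linear and survives \<open>A\<close> holds for all states. Zero
  frequency needs separate care. \<open>SNI\<close> states no inequality at \<open>0\<close>; the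
  Hermitian symmetry of \<open>G'(0)\<close> comes from the change of sign across \<open>0\<close>.
  The pole of \<open>G\<close> at \<open>0\<close> is at most simple because \<open>G2 = 0\<close>,
  which keeps \<open>s G(s)\<close> bounded there.\<close>

abbreviation axis :: "real \<Rightarrow> complex" where
  "axis w \<equiv> \<i> * of_real w"

abbreviation cmatT :: "real mat \<Rightarrow> complex mat" where
  "cmatT M \<equiv> cmat (transpose_mat M)"

section \<open>Analytic functions on the right half plane\<close>

lemma half_plane_domain:
  "open {s::complex. 0 < Re s}" "connected {s::complex. 0 < Re s}"
  using open_halfspace_Re_gt convex_halfspace_Re_gt convex_connected by blast+

text \<open>A nonconstant \<open>f\<close> would have an open image, containing a point to the left
  of \<open>f z\<close>. Later this is a rigidity statement: a positive real function whose real
  part vanishes at one interior point is constant.\<close>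

lemma Re_minimum_imp_constant_on:
  assumes f: "f holomorphic_on {s. 0 < Re s}" and z: "0 < Re z"
    and min: "\<And>s. 0 < Re s \<Longrightarrow> Re (f z) \<le> Re (f s)"
  shows "f constant_on {s. 0 < Re s}"
proof (rule ccontr)
  let ?S = "{s::complex. 0 < Re s}"
  assume "\<not> f constant_on ?S"
  then have "open (f ` ?S)"
    using open_mapping_thm[OF f] half_plane_domain by blast
  then obtain e where "e > 0" and e: "ball (f z) e \<subseteq> f ` ?S"
    using z by (metis (mono_tags) imageI mem_Collect_eq open_contains_ball)
  then have "f z - of_real (e/2) \<in> f ` ?S"
    by (intro subsetD[OF e]) (auto simp: dist_norm)
  then obtain s where "0 < Re s" "f s = f z - of_real (e/2)" by auto
  with min[of s] \<open>e > 0\<close> show False by simp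
qed

text \<open>The boundary conditions are lower limits, so no continuous extension to the axis is
  required. The sublevel set \<open>K\<close> of a supposed negative value is bounded by the
  condition at infinity and closed by the one at the axis; a minimum is attained on it, and
  \<open>f\<close> is constant.\<close>

lemma half_plane_minimum_principle:
  assumes f: "f holomorphic_on {s. 0 < Re s}"
    and bd: "\<And>w e. e > 0 \<Longrightarrow> Re w = 0 \<Longrightarrow>
      eventually (\<lambda>s. Re (f s) > - e) (at w within {s. 0 < Re s})"
    and inf: "\<And>e. e > 0 \<Longrightarrow> eventually (\<lambda>s. 0 < Re s \<longrightarrow> Re (f s) > - e) at_infinity"
    and z: "0 < Re z"
  shows "0 \<le> Re (f z)"
proof (rule ccontr)
  let ?S = "{s::complex. 0 < Re s}"
  assume "\<not> 0 \<le> Re (f z)"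
  then have a: "Re (f z) < 0" by simp
  define K where "K = {s. 0 < Re s \<and> Re (f s) \<le> Re (f z)}"
  obtain b where b: "\<And>s. b \<le> norm s \<Longrightarrow> 0 < Re s \<Longrightarrow> Re (f s) > Re (f z)"
    using inf[of "- Re (f z)"] a unfolding eventually_at_infinity by auto
  have "bounded K"
    unfolding bounded_iff K_def using b by (intro exI[of _ b]) (force simp: not_less)
  moreover have "closed K"
    unfolding closed_sequential_limits
  proof (intro allI impI, elim conjE)
    fix x l assume x: "\<forall>n. x n \<in> K" and l: "x \<longlonglongrightarrow> l"
    have xS: "x n \<in> ?S" for n using x by (auto simp: K_def)
    have "Re l \<ge> 0"
      using tendsto_Re[OF l] xS by (intro LIMSEQ_le_const) (auto intro: less_imp_le)
    moreover have "Re l \<noteq> 0"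
    proof
      assume "Re l = 0"
      then have "eventually (\<lambda>s. Re (f s) > Re (f z)) (at l within ?S)"
        using bd[of "- Re (f z)" l] a by simp
      moreover have "filterlim x (at l within ?S) sequentially"
        unfolding filterlim_at using l xS \<open>Re l = 0\<close>
        by (intro conjI always_eventually allI) (auto, metis less_irrefl)
      ultimately have "eventually (\<lambda>n. Re (f (x n)) > Re (f z)) sequentially"
        by (rule eventually_compose_filterlim)
      then show False using x unfolding K_def eventually_sequentially
        by (metis (mono_tags, lifting) mem_Collect_eq not_le order_refl)
    qed
    ultimately have "l \<in> ?S" by auto
    then have "isCont f l"
      using holomorphic_on_imp_continuous_on[OF f] half_plane_domain(1)
      by (simp add: continuous_on_eq_continuous_at)
    then have "(\<lambda>n. Re (f (x n))) \<longlonglongrightarrow> Re (f l)"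
      using l isCont_tendsto_compose tendsto_Re by blast
    then have "Re (f l) \<le> Re (f z)"
      using x by (intro LIMSEQ_le_const2) (auto simp: K_def)
    with \<open>l \<in> ?S\<close> show "l \<in> K" by (simp add: K_def)
  qed
  ultimately have "compact K" using compact_eq_bounded_closed by blast
  moreover have "K \<noteq> {}" using z by (auto simp: K_def)
  moreover have "continuous_on K (\<lambda>s. Re (f s))"
    using holomorphic_on_imp_continuous_on[OF f]
    by (intro continuous_intros) (auto simp: K_def elim: continuous_on_subset)
  ultimately obtain x where x: "x \<in> K" and min: "\<And>s. s \<in> K \<Longrightarrow> Re (f x) \<le> Re (f s)"
    using continuous_attains_inf by metis
  have "Re (f x) \<le> Re (f s)" if "0 < Re s" for s
    using min[of s] x that by (cases "Re (f s) \<le> Re (f z)") (auto simp: K_def)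
  then have "f constant_on ?S"
    using x by (intro Re_minimum_imp_constant_on[OF f, of x]) (auto simp: K_def)
  \<comment> \<open>A point of the half plane of norm at least \<open>b\<close>, where the real part
    exceeds \<open>Re (f z)\<close>.\<close>
  then have "f z = f (of_real (max 1 b))"
    using z by (auto simp: constant_on_def)
  moreover have "0 < max 1 b" by simp
  ultimately show False using b[of "of_real (max 1 b)"] by simp
qed

section \<open>Positive real functions with simple poles on the axis\<close>

lemma filterlim_vertical_line:
  "filterlim (\<lambda>t::real. axis (w + t)) (at (axis w)) (at 0)"
  unfolding filterlim_at
  by (auto intro!: tendsto_eq_intros simp: eventually_at_filter)

lemma eventually_not_in_finite_line:
  assumes "finite (F::real set)"
  shows "eventually (\<lambda>t. w + t \<notin> F) (at 0)"
proof -
  have "finite ((\<lambda>x. x - w) ` F)" using assms by simp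
  then have "eventually (\<lambda>t. t \<notin> (\<lambda>x. x - w) ` F) (at (0::real))"
    by (metis islimpt_finite islimpt_iff_eventually)
  then show ?thesis by eventually_elim force
qed

text \<open>The poles \<open>k / (s - \<i> w)\<close> with \<open>k \<ge> 0\<close> have nonnegative real part on the half plane and are
  purely imaginary on its boundary, so they do not disturb the minimum principle.\<close>

lemma half_plane_Re_nonneg:
  fixes f :: "complex \<Rightarrow> complex"
  assumes f: "f holomorphic_on {s. 0 < Re s}"
    and F: "finite F" and axis: "\<And>w. w \<notin> F \<Longrightarrow> 0 \<le> Re (f (axis w))"
    and poles: "\<And>w::real. \<exists>k\<ge>0. \<exists>L.
      ((\<lambda>s. f s - of_real k / (s - axis w)) \<longlongrightarrow> L) (at (axis w))"
    and inf: "(f \<longlongrightarrow> L) at_infinity"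
    and z: "0 < Re z"
  shows "0 \<le> Re (f z)"
proof (rule half_plane_minimum_principle[OF f _ _ z])
  fix w' :: complex and e :: real assume e: "e > 0" and "Re w' = 0"
  define w where "w = Im w'"
  have w': "w' = axis w" using \<open>Re w' = 0\<close> by (simp add: complex_eq_iff w_def)
  obtain k M where k: "k \<ge> 0"
    and M: "((\<lambda>s. f s - of_real k / (s - axis w)) \<longlongrightarrow> M) (at (axis w))"
    using poles[of w] by blast
  let ?h = "\<lambda>s. f s - of_real k / (s - axis w)"
  have "((\<lambda>t. Re (?h (axis (w + t)))) \<longlongrightarrow> Re M) (at 0)"
    by (intro tendsto_Re filterlim_compose[OF M] filterlim_vertical_line)
  moreover have "eventually (\<lambda>t. 0 \<le> Re (?h (axis (w + t)))) (at 0)"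
    using eventually_not_in_finite_line[OF F, of w]
  proof eventually_elim
    case (elim t)
    have "Re (?h (axis (w + t))) = Re (f (axis (w + t)))"
      by (simp add: Re_divide algebra_simps)
    with axis[OF elim] show ?case by simp
  qed
  \<comment> \<open>The sign of the finite part is read off along the axis, where \<open>f\<close>
    and \<open>?h\<close> have equal real parts; inside the half plane the pole term can only
    increase \<open>Re (f s)\<close>.\<close>
  ultimately have "0 \<le> Re M"
    by (intro tendsto_lowerbound) auto
  moreover have "((\<lambda>s. Re (?h s)) \<longlongrightarrow> Re M) (at w' within {s. 0 < Re s})"
    using tendsto_Re[OF M] unfolding w' by (rule tendsto_within_subset) simp
  ultimately have "eventually (\<lambda>s. Re (?h s) > - e) (at w' within {s. 0 < Re s})"
    using e by (intro order_tendstoD) auto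
  moreover have "eventually (\<lambda>s. s \<in> {s. 0 < Re s}) (at w' within {s. 0 < Re s})"
    by (simp add: eventually_at_filter)
  ultimately show "eventually (\<lambda>s. Re (f s) > - e) (at w' within {s. 0 < Re s})"
  proof eventually_elim
    case (elim s)
    have "Re (of_real k / (s - axis w)) \<ge> 0"
      using k elim by (auto simp: Re_divide intro!: divide_nonneg_nonneg)
    with elim show ?case by simp
  qed
next
  fix e :: real assume e: "e > 0"
  have line: "filterlim (\<lambda>t::real. axis t) at_infinity at_top"
    by (rule filterlim_norm_at_top_imp_at_infinity)
       (simp add: norm_mult filterlim_at_top_imp_at_infinity filterlim_abs_real)
  \<comment> \<open>The limit at infinity can be taken along the axis, where the sign is known
    outside the finite set \<open>F\<close>.\<close>
  have "((\<lambda>t. Re (f (axis t))) \<longlongrightarrow> Re L) at_top"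
    by (intro tendsto_Re filterlim_compose[OF inf] line)
  moreover have "eventually (\<lambda>t. 0 \<le> Re (f (axis t))) at_top"
  proof -
    obtain b where "\<And>x. x \<in> F \<Longrightarrow> x \<le> b"
      using F by (meson finite_imp_bounded bounded_has_Sup(1) cSup_upper bdd_above_finite)
    then have "t > b \<Longrightarrow> t \<notin> F" for t by force
    then show ?thesis
      using axis by (intro eventually_mono[OF eventually_gt_at_top[of b]]) blast
  qed
  ultimately have "0 \<le> Re L" by (intro tendsto_lowerbound) auto
  then have "eventually (\<lambda>s. Re (f s) > - e) at_infinity"
    using e by (intro order_tendstoD[OF tendsto_Re[OF inf]]) auto
  then show "eventually (\<lambda>s. 0 < Re s \<longrightarrow> Re (f s) > - e) at_infinity"
    by eventually_elim simp
qed

text \<open>After the singularity of \<open>(s - z) * f s\<close> is removed, the remainder is a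
  difference quotient of the extension, so its limit is a derivative. The case \<open>k = 0\<close>
  covers removable singularities.\<close>

lemma simple_pole_remainder_tendsto:
  assumes f: "f holomorphic_on U - {z}" and U: "open U" "z \<in> U"
    and k: "((\<lambda>s. (s - z) * f s) \<longlongrightarrow> k) (at z)"
  shows "\<exists>L. ((\<lambda>s. f s - k / (s - z)) \<longlongrightarrow> L) (at z)"
proof -
  define g where "g = (\<lambda>y. if y = z then k else (y - z) * f y)"
  have "g holomorphic_on U"
    unfolding g_def using f U k by (intro removable_singularity) (auto intro!: holomorphic_intros)
  then obtain D where "(g has_field_derivative D) (at z)"
    using U holomorphic_on_imp_differentiable_at field_differentiable_def by blast
  then have "((\<lambda>y. (g y - g z) / (y - z)) \<longlongrightarrow> D) (at z)"
    by (simp add: has_field_derivative_iff)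
  moreover have "eventually (\<lambda>y. (g y - g z) / (y - z) = f y - k / (y - z)) (at z)"
    by (auto simp: eventually_at_filter g_def diff_divide_distrib intro!: always_eventually)
  ultimately show ?thesis using tendsto_cong by fast
qed

section \<open>The resolvent\<close>

lemma minv_inverse:
  fixes M :: "'a::field mat"
  assumes M: "M \<in> carrier_mat n n" and "det M \<noteq> 0"
  shows "minv M \<in> carrier_mat n n" "M * minv M = 1\<^sub>m n" "minv M * M = 1\<^sub>m n"
proof -
  have "M \<in> Units (ring_mat TYPE('a) n ())"
    using det_non_zero_imp_unit[OF assms] .
  then obtain N where N: "mat_inverse M = Some N"
    using mat_inverse(1)[OF M, where b = "()"] by (cases "mat_inverse M") auto
  then show "minv M \<in> carrier_mat n n" "M * minv M = 1\<^sub>m n" "minv M * M = 1\<^sub>m n"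
    using mat_inverse(2)[OF M N] by (auto simp: minv_def)
qed

text \<open>Cramer's rule; it exposes the rational dependence of the resolvent on its
  parameter.\<close>

lemma minv_eq_adj_mat:
  fixes M :: "'a::field mat"
  assumes M: "M \<in> carrier_mat n n" and "det M \<noteq> 0"
  shows "det M \<cdot>\<^sub>m minv M = adj_mat M"
proof -
  note inv = minv_inverse[OF assms] and adj = adj_mat[OF M]
  have "adj_mat M = (minv M * M) * adj_mat M" using inv adj by simp
  also have "\<dots> = minv M * (det M \<cdot>\<^sub>m 1\<^sub>m n)"
    using assoc_mult_mat[OF inv(1) M adj(1)] adj by simp
  also have "\<dots> = det M \<cdot>\<^sub>m minv M"
    using inv by (metis mult_smult_distrib one_carrier_mat right_mult_one_mat)
  finally show ?thesis by simp
qed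

lemma eigenvalueE:
  assumes "A \<in> carrier_mat n n" "eigenvalue A k"
  obtains v where "v \<in> carrier_vec n" "v \<noteq> 0\<^sub>v n" "A *\<^sub>v v = k \<cdot>\<^sub>v v"
  using assms unfolding eigenvalue_def eigenvector_def by auto

lemma eigenvalueI:
  assumes "A \<in> carrier_mat n n" "v \<in> carrier_vec n" "v \<noteq> 0\<^sub>v n" "A *\<^sub>v v = k \<cdot>\<^sub>v v"
  shows "eigenvalue A k"
  using assms unfolding eigenvalue_def eigenvector_def by auto

lemma eigenvalue_iff_det:
  fixes A :: "'a::field mat"
  assumes A: "A \<in> carrier_mat n n"
  shows "eigenvalue A s \<longleftrightarrow> det (s \<cdot>\<^sub>m 1\<^sub>m n - A) = 0"
proof -
  have "s \<cdot>\<^sub>m 1\<^sub>m n - A = - char_matrix A s"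
    using A unfolding char_matrix_def by (intro eq_matI) auto
  then show ?thesis
    using det_0_negate[of "char_matrix A s" n] eigenvalue_det[OF A] A by (simp add: char_matrix_def)
qed

lemma finite_eigenvalues:
  fixes A :: "'a::field mat"
  assumes A: "A \<in> carrier_mat n n"
  shows "finite {s. eigenvalue A s}"
proof -
  have "char_poly A \<noteq> 0" using degree_monic_char_poly[OF A] by auto
  then show ?thesis
    using poly_roots_finite unfolding eigenvalue_root_char_poly[OF A] by blast
qed

lemma eigenvalue_transpose:
  fixes A :: "'a::field mat"
  assumes A: "A \<in> carrier_mat n n"
  shows "eigenvalue (transpose_mat A) s \<longleftrightarrow> eigenvalue A s"
  using eigenvalue_root_char_poly[OF A] eigenvalue_root_char_poly[of "transpose_mat A" n] A by simp

definition resolvent :: "complex mat \<Rightarrow> complex \<Rightarrow> complex mat" where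
  "resolvent A s = minv (s \<cdot>\<^sub>m 1\<^sub>m (dim_row A) - A)"

lemma resolvent_carrier [simp]:
  assumes "A \<in> carrier_mat n n" "\<not> eigenvalue A s"
  shows "resolvent A s \<in> carrier_mat n n"
  using minv_inverse(1)[of "s \<cdot>\<^sub>m 1\<^sub>m n - A" n] assms eigenvalue_iff_det[OF assms(1)]
  by (simp add: resolvent_def minus_carrier_mat)

lemma resolvent_vec_carrier [simp]:
  assumes "A \<in> carrier_mat n n" "\<not> eigenvalue A s" "b \<in> carrier_vec n"
  shows "resolvent A s *\<^sub>v b \<in> carrier_vec n"
  using mult_mat_vec_carrier[OF resolvent_carrier] assms by blast

lemma mult_mat_zero_vec:
  "M \<in> carrier_mat k n \<Longrightarrow> M *\<^sub>v 0\<^sub>v n = (0\<^sub>v k :: 'a::semiring_0 vec)"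
  by (intro eq_vecI) auto

lemma smult_mat_mult_vec:
  fixes M :: "'a::comm_ring_1 mat"
  assumes "M \<in> carrier_mat k n" "v \<in> carrier_vec n"
  shows "(a \<cdot>\<^sub>m M) *\<^sub>v v = a \<cdot>\<^sub>v (M *\<^sub>v v)"
  using assms by (intro eq_vecI) (auto simp: smult_scalar_prod_distrib[of _ n])

lemma shift_mult_vec:
  fixes A :: "'a::field mat"
  assumes "A \<in> carrier_mat n n" "x \<in> carrier_vec n"
  shows "(s \<cdot>\<^sub>m 1\<^sub>m n - A) *\<^sub>v x = s \<cdot>\<^sub>v x - A *\<^sub>v x"
  using assms by (simp add: minus_mult_distrib_mat_vec[of _ n n] smult_mat_mult_vec[of _ n n])

lemma resolvent_solves:
  assumes A: "A \<in> carrier_mat n n" and s: "\<not> eigenvalue A s" and b: "b \<in> carrier_vec n"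
  shows "s \<cdot>\<^sub>v (resolvent A s *\<^sub>v b) = A *\<^sub>v (resolvent A s *\<^sub>v b) + b"
proof -
  let ?M = "s \<cdot>\<^sub>m 1\<^sub>m n - A" and ?x = "resolvent A s *\<^sub>v b"
  have M: "?M \<in> carrier_mat n n" using A by (simp add: minus_carrier_mat)
  have R: "resolvent A s \<in> carrier_mat n n" using A s by simp
  then have x: "?x \<in> carrier_vec n" using b by simp
  have "?M * resolvent A s = 1\<^sub>m n"
    using minv_inverse(2)[OF M] A s eigenvalue_iff_det[OF A] by (simp add: resolvent_def)
  then have "?M *\<^sub>v ?x = b"
    using assoc_mult_mat_vec[OF M R b] b by simp
  then have eq: "s \<cdot>\<^sub>v ?x - A *\<^sub>v ?x = b"
    using shift_mult_vec[OF A x] by simp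
  show ?thesis
  proof (rule eq_vecI)
    fix i assume "i < dim_vec (A *\<^sub>v ?x + b)"
    then have i: "i < n" using b by simp
    have "(s \<cdot>\<^sub>v ?x - A *\<^sub>v ?x) $ i = b $ i" using eq by simp
    then show "(s \<cdot>\<^sub>v ?x) $ i = (A *\<^sub>v ?x + b) $ i" using i A b x R by (simp add: algebra_simps)
  qed (use A b x R in auto)
qed

text \<open>With \<open>resolvent_solves\<close> this characterizes the resolvent by the state
  equation, so later identities are proved by exhibiting a solution rather than by manipulating
  inverses.\<close>

lemma resolvent_unique:
  assumes A: "A \<in> carrier_mat n n" and s: "\<not> eigenvalue A s"
    and x: "x \<in> carrier_vec n" and eq: "s \<cdot>\<^sub>v x = A *\<^sub>v x + b" and b: "b \<in> carrier_vec n"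
  shows "resolvent A s *\<^sub>v b = x"
proof -
  let ?M = "s \<cdot>\<^sub>m 1\<^sub>m n - A"
  have M: "?M \<in> carrier_mat n n" using A by (simp add: minus_carrier_mat)
  have R: "resolvent A s \<in> carrier_mat n n" using A s by simp
  have RM: "resolvent A s * ?M = 1\<^sub>m n"
    using minv_inverse(3)[OF M] A s eigenvalue_iff_det[OF A] by (simp add: resolvent_def)
  have "b = ?M *\<^sub>v x"
    using shift_mult_vec[OF A x] A x b by (intro eq_vecI) (auto simp: eq)
  then have "resolvent A s *\<^sub>v b = (resolvent A s * ?M) *\<^sub>v x"
    using assoc_mult_mat_vec[OF R M x] by simp
  then show ?thesis using RM x by simp
qed

section \<open>Sesquilinear forms and the rational structure of the resolvent\<close>

lemma form_eq_sum:
  fixes M :: "complex mat"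
  assumes "M \<in> carrier_mat k n" "b \<in> carrier_vec n" "c \<in> carrier_vec k"
  shows "(M *\<^sub>v b) \<bullet>c c = (\<Sum>i<k. \<Sum>j<n. M $$ (i, j) * b $ j * cnj (c $ i))"
  using assms by (auto simp: scalar_prod_def atLeast0LessThan sum_distrib_right intro!: sum.cong)

lemma form_unit_vec:
  fixes M :: "complex mat"
  assumes "M \<in> carrier_mat k n" "i < k" "j < n"
  shows "(M *\<^sub>v unit_vec n j) \<bullet>c unit_vec k i = M $$ (i, j)"
proof -
  have "conjugate (unit_vec k i) = (unit_vec k i :: complex vec)"
    by (intro eq_vecI) (auto simp: unit_vec_def)
  then show ?thesis using assms by simp
qed

lemma cscalar_commute:
  fixes v w :: "complex vec"
  assumes "v \<in> carrier_vec n" "w \<in> carrier_vec n"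
  shows "v \<bullet>c w = cnj (w \<bullet>c v)"
  using assms by (auto simp: scalar_prod_def mult.commute intro!: sum.cong)

lemma cmat_adjoint:
  assumes M: "M \<in> carrier_mat k n" and x: "x \<in> carrier_vec n" and y: "y \<in> carrier_vec k"
  shows "(cmat M *\<^sub>v x) \<bullet>c y = x \<bullet>c (cmatT M *\<^sub>v y)"
proof -
  have "(cmat M *\<^sub>v x) \<bullet>c y = (\<Sum>i<k. \<Sum>j<n. of_real (M $$ (i, j)) * x $ j * cnj (y $ i))"
    using assms by (subst form_eq_sum[of _ k n]) auto
  also have "\<dots> = (\<Sum>j<n. \<Sum>i<k. of_real (M $$ (i, j)) * x $ j * cnj (y $ i))"
    by (rule sum.swap)
  also have "\<dots> = x \<bullet>c (cmatT M *\<^sub>v y)"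
    using assms by (auto simp: scalar_prod_def atLeast0LessThan sum_distrib_left intro!: sum.cong)
  finally show ?thesis .
qed

lemma form_tendsto:
  fixes F :: "'a \<Rightarrow> complex mat"
  assumes F: "eventually (\<lambda>s. F s \<in> carrier_mat k n) net" and L: "L \<in> carrier_mat k n"
    and lim: "\<And>i j. i < k \<Longrightarrow> j < n \<Longrightarrow> ((\<lambda>s. F s $$ (i, j)) \<longlongrightarrow> L $$ (i, j)) net"
    and b: "b \<in> carrier_vec n" and c: "c \<in> carrier_vec k"
  shows "((\<lambda>s. (F s *\<^sub>v b) \<bullet>c c) \<longlongrightarrow> (L *\<^sub>v b) \<bullet>c c) net"
proof -
  have "((\<lambda>s. \<Sum>i<k. \<Sum>j<n. F s $$ (i, j) * b $ j * cnj (c $ i)) \<longlongrightarrow>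
      (\<Sum>i<k. \<Sum>j<n. L $$ (i, j) * b $ j * cnj (c $ i))) net"
    by (intro tendsto_intros lim) auto
  moreover have "eventually (\<lambda>s. (\<Sum>i<k. \<Sum>j<n. F s $$ (i, j) * b $ j * cnj (c $ i)) = (F s *\<^sub>v b) \<bullet>c c) net"
    using F by eventually_elim (rule form_eq_sum[symmetric, OF _ b c])
  ultimately show ?thesis
    using tendsto_cong form_eq_sum[OF L b c] by force
qed

lemma det_holomorphic:
  assumes "\<And>s. M s \<in> carrier_mat n n"
    and "\<And>i j. i < n \<Longrightarrow> j < n \<Longrightarrow> (\<lambda>s. M s $$ (i, j)) holomorphic_on S"
  shows "(\<lambda>s. det (M s)) holomorphic_on S"
proof -
  have "(\<lambda>s. det (M s)) = (\<lambda>s. \<Sum>p | p permutes {0..<n}. signof p * (\<Prod>i = 0..<n. M s $$ (i, p i)))"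
    using det_def'[OF assms(1)] by auto
  moreover have "p i < n" if "p permutes {0..<n}" "i < n" for p i
    using permutes_in_image[OF that(1), of i] that by simp
  ultimately show ?thesis
    using assms(2) by (auto intro!: holomorphic_intros)
qed

text \<open>The numerator is built from cofactors of \<open>s I - A\<close>, which are entire in
  \<open>s\<close>. Holomorphy off the spectrum and meromorphy everywhere are both read off this
  quotient.\<close>

lemma resolvent_form_eq_quotient:
  assumes A: "A \<in> carrier_mat n n" and b: "b \<in> carrier_vec n" and c: "c \<in> carrier_vec n"
  obtains P where "P holomorphic_on UNIV"
    "\<And>s. \<not> eigenvalue A s \<Longrightarrow> (resolvent A s *\<^sub>v b) \<bullet>c c = P s / det (s \<cdot>\<^sub>m 1\<^sub>m n - A)"
proof -
  let ?M = "\<lambda>s. s \<cdot>\<^sub>m 1\<^sub>m n - A"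
  define P where "P = (\<lambda>s. \<Sum>i<n. \<Sum>j<n. adj_mat (?M s) $$ (i, j) * b $ j * cnj (c $ i))"
  have M: "?M s \<in> carrier_mat n n" for s using A by (simp add: minus_carrier_mat)
  have "(\<lambda>s. adj_mat (?M s) $$ (i, j)) holomorphic_on UNIV" if ij: "i < n" "j < n" for i j
  proof -
    have "(\<lambda>s. det (mat_delete (?M s) j i)) holomorphic_on UNIV"
    proof (rule det_holomorphic)
      show "mat_delete (?M s) j i \<in> carrier_mat (n - 1) (n - 1)" for s
        using mat_delete_carrier[OF M] by blast
    next
      fix i' j' assume "i' < n - 1" "j' < n - 1"
      then show "(\<lambda>s. mat_delete (?M s) j i $$ (i', j')) holomorphic_on UNIV"
        using A by (auto simp: mat_delete_def one_mat_def intro!: holomorphic_intros)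
    qed
    then show ?thesis
      using ij A by (auto simp: adj_mat_def cofactor_def intro!: holomorphic_intros)
  qed
  then have "P holomorphic_on UNIV"
    unfolding P_def by (auto intro!: holomorphic_intros)
  moreover have "(resolvent A s *\<^sub>v b) \<bullet>c c = P s / det (?M s)" if s: "\<not> eigenvalue A s" for s
  proof -
    have d: "det (?M s) \<noteq> 0" using s eigenvalue_iff_det[OF A] by simp
    have R: "resolvent A s \<in> carrier_mat n n" using A s by simp
    have "P s = (adj_mat (?M s) *\<^sub>v b) \<bullet>c c"
      unfolding P_def using form_eq_sum[OF adj_mat(1)[OF M] b c] by simp
    also have "adj_mat (?M s) = det (?M s) \<cdot>\<^sub>m resolvent A s"
      using minv_eq_adj_mat[OF M d] A by (simp add: resolvent_def)
    also have "(\<dots> *\<^sub>v b) \<bullet>c c = det (?M s) * ((resolvent A s *\<^sub>v b) \<bullet>c c)"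
      using R b c by (simp add: smult_mat_mult_vec[of _ n n] smult_scalar_prod_distrib[of _ n])
    finally show ?thesis using d by simp
  qed
  ultimately show thesis by (rule that)
qed

lemma open_non_eigenvalues: "A \<in> carrier_mat n n \<Longrightarrow> open {s. \<not> eigenvalue (A::complex mat) s}"
  using finite_imp_closed[OF finite_eigenvalues, of A n] by (simp add: closed_def Compl_eq)

lemma eventually_non_eigenvalue:
  assumes "A \<in> carrier_mat n n"
  shows "eventually (\<lambda>s. \<not> eigenvalue (A::complex mat) s) (at z)"
  using islimpt_finite[OF finite_eigenvalues[OF assms], of z] by (simp add: islimpt_iff_eventually)

lemma char_det_holomorphic:
  assumes A: "A \<in> carrier_mat n n"
  shows "(\<lambda>s. det (s \<cdot>\<^sub>m 1\<^sub>m n - A)) holomorphic_on (S :: complex set)"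
  by (rule det_holomorphic[of _ n])
     (use A in \<open>auto simp: one_mat_def minus_carrier_mat intro!: holomorphic_intros\<close>)

lemma resolvent_form_holomorphic:
  assumes A: "A \<in> carrier_mat n n" and b: "b \<in> carrier_vec n" and c: "c \<in> carrier_vec n"
  shows "(\<lambda>s. (resolvent A s *\<^sub>v b) \<bullet>c c) holomorphic_on {s. \<not> eigenvalue A s}"
proof -
  obtain P where P: "P holomorphic_on UNIV"
    "\<And>s. \<not> eigenvalue A s \<Longrightarrow> (resolvent A s *\<^sub>v b) \<bullet>c c = P s / det (s \<cdot>\<^sub>m 1\<^sub>m n - A)"
    using resolvent_form_eq_quotient[OF assms] by blast
  have "(\<lambda>s. P s / det (s \<cdot>\<^sub>m 1\<^sub>m n - A)) holomorphic_on {s. \<not> eigenvalue A s}"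
    using P(1) A eigenvalue_iff_det[OF A]
    by (intro holomorphic_intros char_det_holomorphic) (auto elim: holomorphic_on_subset)
  then show ?thesis
    by (rule holomorphic_transform) (simp add: P(2))
qed

text \<open>At eigenvalues the value of \<open>resolvent\<close> is arbitrary, but meromorphy
  depends only on punctured neighbourhoods, where the form agrees with the quotient.\<close>

lemma resolvent_form_meromorphic:
  assumes A: "A \<in> carrier_mat n n" and b: "b \<in> carrier_vec n" and c: "c \<in> carrier_vec n"
  shows "(\<lambda>s. (resolvent A s *\<^sub>v b) \<bullet>c c) meromorphic_on S"
proof -
  obtain P where P: "P holomorphic_on UNIV"
    "\<And>s. \<not> eigenvalue A s \<Longrightarrow> (resolvent A s *\<^sub>v b) \<bullet>c c = P s / det (s \<cdot>\<^sub>m 1\<^sub>m n - A)"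
    using resolvent_form_eq_quotient[OF assms] by blast
  have "(\<lambda>s. P s / det (s \<cdot>\<^sub>m 1\<^sub>m n - A)) meromorphic_on S"
    using P(1) char_det_holomorphic[OF A, of UNIV]
    by (intro meromorphic_intros analytic_on_imp_meromorphic_on)
       (auto simp: analytic_on_holomorphic)
  moreover have "eventually (\<lambda>s. P s / det (s \<cdot>\<^sub>m 1\<^sub>m n - A) = (resolvent A s *\<^sub>v b) \<bullet>c c) (at z)" for z
    using eventually_non_eigenvalue[OF A] by eventually_elim (simp add: P(2))
  ultimately show ?thesis
    by (subst meromorphic_on_cong[OF _ refl, symmetric])
qed

lemma meromorphic_tendsto_or_is_pole:
  assumes "f meromorphic_on {z}" "\<not> is_pole f z"
  shows "\<exists>L. (f \<longlongrightarrow> L) (at z)"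
  using assms by (auto simp: meromorphic_at_iff not_essential_def)

section \<open>The resolvent at infinity\<close>

lemma eventually_non_eigenvalue_at_infinity:
  assumes "A \<in> carrier_mat n n"
  shows "eventually (\<lambda>s. \<not> eigenvalue (A::complex mat) s) at_infinity"
proof -
  obtain r where "\<And>s. eigenvalue A s \<Longrightarrow> norm s \<le> r"
    using finite_imp_bounded[OF finite_eigenvalues[OF assms]] unfolding bounded_iff by auto
  then show ?thesis
    unfolding eventually_at_infinity by (intro exI[of _ "r + 1"]) force
qed

text \<open>Summing moduli in \<open>s x = A x + b\<close> gives
  \<open>|s| N \<le> \<alpha> N + \<beta>\<close>, where \<open>N\<close>, \<open>\<alpha>\<close>
  and \<open>\<beta>\<close> are the entry sums of \<open>x\<close>, \<open>A\<close> and
  \<open>b\<close>. Hence \<open>N \<le> \<beta> / (|s| - \<alpha>)\<close> once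
  \<open>|s| > \<alpha>\<close>.\<close>

lemma resolvent_tendsto_0_at_infinity:
  assumes A: "A \<in> carrier_mat n n" and b: "b \<in> carrier_vec n" and i: "i < n"
  shows "((\<lambda>s. (resolvent A s *\<^sub>v b) $ i) \<longlongrightarrow> 0) at_infinity"
proof -
  define \<alpha> where "\<alpha> = (\<Sum>k<n. \<Sum>j<n. norm (A $$ (k, j)))"
  define \<beta> where "\<beta> = (\<Sum>k<n. norm (b $ k))"
  have nonneg: "0 \<le> \<alpha>" "0 \<le> \<beta>" by (auto simp: \<alpha>_def \<beta>_def intro!: sum_nonneg)
  have bound: "norm ((resolvent A s *\<^sub>v b) $ i) \<le> \<beta> / (norm s - \<alpha>)"
    if s: "\<not> eigenvalue A s" and big: "norm s > \<alpha>" for s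
  proof -
    define x where "x = resolvent A s *\<^sub>v b"
    have x: "x \<in> carrier_vec n" using A b s by (simp add: x_def)
    define N where "N = (\<Sum>k<n. norm (x $ k))"
    have "norm s * N = (\<Sum>k<n. norm ((s \<cdot>\<^sub>v x) $ k))"
      using x by (auto simp: N_def sum_distrib_left norm_mult intro!: sum.cong)
    also have "\<dots> = (\<Sum>k<n. norm ((\<Sum>j<n. A $$ (k, j) * x $ j) + b $ k))"
      using resolvent_solves[OF A s b] A b x
      by (auto simp: x_def[symmetric] scalar_prod_def atLeast0LessThan intro!: sum.cong)
    also have "\<dots> \<le> (\<Sum>k<n. (\<Sum>j<n. norm (A $$ (k, j)) * N) + norm (b $ k))"
    proof (intro sum_mono norm_triangle_mono order_refl)
      fix k assume "k \<in> {..<n}"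
      show "norm (\<Sum>j<n. A $$ (k, j) * x $ j) \<le> (\<Sum>j<n. norm (A $$ (k, j)) * N)"
        by (intro order_trans[OF norm_sum] sum_mono)
           (auto simp: norm_mult N_def intro!: mult_left_mono member_le_sum)
    qed
    also have "\<dots> = \<alpha> * N + \<beta>"
      by (simp add: sum.distrib \<alpha>_def \<beta>_def sum_distrib_right)
    finally have "N \<le> \<beta> / (norm s - \<alpha>)"
      using big by (simp add: field_simps)
    moreover have "norm (x $ i) \<le> N"
      using i by (auto simp: N_def intro!: member_le_sum)
    ultimately show ?thesis by (simp add: x_def)
  qed
  have "eventually (\<lambda>s. norm s > \<alpha>) (at_infinity :: complex filter)"
    unfolding eventually_at_infinity by (intro exI[of _ "\<alpha> + 1"]) auto
  with eventually_non_eigenvalue_at_infinity[OF A]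
  have ev: "eventually (\<lambda>s. \<not> eigenvalue A s \<and> norm s > \<alpha>) at_infinity"
    by (rule eventually_conj)
  have "((\<lambda>t. \<beta> / (t - \<alpha>)) \<longlongrightarrow> 0) at_top"
    by real_asymp
  then have "((\<lambda>s::complex. \<beta> / (norm s - \<alpha>)) \<longlongrightarrow> 0) at_infinity"
    by (rule filterlim_compose[OF _ filterlim_norm_at_top])
  then show ?thesis
    by (rule Lim_null_comparison[rotated])
       (use ev bound in \<open>auto elim: eventually_mono\<close>)
qed

lemma resolvent_form_tendsto_0_at_infinity:
  assumes A: "A \<in> carrier_mat n n" and b: "b \<in> carrier_vec n" and c: "c \<in> carrier_vec n"
  shows "((\<lambda>s. (resolvent A s *\<^sub>v b) \<bullet>c c) \<longlongrightarrow> 0) at_infinity"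
proof -
  have "((\<lambda>s. \<Sum>i<n. (resolvent A s *\<^sub>v b) $ i * cnj (c $ i)) \<longlongrightarrow> 0) at_infinity"
    by (intro tendsto_null_sum tendsto_mult_left_zero resolvent_tendsto_0_at_infinity[OF A b]) auto
  then show ?thesis using c by (simp add: scalar_prod_def atLeast0LessThan)
qed

text \<open>From \<open>s R(s) b = A R(s) b + b\<close>, whose first term on the right tends to
  zero.\<close>

lemma mult_resolvent_form_tendsto_at_infinity:
  assumes A: "A \<in> carrier_mat n n" and b: "b \<in> carrier_vec n" and c: "c \<in> carrier_vec n"
  shows "((\<lambda>s. s * ((resolvent A s *\<^sub>v b) \<bullet>c c)) \<longlongrightarrow> b \<bullet>c c) at_infinity"
proof -
  have "((\<lambda>s. (\<Sum>i<n. \<Sum>j<n. A $$ (i, j) * (resolvent A s *\<^sub>v b) $ j * cnj (c $ i)) + b \<bullet>c c) \<longlongrightarrow>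
      0 + b \<bullet>c c) at_infinity"
    by (intro tendsto_add tendsto_const tendsto_null_sum tendsto_mult_left_zero
        tendsto_mult_right_zero resolvent_tendsto_0_at_infinity[OF A b]) auto
  moreover have "eventually (\<lambda>s. (\<Sum>i<n. \<Sum>j<n. A $$ (i, j) * (resolvent A s *\<^sub>v b) $ j * cnj (c $ i)) + b \<bullet>c c
      = s * ((resolvent A s *\<^sub>v b) \<bullet>c c)) at_infinity"
    using eventually_non_eigenvalue_at_infinity[OF A]
  proof eventually_elim
    case (elim s)
    have x: "resolvent A s *\<^sub>v b \<in> carrier_vec n" using A b elim by simp
    have "s * ((resolvent A s *\<^sub>v b) \<bullet>c c) = (s \<cdot>\<^sub>v (resolvent A s *\<^sub>v b)) \<bullet>c c"
      using x c by (simp add: smult_scalar_prod_distrib[of _ n])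
    also have "\<dots> = (A *\<^sub>v (resolvent A s *\<^sub>v b)) \<bullet>c c + b \<bullet>c c"
      using resolvent_solves[OF A elim b] A x b c by (simp add: add_scalar_prod_distrib[of _ n])
    finally show ?case using form_eq_sum[OF A x c] by simp
  qed
  ultimately show ?thesis using tendsto_cong by force
qed

section \<open>Minimal realizations\<close>

text \<open>Subspaces are plain sets, so that a set comprehension given by some property of vectors
  can be inserted directly where invariant subspaces are required.\<close>

definition vec_subspace :: "nat \<Rightarrow> 'a::field vec set \<Rightarrow> bool" where
  "vec_subspace n S \<longleftrightarrow> S \<subseteq> carrier_vec n \<and> 0\<^sub>v n \<in> S \<and>
     (\<forall>x\<in>S. \<forall>y\<in>S. x + y \<in> S) \<and> (\<forall>a. \<forall>x\<in>S. a \<cdot>\<^sub>v x \<in> S)"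

lemma vec_subspaceI:
  assumes "S \<subseteq> carrier_vec n" "0\<^sub>v n \<in> S" "\<And>x y. x \<in> S \<Longrightarrow> y \<in> S \<Longrightarrow> x + y \<in> S"
    "\<And>a x. x \<in> S \<Longrightarrow> a \<cdot>\<^sub>v x \<in> S"
  shows "vec_subspace n S"
  using assms by (simp add: vec_subspace_def)

lemma vec_subspaceD:
  assumes "vec_subspace n S"
  shows "x \<in> S \<Longrightarrow> x \<in> carrier_vec n" "0\<^sub>v n \<in> S" "x \<in> S \<Longrightarrow> y \<in> S \<Longrightarrow> x + y \<in> S"
    "x \<in> S \<Longrightarrow> a \<cdot>\<^sub>v x \<in> S"
  using assms by (auto simp: vec_subspace_def)

lemma vec_subspace_mult_vec:
  assumes S: "vec_subspace n S" and M: "M \<in> carrier_mat n k"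
    and cols: "\<And>j. j < k \<Longrightarrow> col M j \<in> S" and a: "a \<in> carrier_vec k"
  shows "M *\<^sub>v a \<in> S"
proof -
  have "vec n (\<lambda>i. \<Sum>j<l. M $$ (i, j) * a $ j) \<in> S" if "l \<le> k" for l
    using that
  proof (induction l)
    case 0
    have "vec n (\<lambda>i. \<Sum>j<0. M $$ (i, j) * a $ j) = 0\<^sub>v n" by auto
    then show ?case using vec_subspaceD(2)[OF S] by simp
  next
    case (Suc l)
    have "vec n (\<lambda>i. \<Sum>j<Suc l. M $$ (i, j) * a $ j) =
        vec n (\<lambda>i. \<Sum>j<l. M $$ (i, j) * a $ j) + a $ l \<cdot>\<^sub>v col M l"
      using M Suc.prems by (intro eq_vecI) auto
    then show ?case using Suc cols[of l] vec_subspaceD(3,4)[OF S] by simp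
  qed
  moreover have "M *\<^sub>v a = vec n (\<lambda>i. \<Sum>j<k. M $$ (i, j) * a $ j)"
    using M a by (intro eq_vecI) (auto simp: scalar_prod_def atLeast0LessThan)
  ultimately show ?thesis by simp
qed

lemma mat_eq_of_mult_vec:
  fixes M N :: "'a::comm_ring_1 mat"
  assumes M: "M \<in> carrier_mat k n" and N: "N \<in> carrier_mat k n"
    and eq: "\<And>u. u \<in> carrier_vec n \<Longrightarrow> M *\<^sub>v u = N *\<^sub>v u"
  shows "M = N"
proof (rule eq_matI)
  fix i j assume "i < dim_row N" "j < dim_col N"
  then have ij: "i < k" "j < n" using N by auto
  have "(M *\<^sub>v unit_vec n j) $ i = (N *\<^sub>v unit_vec n j) $ i" using eq by simp
  then show "M $$ (i, j) = N $$ (i, j)" using ij M N by simp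
qed (use M N in auto)

text \<open>One Gram-Schmidt step. Since \<open>r\<close> is already orthogonal to the columns of
  \<open>T\<close>, only the normalization \<open>a = 1 / sqrt (r \<bullet> r)\<close>
  remains.\<close>

lemma orthonormal_extend:
  fixes T :: "real mat"
  assumes T: "T \<in> carrier_mat n d" and orth: "transpose_mat T * T = 1\<^sub>m d"
    and r: "r \<in> carrier_vec n" "r \<noteq> 0\<^sub>v n" and perp: "transpose_mat T *\<^sub>v r = 0\<^sub>v d"
  obtains T' a where "T' \<in> carrier_mat n (Suc d)" "transpose_mat T' * T' = 1\<^sub>m (Suc d)"
    "\<And>j. j < d \<Longrightarrow> col T' j = col T j" "col T' d = a \<cdot>\<^sub>v r"
proof -
  define a where "a = 1 / sqrt (r \<bullet> r)"
  define T' where "T' = mat n (Suc d) (\<lambda>(i, j). if j < d then T $$ (i, j) else a * r $ i)"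
  have pos: "r \<bullet> r > 0"
    using conjugate_square_greater_0_vec[OF r(1)] r(2) by simp
  have T': "T' \<in> carrier_mat n (Suc d)" by (simp add: T'_def)
  have colT: "col T' j = col T j" if "j < d" for j
    using that T by (intro eq_vecI) (auto simp: T'_def)
  have cold: "col T' d = a \<cdot>\<^sub>v r"
    using r by (intro eq_vecI) (auto simp: T'_def)
  have TT: "col T i \<bullet> col T j = (if i = j then 1 else 0)" if "i < d" "j < d" for i j
  proof -
    have "(transpose_mat T * T) $$ (i, j) = (1\<^sub>m d) $$ (i, j)" using orth by simp
    then show ?thesis using that T by simp
  qed
  have Tr: "col T i \<bullet> r = 0" if "i < d" for i
  proof -
    have "(transpose_mat T *\<^sub>v r) $ i = 0" using perp that by simp
    then show ?thesis using that T by simp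
  qed
  have rT: "r \<bullet> col T i = 0" if "i < d" for i
    using Tr[OF that] comm_scalar_prod[of r n "col T i"] r T that by simp
  have aa: "a * (a * (r \<bullet> r)) = 1"
    using pos by (simp add: a_def)
  have "transpose_mat T' * T' = 1\<^sub>m (Suc d)"
  proof (rule eq_matI)
    fix i j assume "i < dim_row (1\<^sub>m (Suc d))" "j < dim_col (1\<^sub>m (Suc d))"
    then have ij: "i < Suc d" "j < Suc d" by auto
    then have "(transpose_mat T' * T') $$ (i, j) = col T' i \<bullet> col T' j"
      using T' by simp
    also have "\<dots> = 1\<^sub>m (Suc d) $$ (i, j)"
      using ij T r colT[of i] colT[of j] cold TT[of i j] Tr[of i] rT[of j] aa
      by (cases "i < d"; cases "j < d") (auto simp: less_Suc_eq smult_scalar_prod_distrib[of _ n] scalar_prod_smult_distrib[of _ n])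
    finally show "(transpose_mat T' * T') $$ (i, j) = 1\<^sub>m (Suc d) $$ (i, j)" .
  qed (use T' in auto)
  then show thesis using that T' colT cold by blast
qed

text \<open>A maximal orthonormal family in \<open>W\<close> works: if some \<open>w\<close>
  differed from its projection, the residual would extend the family. A family of \<open>n\<close>
  columns would be an orthogonal matrix and force \<open>W\<close> to be the whole space. The
  transpose of \<open>T\<close> is the coordinate map on \<open>W\<close>.\<close>

lemma proper_subspace_orthonormal_basis:
  fixes W :: "real vec set"
  assumes W: "vec_subspace n W" and proper: "W \<noteq> carrier_vec n"
  obtains d T where "d < n" "T \<in> carrier_mat n d"
    "\<And>w. w \<in> W \<Longrightarrow> T *\<^sub>v (transpose_mat T *\<^sub>v w) = w" "\<And>a. a \<in> carrier_vec d \<Longrightarrow> T *\<^sub>v a \<in> W"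
proof -
  define P where "P d \<longleftrightarrow> d \<le> n \<and> (\<exists>T\<in>carrier_mat n d. transpose_mat T * T = 1\<^sub>m d \<and>
     (\<forall>j<d. col T j \<in> W))" for d
  have "P 0" unfolding P_def by (auto intro!: bexI[of _ "0\<^sub>m n 0"])
  moreover have "\<forall>d. P d \<longrightarrow> d \<le> n" by (simp add: P_def)
  ultimately obtain d where "P d" and max: "\<And>d'. P d' \<Longrightarrow> d' \<le> d"
    using GreatestI_nat[of P 0 n] Greatest_le_nat[of P _ n] by blast
  then obtain T where T: "T \<in> carrier_mat n d" and orth: "transpose_mat T * T = 1\<^sub>m d"
    and cols: "\<And>j. j < d \<Longrightarrow> col T j \<in> W" and "d \<le> n" unfolding P_def by blast
  have TW: "T *\<^sub>v a \<in> W" if "a \<in> carrier_vec d" for a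
    using vec_subspace_mult_vec[OF W T cols that] .
  have "d \<noteq> n"
  proof
    assume "d = n"
    then have "T * transpose_mat T = 1\<^sub>m n"
      using mat_mult_left_right_inverse[of "transpose_mat T" n T] T orth by simp
    then have "v \<in> W" if "v \<in> carrier_vec n" for v
      using TW[of "transpose_mat T *\<^sub>v v"] that T \<open>d = n\<close>
        assoc_mult_mat_vec[of T n n "transpose_mat T" n v] by simp
    then show False using proper W by (auto simp: vec_subspace_def)
  qed
  then have "d < n" using \<open>d \<le> n\<close> by simp
  moreover have "T *\<^sub>v (transpose_mat T *\<^sub>v w) = w" if w: "w \<in> W" for w
  proof (rule ccontr)
    assume neq: "T *\<^sub>v (transpose_mat T *\<^sub>v w) \<noteq> w"
    have wn: "w \<in> carrier_vec n" using vec_subspaceD(1)[OF W w] .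
    define t where "t = T *\<^sub>v (transpose_mat T *\<^sub>v w)"
    \<comment> \<open>Written with \<open>+\<close> and a scalar multiple so that membership in
      \<open>W\<close> follows from the closure rules.\<close>
    define r where "r = w + (-1) \<cdot>\<^sub>v t"
    have t: "t \<in> W" "t \<in> carrier_vec n" using TW T wn by (auto simp: t_def)
    have r: "r \<in> W" "r \<in> carrier_vec n"
      using vec_subspaceD[OF W] t w wn by (auto simp: r_def)
    have "r \<noteq> 0\<^sub>v n"
    proof
      assume "r = 0\<^sub>v n"
      have "t = w"
      proof (rule eq_vecI)
        fix i assume i: "i < dim_vec w"
        have "r $ i = 0" using \<open>r = 0\<^sub>v n\<close> i wn by simp
        then show "t $ i = w $ i" using i t wn by (simp add: r_def)
      qed (use t wn in auto)
      then show False using neq by (simp add: t_def)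
    qed
    moreover have "transpose_mat T *\<^sub>v r = 0\<^sub>v d"
    proof -
      have "transpose_mat T *\<^sub>v t = transpose_mat T *\<^sub>v w"
        using assoc_mult_mat_vec[of "transpose_mat T" d n T d "transpose_mat T *\<^sub>v w"] orth T wn
        by (simp add: t_def)
      then have "transpose_mat T *\<^sub>v r = transpose_mat T *\<^sub>v w + (-1) \<cdot>\<^sub>v (transpose_mat T *\<^sub>v w)"
        using T wn t unfolding r_def
        by (simp add: mult_add_distrib_mat_vec[of _ d n] mult_mat_vec[of _ d n])
      then show ?thesis using T wn by (intro eq_vecI) auto
    qed
    ultimately obtain T' a where T': "T' \<in> carrier_mat n (Suc d)"
      "transpose_mat T' * T' = 1\<^sub>m (Suc d)"
      "\<And>j. j < d \<Longrightarrow> col T' j = col T j" "col T' d = a \<cdot>\<^sub>v r"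
      using orthonormal_extend[OF T orth r(2)] by blast
    then have "P (Suc d)"
      unfolding P_def using \<open>d < n\<close> cols vec_subspaceD(4)[OF W r(1)]
      by (auto simp: less_Suc_eq intro!: bexI[of _ T'])
    then show False using max by fastforce
  qed
  ultimately show thesis using that T TW by blast
qed

section \<open>Controllability from minimality\<close>

lemma state_spaceD:
  assumes "state_space m n A B C D"
  shows "A \<in> carrier_mat n n" "B \<in> carrier_mat n m" "C \<in> carrier_mat m n" "D \<in> carrier_mat m m"
  using assms by (auto simp: state_space_def)

lemma transfer_eq_resolvent:
  "transfer A B C D s = cmat C * resolvent (cmat A) s * cmat B + cmat D"
  by (simp add: transfer_def resolvent_def)

lemma transfer_carrier [simp]:
  assumes "state_space m n A B C D"
  shows "transfer A B C D s \<in> carrier_mat m m"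
  using state_spaceD[OF assms] by (auto simp: transfer_def)

lemma transfer_mult_vec:
  assumes ss: "state_space m n A B C D" and s: "\<not> eigenvalue (cmat A) s" and u: "u \<in> carrier_vec m"
  shows "transfer A B C D s *\<^sub>v u =
    cmat C *\<^sub>v (resolvent (cmat A) s *\<^sub>v (cmat B *\<^sub>v u)) + cmat D *\<^sub>v u"
proof -
  note d = state_spaceD[OF ss]
  have R: "resolvent (cmat A) s \<in> carrier_mat n n" using d s by simp
  have c: "cmat B \<in> carrier_mat n m" "cmat C \<in> carrier_mat m n" "cmat D \<in> carrier_mat m m"
    using d by auto
  have CR: "cmat C * resolvent (cmat A) s \<in> carrier_mat m n" using R c by simp
  have "transfer A B C D s *\<^sub>v u =
      (cmat C * resolvent (cmat A) s * cmat B) *\<^sub>v u + cmat D *\<^sub>v u"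
    unfolding transfer_eq_resolvent by (rule add_mult_distrib_mat_vec[of _ m m]) (use CR c u in auto)
  also have "(cmat C * resolvent (cmat A) s * cmat B) *\<^sub>v u =
      (cmat C * resolvent (cmat A) s) *\<^sub>v (cmat B *\<^sub>v u)"
    by (rule assoc_mult_mat_vec[OF CR c(1) u])
  also have "\<dots> = cmat C *\<^sub>v (resolvent (cmat A) s *\<^sub>v (cmat B *\<^sub>v u))"
    by (rule assoc_mult_mat_vec[OF c(2) R]) (use c u in simp)
  finally show ?thesis .
qed

text \<open>If \<open>W\<close> were proper, compression to it would give a realization of smaller
  dimension \<open>d\<close>: invariance yields \<open>T A1 = A T\<close> and
  \<open>T B1 = B\<close>, so \<open>T\<close> carries solutions of the small state equation to
  solutions of the large one, with the same output.\<close>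

lemma minimal_realization_reachable:
  assumes min: "minimal_realization m n A B C D"
    and W: "vec_subspace n W" and inv: "\<And>x. x \<in> W \<Longrightarrow> A *\<^sub>v x \<in> W"
    and BW: "\<And>u. u \<in> carrier_vec m \<Longrightarrow> B *\<^sub>v u \<in> W"
  shows "W = carrier_vec n"
proof (rule ccontr)
  assume "W \<noteq> carrier_vec n"
  then obtain d T where "d < n" and T: "T \<in> carrier_mat n d"
    and proj: "\<And>w. w \<in> W \<Longrightarrow> T *\<^sub>v (transpose_mat T *\<^sub>v w) = w"
    and TW: "\<And>a. a \<in> carrier_vec d \<Longrightarrow> T *\<^sub>v a \<in> W"
    using proper_subspace_orthonormal_basis[OF W] by metis
  have ss: "state_space m n A B C D" using min by (simp add: minimal_realization_def)
  note dim = state_spaceD[OF ss]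
  define A1 where "A1 = transpose_mat T * (A * T)"
  define B1 where "B1 = transpose_mat T * B"
  define C1 where "C1 = C * T"
  have dim1: "A1 \<in> carrier_mat d d" "B1 \<in> carrier_mat d m" "C1 \<in> carrier_mat m d"
    using T dim by (auto simp: A1_def B1_def C1_def)
  have ss1: "state_space m d A1 B1 C1 D" using dim1 dim by (simp add: state_space_def)
  have TA1: "T * A1 = A * T"
  proof (rule mat_eq_of_mult_vec[of _ n d])
    fix u :: "real vec" assume u: "u \<in> carrier_vec d"
    have "(T * A1) *\<^sub>v u = T *\<^sub>v (transpose_mat T *\<^sub>v (A *\<^sub>v (T *\<^sub>v u)))"
      unfolding A1_def using T dim u
      by (simp add: assoc_mult_mat_vec[of _ n d _ d] assoc_mult_mat_vec[of _ d n _ d]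
          assoc_mult_mat_vec[of _ n n _ d])
    also have "\<dots> = A *\<^sub>v (T *\<^sub>v u)" using proj inv TW u by simp
    finally show "(T * A1) *\<^sub>v u = (A * T) *\<^sub>v u" using T dim u by simp
  qed (use T dim dim1 in auto)
  have TB1: "T * B1 = B"
  proof (rule mat_eq_of_mult_vec[of _ n m])
    fix u :: "real vec" assume u: "u \<in> carrier_vec m"
    then show "(T * B1) *\<^sub>v u = B *\<^sub>v u"
      unfolding B1_def using T dim proj BW
      by (simp add: assoc_mult_mat_vec[of _ n d _ m] assoc_mult_mat_vec[of _ d n _ m])
  qed (use T dim dim1 in auto)
  let ?T = "cmat T" and ?A = "cmat A" and ?B = "cmat B" and ?A1 = "cmat A1" and ?B1 = "cmat B1"
  have c: "?T \<in> carrier_mat n d" "?A \<in> carrier_mat n n" "?B \<in> carrier_mat n m"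
    "?A1 \<in> carrier_mat d d" "?B1 \<in> carrier_mat d m" "cmat C \<in> carrier_mat m n"
    using T dim dim1 by auto
  have TA1': "?T * ?A1 = ?A * ?T" and TB1': "?T * ?B1 = ?B" and C1': "cmat C1 = cmat C * ?T"
    using arg_cong[OF TA1, of cmat] arg_cong[OF TB1, of cmat] T dim dim1
    by (simp_all add: of_real_hom.mat_hom_mult C1_def)
  have "same_transfer A B C D A1 B1 C1 D"
    unfolding same_transfer_def
  proof (intro allI impI)
    fix s assume s: "\<not> eigenvalue ?A s" and s1: "\<not> eigenvalue ?A1 s"
    show "transfer A B C D s = transfer A1 B1 C1 D s"
    proof (rule mat_eq_of_mult_vec[OF transfer_carrier[OF ss] transfer_carrier[OF ss1]])
      fix u :: "complex vec" assume u: "u \<in> carrier_vec m"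
      define x where "x = resolvent ?A1 s *\<^sub>v (?B1 *\<^sub>v u)"
      have x: "x \<in> carrier_vec d" using c s1 u by (simp add: x_def)
      have "s \<cdot>\<^sub>v x = ?A1 *\<^sub>v x + ?B1 *\<^sub>v u"
        unfolding x_def using c s1 u by (intro resolvent_solves[of _ d]) auto
      then have "?T *\<^sub>v (s \<cdot>\<^sub>v x) = ?T *\<^sub>v (?A1 *\<^sub>v x) + ?T *\<^sub>v (?B1 *\<^sub>v u)"
        using c x u by (simp add: mult_add_distrib_mat_vec[of _ n d])
      then have "s \<cdot>\<^sub>v (?T *\<^sub>v x) = (?T * ?A1) *\<^sub>v x + (?T * ?B1) *\<^sub>v u"
        using c x u by (simp add: mult_mat_vec[of _ n d])
      then have "s \<cdot>\<^sub>v (?T *\<^sub>v x) = ?A *\<^sub>v (?T *\<^sub>v x) + ?B *\<^sub>v u"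
        using c x u by (simp add: TA1' TB1')
      then have "resolvent ?A s *\<^sub>v (?B *\<^sub>v u) = ?T *\<^sub>v x"
        using c s x u by (intro resolvent_unique[of _ n]) auto
      then show "transfer A B C D s *\<^sub>v u = transfer A1 B1 C1 D s *\<^sub>v u"
        using transfer_mult_vec[OF ss s u] transfer_mult_vec[OF ss1 s1 u] c x
        by (simp add: C1' x_def)
    qed
  qed
  then have "n \<le> d" using min ss1 unfolding minimal_realization_def by blast
  with \<open>d < n\<close> show False by simp
qed

text \<open>The geometric form of controllability, taken in place of a rank condition on
  \<open>[B, A B, ...]\<close> because it is applied as an induction rule over states.\<close>

definition controllable :: "complex mat \<Rightarrow> complex mat \<Rightarrow> bool" where
  "controllable A B \<longleftrightarrow> (\<forall>S. vec_subspace (dim_row A) S \<longrightarrow> (\<forall>x\<in>S. A *\<^sub>v x \<in> S) \<longrightarrow>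
     (\<forall>u\<in>carrier_vec (dim_col B). B *\<^sub>v u \<in> S) \<longrightarrow> S = carrier_vec (dim_row A))"

lemma controllableD:
  assumes "controllable A B" "A \<in> carrier_mat n n" "B \<in> carrier_mat n m" "vec_subspace n S"
    "\<And>x. x \<in> S \<Longrightarrow> A *\<^sub>v x \<in> S" "\<And>u. u \<in> carrier_vec m \<Longrightarrow> B *\<^sub>v u \<in> S"
    "x \<in> carrier_vec n"
  shows "x \<in> S"
  using assms unfolding controllable_def by (metis carrier_matD)

text \<open>Minimality compares real realizations, while the applications use complex vectors. The
  real vectors inside a complex invariant subspace form a real invariant subspace; it is everything,
  so the complex one contains all unit vectors.\<close>

lemma minimal_realization_controllable:
  assumes min: "minimal_realization m n A B C D"
  shows "controllable (cmat A) (cmat B)"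
proof -
  have dim: "A \<in> carrier_mat n n" "B \<in> carrier_mat n m"
    using min by (auto simp: minimal_realization_def state_space_def)
  have "S = carrier_vec n" if S: "vec_subspace n S" and inv: "\<And>x. x \<in> S \<Longrightarrow> cmat A *\<^sub>v x \<in> S"
    and BS: "\<And>u. u \<in> carrier_vec m \<Longrightarrow> cmat B *\<^sub>v u \<in> S" for S
  proof -
    let ?c = "map_vec complex_of_real"
    define W where "W = {w \<in> carrier_vec n. ?c w \<in> S}"
    have "W = carrier_vec n"
    proof (rule minimal_realization_reachable[OF min])
      show "vec_subspace n W"
      proof (rule vec_subspaceI)
        fix x y assume "x \<in> W" "y \<in> W"
        moreover from this have "?c (x + y) = ?c x + ?c y" by (intro eq_vecI) (auto simp: W_def)
        ultimately show "x + y \<in> W" using vec_subspaceD(3)[OF S] by (simp add: W_def)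
      qed (use vec_subspaceD[OF S] in \<open>auto simp: W_def of_real_hom.vec_hom_zero of_real_hom.vec_hom_smult\<close>)
    next
      fix x assume "x \<in> W"
      then show "A *\<^sub>v x \<in> W"
        using inv dim by (auto simp: W_def of_real_hom.mult_mat_vec_hom[of _ n n])
    next
      fix u :: "real vec" assume "u \<in> carrier_vec m"
      then show "B *\<^sub>v u \<in> W"
        using BS[of "?c u"] dim by (auto simp: W_def of_real_hom.mult_mat_vec_hom[of _ n m])
    qed
    moreover have "?c (unit_vec n j) = unit_vec n j" for j
      by (intro eq_vecI) (auto simp: unit_vec_def)
    ultimately have unit: "unit_vec n j \<in> S" for j
      unfolding W_def by (metis (mono_tags, lifting) mem_Collect_eq unit_vec_carrier)
    have "x \<in> S" if "x \<in> carrier_vec n" for x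
      using vec_subspace_mult_vec[OF S one_carrier_mat _ that] unit that by simp
    then show ?thesis using vec_subspaceD(1)[OF S] by blast
  qed
  then show ?thesis using dim by (auto simp: controllable_def)
qed

section \<open>Duality by transposition\<close>

lemma minv_unique:
  fixes M :: "'a::field mat"
  assumes M: "M \<in> carrier_mat n n" and N: "N \<in> carrier_mat n n" and NM: "N * M = 1\<^sub>m n"
  shows "minv M = N"
proof -
  have "det N * det M = 1" using det_mult[OF N M] NM by simp
  then have "det M \<noteq> 0" by auto
  note inv = minv_inverse[OF M this]
  have "N = N * (M * minv M)" using inv N by simp
  also have "\<dots> = minv M" using assoc_mult_mat[OF N M inv(1)] NM inv by simp
  finally show ?thesis by simp
qed

lemma transpose_shift:
  assumes "A \<in> carrier_mat n n"
  shows "s \<cdot>\<^sub>m 1\<^sub>m n - transpose_mat A = transpose_mat (s \<cdot>\<^sub>m 1\<^sub>m n - (A :: 'a::comm_ring_1 mat))"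
  using assms by (intro eq_matI) auto

lemma resolvent_transpose:
  assumes A: "A \<in> carrier_mat n n" and s: "\<not> eigenvalue A s"
  shows "resolvent (transpose_mat A) s = transpose_mat (resolvent A s)"
proof -
  let ?M = "s \<cdot>\<^sub>m 1\<^sub>m n - A"
  have M: "?M \<in> carrier_mat n n" using A by (simp add: minus_carrier_mat)
  have R: "resolvent A s \<in> carrier_mat n n" using A s by simp
  have MR: "?M * resolvent A s = 1\<^sub>m n"
    using minv_inverse(2)[OF M] A s eigenvalue_iff_det[OF A] by (simp add: resolvent_def)
  have "minv (transpose_mat ?M) = transpose_mat (resolvent A s)"
    using M R transpose_mult[OF M R] MR by (intro minv_unique[of _ n]) auto
  then show ?thesis
    using A transpose_shift[OF A] by (simp add: resolvent_def)
qed

lemma cmat_transpose: "cmatT M = transpose_mat (cmat M)"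
  by (intro eq_matI) auto

lemma transfer_transpose:
  assumes ss: "state_space m n A B C D" and s: "\<not> eigenvalue (cmat A) s"
  shows "transfer (transpose_mat A) (transpose_mat C) (transpose_mat B) (transpose_mat D) s =
    transpose_mat (transfer A B C D s)"
proof -
  note d = state_spaceD[OF ss]
  have c: "cmat A \<in> carrier_mat n n" "cmat B \<in> carrier_mat n m" "cmat C \<in> carrier_mat m n"
    "cmat D \<in> carrier_mat m m" using d by auto
  have R: "resolvent (cmat A) s \<in> carrier_mat n n" using c s by simp
  have CR: "cmat C * resolvent (cmat A) s \<in> carrier_mat m n" using R c by simp
  have "transpose_mat (cmat C * resolvent (cmat A) s * cmat B) =
      transpose_mat (cmat B) * (transpose_mat (resolvent (cmat A) s) * transpose_mat (cmat C))"
    using transpose_mult[OF CR c(2)] transpose_mult[OF c(3) R] by simp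
  also have "\<dots> = transpose_mat (cmat B) * transpose_mat (resolvent (cmat A) s) * transpose_mat (cmat C)"
    using assoc_mult_mat[of "transpose_mat (cmat B)" m n "transpose_mat (resolvent (cmat A) s)" n
        "transpose_mat (cmat C)" m] c R by simp
  finally show ?thesis
    unfolding transfer_eq_resolvent cmat_transpose resolvent_transpose[OF c(1) s]
    using c CR by (simp add: transpose_add[of _ m m])
qed

lemma state_space_transpose:
  "state_space m n A B C D \<Longrightarrow>
    state_space m n (transpose_mat A) (transpose_mat C) (transpose_mat B) (transpose_mat D)"
  by (auto simp: state_space_def)

lemma same_transfer_transpose:
  assumes ss: "state_space m n A B C D" and ss': "state_space m n' A' B' C' D'"
    and same: "same_transfer (transpose_mat A) (transpose_mat C) (transpose_mat B) (transpose_mat D) A' B' C' D'"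
  shows "same_transfer A B C D (transpose_mat A') (transpose_mat C') (transpose_mat B') (transpose_mat D')"
  unfolding same_transfer_def
proof (intro allI impI)
  fix s assume s: "\<not> eigenvalue (cmat A) s" and "\<not> eigenvalue (cmat (transpose_mat A')) s"
  then have s': "\<not> eigenvalue (cmat A') s"
    using eigenvalue_transpose[of "cmat A'" n'] state_spaceD[OF ss'] by (simp add: cmat_transpose)
  have "\<not> eigenvalue (cmatT A) s"
    using s eigenvalue_transpose[of "cmat A" n] state_spaceD[OF ss] by (simp add: cmat_transpose)
  then have "transpose_mat (transfer A B C D s) = transfer A' B' C' D' s"
    using same s' transfer_transpose[OF ss s] by (simp add: same_transfer_def)
  then show "transfer A B C D s =
      transfer (transpose_mat A') (transpose_mat C') (transpose_mat B') (transpose_mat D') s"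
    using transfer_transpose[OF ss' s'] by (metis transpose_transpose)
qed

lemma minimal_realization_transpose:
  assumes "minimal_realization m n A B C D"
  shows "minimal_realization m n (transpose_mat A) (transpose_mat C) (transpose_mat B) (transpose_mat D)"
  unfolding minimal_realization_def
proof (intro conjI allI impI)
  have ss: "state_space m n A B C D" using assms by (simp add: minimal_realization_def)
  then show "state_space m n (transpose_mat A) (transpose_mat C) (transpose_mat B) (transpose_mat D)"
    by (rule state_space_transpose)
  fix n' A' B' C' D' assume ss': "state_space m n' A' B' C' D'"
    and "same_transfer (transpose_mat A) (transpose_mat C) (transpose_mat B) (transpose_mat D) A' B' C' D'"
  from same_transfer_transpose[OF ss this] state_space_transpose[OF ss'] assms
  show "n \<le> n'" unfolding minimal_realization_def by blast
qed

text \<open>Observability has no definition of its own: it is controllability of the dual system,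
  which inherits minimality.\<close>

lemma minimal_realization_observable:
  "minimal_realization m n A B C D \<Longrightarrow>
    controllable (cmatT A) (cmatT C)"
  using minimal_realization_controllable minimal_realization_transpose by blast

section \<open>Transfer functions\<close>

lemma resolvent_commute:
  assumes A: "A \<in> carrier_mat n n" and s: "\<not> eigenvalue A s" and b: "b \<in> carrier_vec n"
  shows "resolvent A s *\<^sub>v (A *\<^sub>v b) = A *\<^sub>v (resolvent A s *\<^sub>v b)"
proof (rule resolvent_unique[OF A s])
  let ?x = "resolvent A s *\<^sub>v b"
  have x: "?x \<in> carrier_vec n" using A s b by simp
  have "s \<cdot>\<^sub>v (A *\<^sub>v ?x) = A *\<^sub>v (s \<cdot>\<^sub>v ?x)" using A x by (simp add: mult_mat_vec[of _ n n])
  then show "s \<cdot>\<^sub>v (A *\<^sub>v ?x) = A *\<^sub>v (A *\<^sub>v ?x) + A *\<^sub>v b"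
    using A x b by (simp add: resolvent_solves[OF A s b] mult_add_distrib_mat_vec[of _ n n])
qed (use A s b in auto)

lemma mult_resolvent_form:
  assumes A: "A \<in> carrier_mat n n" and s: "\<not> eigenvalue A s" and b: "b \<in> carrier_vec n"
    and c: "c \<in> carrier_vec n"
  shows "(A *\<^sub>v (resolvent A s *\<^sub>v b)) \<bullet>c c = s * ((resolvent A s *\<^sub>v b) \<bullet>c c) - b \<bullet>c c"
proof -
  have "s * ((resolvent A s *\<^sub>v b) \<bullet>c c) = (s \<cdot>\<^sub>v (resolvent A s *\<^sub>v b)) \<bullet>c c"
    using A b c s by (simp add: smult_scalar_prod_distrib[of _ n])
  also have "\<dots> = (A *\<^sub>v (resolvent A s *\<^sub>v b)) \<bullet>c c + b \<bullet>c c"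
    unfolding resolvent_solves[OF A s b] using A b c s by (simp add: add_scalar_prod_distrib[of _ n])
  finally show ?thesis by simp
qed

section \<open>Complex conjugation and Hermitian forms\<close>

lemma conjugate_cmat_mult_vec:
  assumes "M \<in> carrier_mat k n" "x \<in> carrier_vec n"
  shows "conjugate (cmat M *\<^sub>v x) = cmat M *\<^sub>v conjugate x"
  using assms by (intro eq_vecI) (auto simp: scalar_prod_def intro!: sum.cong)

lemma conjugate_cscalar_prod:
  fixes x y :: "complex vec"
  assumes "x \<in> carrier_vec n" "y \<in> carrier_vec n"
  shows "conjugate x \<bullet>c conjugate y = cnj (x \<bullet>c y)"
  using assms by (auto simp: scalar_prod_def intro!: sum.cong)

lemma cscalar_prod_smult_right:
  fixes x y :: "complex vec"
  assumes "x \<in> carrier_vec n" "y \<in> carrier_vec n"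
  shows "x \<bullet>c (a \<cdot>\<^sub>v y) = cnj a * (x \<bullet>c y)"
  using assms by (simp add: conjugate_smult_vec scalar_prod_smult_distrib[of _ n])

lemma cscalar_prod_add_right:
  fixes x y z :: "complex vec"
  assumes "x \<in> carrier_vec n" "y \<in> carrier_vec n" "z \<in> carrier_vec n"
  shows "x \<bullet>c (y + z) = x \<bullet>c y + x \<bullet>c z"
  using assms by (simp add: conjugate_add_vec[of _ n] scalar_prod_add_distrib[of _ n])

lemma cscalar_prod_eq_0_imp_zero:
  fixes x :: "complex vec"
  assumes x: "x \<in> carrier_vec n" and eq: "\<And>y. y \<in> carrier_vec n \<Longrightarrow> x \<bullet>c y = 0"
  shows "x = 0\<^sub>v n"
  using conjugate_square_eq_0_vec[OF x] eq[OF x] by simp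

lemma eigenvalue_cnj:
  assumes A: "A \<in> carrier_mat n n" and ev: "eigenvalue (cmat A) s"
  shows "eigenvalue (cmat A) (cnj s)"
proof -
  obtain v where v: "v \<in> carrier_vec n" "v \<noteq> 0\<^sub>v n" "cmat A *\<^sub>v v = s \<cdot>\<^sub>v v"
    using eigenvalueE[OF _ ev] A by auto
  then have "cmat A *\<^sub>v conjugate v = cnj s \<cdot>\<^sub>v conjugate v"
    using conjugate_cmat_mult_vec[OF A v(1)] by (simp add: conjugate_smult_vec)
  then show ?thesis
    using A v by (intro eigenvalueI[of _ n "conjugate v"]) auto
qed

lemma eigenvalue_cnj_iff:
  "A \<in> carrier_mat n n \<Longrightarrow> eigenvalue (cmat A) (cnj s) \<longleftrightarrow> eigenvalue (cmat A) s"
  using eigenvalue_cnj[of A n s] eigenvalue_cnj[of A n "cnj s"] by auto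

lemma resolvent_cnj:
  assumes A: "A \<in> carrier_mat n n" and s: "\<not> eigenvalue (cmat A) s" and b: "b \<in> carrier_vec n"
  shows "resolvent (cmat A) (cnj s) *\<^sub>v conjugate b = conjugate (resolvent (cmat A) s *\<^sub>v b)"
proof (rule resolvent_unique[of _ n])
  have cA: "cmat A \<in> carrier_mat n n" using A by simp
  let ?x = "resolvent (cmat A) s *\<^sub>v b"
  have x: "?x \<in> carrier_vec n" using cA s b by simp
  have "conjugate (s \<cdot>\<^sub>v ?x) = conjugate (cmat A *\<^sub>v ?x + b)"
    using resolvent_solves[OF cA s b] by simp
  then show "cnj s \<cdot>\<^sub>v conjugate ?x = cmat A *\<^sub>v conjugate ?x + conjugate b"
    using cA x b conjugate_cmat_mult_vec[OF A x]
    by (simp add: conjugate_smult_vec conjugate_add_vec[of _ n])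
  show "conjugate ?x \<in> carrier_vec n" using x by simp
qed (use A s b eigenvalue_cnj_iff[OF A] in auto)

lemma mat_tendsto_form:
  assumes "mat_tendsto m F L net" "eventually (\<lambda>s. F s \<in> carrier_mat m m) net"
    "x \<in> carrier_vec m" "y \<in> carrier_vec m"
  shows "((\<lambda>s. (F s *\<^sub>v x) \<bullet>c y) \<longlongrightarrow> (L *\<^sub>v x) \<bullet>c y) net"
  using assms by (intro form_tendsto[of _ m m]) (auto simp: mat_tendsto_def)

lemma smult_form:
  fixes M :: "complex mat"
  assumes "M \<in> carrier_mat k n" "x \<in> carrier_vec n" "y \<in> carrier_vec k"
  shows "((a \<cdot>\<^sub>m M) *\<^sub>v x) \<bullet>c y = a * ((M *\<^sub>v x) \<bullet>c y)"
  using assms by (simp add: smult_mat_mult_vec[of _ k n] smult_scalar_prod_distrib[of _ k])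

lemma diff_form:
  fixes M N :: "complex mat"
  assumes "M \<in> carrier_mat k n" "N \<in> carrier_mat k n" "x \<in> carrier_vec n" "y \<in> carrier_vec k"
  shows "((M - N) *\<^sub>v x) \<bullet>c y = (M *\<^sub>v x) \<bullet>c y - (N *\<^sub>v x) \<bullet>c y"
  using assms by (simp add: minus_mult_distrib_mat_vec[of _ k n] minus_scalar_prod_distrib[of _ k])

lemma mat_adjoint_form:
  fixes M :: "complex mat"
  assumes M: "M \<in> carrier_mat m m" and x: "x \<in> carrier_vec m" and y: "y \<in> carrier_vec m"
  shows "mat_adjoint M \<in> carrier_mat m m"
    "(mat_adjoint M *\<^sub>v x) \<bullet>c y = cnj ((M *\<^sub>v y) \<bullet>c x)"
proof -
  have ent: "mat_adjoint M $$ (i, j) = cnj (M $$ (j, i))" if "i < m" "j < m" for i j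
    using that M by (simp add: mat_adjoint_def mat_of_rows_index)
  show c: "mat_adjoint M \<in> carrier_mat m m"
    using M unfolding mat_adjoint_def by (intro carrier_matI) auto
  have "(mat_adjoint M *\<^sub>v x) \<bullet>c y = (\<Sum>i<m. \<Sum>j<m. cnj (M $$ (j, i)) * x $ j * cnj (y $ i))"
    using form_eq_sum[OF c x y] ent by simp
  also have "\<dots> = (\<Sum>j<m. \<Sum>i<m. cnj (M $$ (j, i)) * x $ j * cnj (y $ i))"
    by (rule sum.swap)
  also have "\<dots> = cnj ((M *\<^sub>v y) \<bullet>c x)"
    using form_eq_sum[OF M y x] by (simp add: mult_ac)
  finally show "(mat_adjoint M *\<^sub>v x) \<bullet>c y = cnj ((M *\<^sub>v y) \<bullet>c x)" .
qed

text \<open>With \<open>a\<close> the value of the form of \<open>M\<close> at \<open>x\<close>, the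
  form on the left is \<open>\<i> (a - cnj a)\<close>. The matrix inequalities in \<open>NI\<close>
  and \<open>SNI\<close> thereby become sign conditions on an imaginary part.\<close>

lemma imaginary_part_form:
  fixes M :: "complex mat"
  assumes M: "M \<in> carrier_mat m m" and x: "x \<in> carrier_vec m"
  shows "Re (((\<i> \<cdot>\<^sub>m (M - mat_adjoint M)) *\<^sub>v x) \<bullet>c x) = - 2 * Im ((M *\<^sub>v x) \<bullet>c x)"
  using mat_adjoint_form[OF M x x] M x
  by (simp add: smult_form[of _ m m] diff_form[of _ m m] minus_carrier_mat)

lemma hermitian_form:
  assumes "hermitian_mat M" "M \<in> carrier_mat m m" "x \<in> carrier_vec m" "y \<in> carrier_vec m"
  shows "(M *\<^sub>v x) \<bullet>c y = cnj ((M *\<^sub>v y) \<bullet>c x)"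
  using mat_adjoint_form(2)[OF assms(2-4)] assms(1) by (simp add: hermitian_mat_def)

lemma filterlim_cnj_at: "filterlim cnj (at (cnj z)) (at z)"
  unfolding filterlim_at by (auto intro!: tendsto_eq_intros simp: eventually_at_filter)

section \<open>Minimal systems: poles and eigenvalues\<close>

locale minimal_system =
  fixes m n :: nat and A B C D :: "real mat"
  assumes minimal: "minimal_realization m n A B C D"
begin

abbreviation R where "R \<equiv> resolvent (cmat A)"
abbreviation G where "G \<equiv> transfer A B C D"

abbreviation Rform where "Rform s b c \<equiv> (R s *\<^sub>v b) \<bullet>c c"
abbreviation Gform where "Gform s u v \<equiv> (G s *\<^sub>v u) \<bullet>c v"

lemma state_space: "state_space m n A B C D"
  using minimal by (simp add: minimal_realization_def)

lemmas real_dims = state_spaceD[OF state_space]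

lemma dims [simp]:
  "cmat A \<in> carrier_mat n n" "cmat B \<in> carrier_mat n m" "cmat C \<in> carrier_mat m n"
  "cmat D \<in> carrier_mat m m" "cmatT A \<in> carrier_mat n n"
  "cmatT C \<in> carrier_mat n m" "G s \<in> carrier_mat m m"
  using real_dims transfer_carrier[OF state_space] by auto

lemma vec_dims [simp]:
  "x \<in> carrier_vec n \<Longrightarrow> cmat A *\<^sub>v x \<in> carrier_vec n"
  "u \<in> carrier_vec m \<Longrightarrow> cmat B *\<^sub>v u \<in> carrier_vec n"
  "x \<in> carrier_vec n \<Longrightarrow> cmat C *\<^sub>v x \<in> carrier_vec m"
  "u \<in> carrier_vec m \<Longrightarrow> cmat D *\<^sub>v u \<in> carrier_vec m"
  "x \<in> carrier_vec n \<Longrightarrow> cmatT A *\<^sub>v x \<in> carrier_vec n"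
  "u \<in> carrier_vec m \<Longrightarrow> cmatT C *\<^sub>v u \<in> carrier_vec n"
  "u \<in> carrier_vec m \<Longrightarrow> G s *\<^sub>v u \<in> carrier_vec m"
  by (rule mult_mat_vec_carrier, rule dims, assumption)+

lemma R_dim [simp]: "\<not> eigenvalue (cmat A) s \<Longrightarrow> b \<in> carrier_vec n \<Longrightarrow> R s *\<^sub>v b \<in> carrier_vec n"
  by (rule resolvent_vec_carrier[OF dims(1)])

lemma controllable_induct:
  assumes S: "vec_subspace n S" and "\<And>x. x \<in> S \<Longrightarrow> cmat A *\<^sub>v x \<in> S"
    and "\<And>u. u \<in> carrier_vec m \<Longrightarrow> cmat B *\<^sub>v u \<in> S" and "x \<in> carrier_vec n"
  shows "x \<in> S"
  using controllableD[OF minimal_realization_controllable[OF minimal] dims(1,2) S] assms by blast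

lemma observable_induct:
  assumes S: "vec_subspace n S" and "\<And>x. x \<in> S \<Longrightarrow> cmatT A *\<^sub>v x \<in> S"
    and "\<And>u. u \<in> carrier_vec m \<Longrightarrow> cmatT C *\<^sub>v u \<in> S" and "x \<in> carrier_vec n"
  shows "x \<in> S"
  using controllableD[OF minimal_realization_observable[OF minimal] dims(5,6) S] assms by blast

lemma G_mult_vec:
  assumes "\<not> eigenvalue (cmat A) s" "u \<in> carrier_vec m"
  shows "G s *\<^sub>v u = cmat C *\<^sub>v (R s *\<^sub>v (cmat B *\<^sub>v u)) + cmat D *\<^sub>v u"
  using transfer_mult_vec[OF state_space assms] .

lemma A_adjoint:
  "x \<in> carrier_vec n \<Longrightarrow> y \<in> carrier_vec n \<Longrightarrow>
    (cmat A *\<^sub>v x) \<bullet>c y = x \<bullet>c (cmatT A *\<^sub>v y)"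
  using cmat_adjoint[OF real_dims(1)] by blast

lemma C_adjoint:
  "x \<in> carrier_vec n \<Longrightarrow> y \<in> carrier_vec m \<Longrightarrow>
    (cmat C *\<^sub>v x) \<bullet>c y = x \<bullet>c (cmatT C *\<^sub>v y)"
  using cmat_adjoint[OF real_dims(3)] by blast

lemma G_form:
  assumes "\<not> eigenvalue (cmat A) s" "u \<in> carrier_vec m" "v \<in> carrier_vec m"
  shows "Gform s u v =
    Rform s (cmat B *\<^sub>v u) (cmatT C *\<^sub>v v) + (cmat D *\<^sub>v u) \<bullet>c v"
  using assms by (simp add: G_mult_vec add_scalar_prod_distrib[of _ m] C_adjoint)

text \<open>The realization is real, so everything commutes with conjugation. This is how conditions
  imposed for \<open>w > 0\<close> reach negative frequencies.\<close>

lemma G_form_cnj: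
  assumes s: "\<not> eigenvalue (cmat A) s" and u: "u \<in> carrier_vec m" and v: "v \<in> carrier_vec m"
  shows "(G (cnj s) *\<^sub>v conjugate u) \<bullet>c conjugate v = cnj (Gform s u v)"
proof -
  have s': "\<not> eigenvalue (cmat A) (cnj s)" using s eigenvalue_cnj_iff[OF real_dims(1)] by simp
  have "G (cnj s) *\<^sub>v conjugate u = conjugate (G s *\<^sub>v u)"
    using s u v s'
    by (simp add: G_mult_vec conjugate_add_vec[of _ m] conjugate_cmat_mult_vec[OF real_dims(3)]
        conjugate_cmat_mult_vec[OF real_dims(4)] conjugate_cmat_mult_vec[OF real_dims(2), symmetric]
        resolvent_cnj[OF real_dims(1)])
  then show ?thesis using conjugate_cscalar_prod[of "G s *\<^sub>v u" m v] u v by simp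
qed

lemma G_axis_form_cnj:
  assumes ne: "\<not> eigenvalue (cmat A) (axis w)" and x: "x \<in> carrier_vec m"
  shows "Re (axis w * ((G (axis w) *\<^sub>v x) \<bullet>c x)) =
    w * Im ((G (axis (- w)) *\<^sub>v conjugate x) \<bullet>c conjugate x)"
  using G_form_cnj[OF ne x x] by simp

lemma G_form_holomorphic:
  assumes "u \<in> carrier_vec m" "v \<in> carrier_vec m"
  shows "(\<lambda>s. Gform s u v) holomorphic_on {s. \<not> eigenvalue (cmat A) s}"
proof (rule holomorphic_transform)
  show "(\<lambda>s. Rform s (cmat B *\<^sub>v u) (cmatT C *\<^sub>v v) + (cmat D *\<^sub>v u) \<bullet>c v)
      holomorphic_on {s. \<not> eigenvalue (cmat A) s}"
    using assms by (intro holomorphic_intros resolvent_form_holomorphic[OF dims(1)]) auto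
qed (use assms in \<open>simp add: G_form\<close>)

lemma eventually_not_eigenvalue: "eventually (\<lambda>s. \<not> eigenvalue (cmat A) s) (at z)"
  by (rule eventually_non_eigenvalue[OF dims(1)])

lemma G_form_meromorphic:
  assumes "u \<in> carrier_vec m" "v \<in> carrier_vec m"
  shows "(\<lambda>s. Gform s u v) meromorphic_on S"
proof -
  have "(\<lambda>s. Rform s (cmat B *\<^sub>v u) (cmatT C *\<^sub>v v) + (cmat D *\<^sub>v u) \<bullet>c v)
      meromorphic_on S"
    using assms by (intro meromorphic_intros resolvent_form_meromorphic[OF dims(1)]) auto
  moreover have "eventually (\<lambda>s. Rform s (cmat B *\<^sub>v u) (cmatT C *\<^sub>v v) + (cmat D *\<^sub>v u) \<bullet>c v
      = Gform s u v) (at z)" for z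
    using eventually_not_eigenvalue by eventually_elim (use assms in \<open>simp add: G_form\<close>)
  ultimately show ?thesis
    by (subst meromorphic_on_cong[OF _ refl, symmetric])
qed

text \<open>Absence of a pole only says that no entry tends to infinity; meromorphy of the entries
  upgrades this to a finite limit.\<close>

lemma no_pole_form_tendsto:
  assumes z: "\<not> has_pole_at m G z" and u: "u \<in> carrier_vec m" and v: "v \<in> carrier_vec m"
  shows "\<exists>L. ((\<lambda>s. Gform s u v) \<longlongrightarrow> L) (at z)"
proof -
  have "\<exists>L. ((\<lambda>s. G s $$ (i, j)) \<longlongrightarrow> L) (at z)" if ij: "i < m" "j < m" for i j
  proof (rule meromorphic_tendsto_or_is_pole)
    have "(\<lambda>s. Gform s (unit_vec m j) (unit_vec m i)) meromorphic_on {z}"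
      by (intro G_form_meromorphic) auto
    then show "(\<lambda>s. G s $$ (i, j)) meromorphic_on {z}"
      using form_unit_vec[OF dims(7) ij] by simp
    show "\<not> is_pole (\<lambda>s. G s $$ (i, j)) z" using z ij by (auto simp: has_pole_at_def)
  qed
  then obtain l where l: "\<And>i j. i < m \<Longrightarrow> j < m \<Longrightarrow> ((\<lambda>s. G s $$ (i, j)) \<longlongrightarrow> l i j) (at z)"
    by metis
  have "((\<lambda>s. Gform s u v) \<longlongrightarrow> (mat m m (\<lambda>(i, j). l i j) *\<^sub>v u) \<bullet>c v) (at z)"
    using u v l by (intro form_tendsto[of _ m m]) auto
  then show ?thesis by blast
qed

lemma tendsto_off_spectrum:
  assumes "(f \<longlongrightarrow> L) (at z)" "\<And>s. \<not> eigenvalue (cmat A) s \<Longrightarrow> f s = g s"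
  shows "(g \<longlongrightarrow> L) (at z)"
  by (rule Lim_transform_eventually[OF assms(1) eventually_mono[OF eventually_not_eigenvalue assms(2)]])

text \<open>The equation \<open>A R(s) = s R(s) - I\<close>, once on the input side and once on the
  output side.\<close>

lemma resolvent_form_shift:
  assumes s: "\<not> eigenvalue (cmat A) s" and "b \<in> carrier_vec n" "c \<in> carrier_vec n"
  shows "Rform s (cmat A *\<^sub>v b) c = s * Rform s b c - b \<bullet>c c"
    "Rform s b (cmatT A *\<^sub>v c) = s * Rform s b c - b \<bullet>c c"
  using assms mult_resolvent_form[OF dims(1) s] resolvent_commute[OF dims(1) s]
  by (simp_all add: A_adjoint[symmetric])

text \<open>By the resolvent equation, a property \<open>K\<close> of functions that is stable under multiplication
  by the variable holds for an \<open>A\<close>-invariant space of vectors \<open>b\<close>.\<close>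

lemma resolvent_form_induct:
  assumes add: "\<And>f g. K f \<Longrightarrow> K g \<Longrightarrow> K (\<lambda>s. f s + g s)"
    and scale: "\<And>a f. K f \<Longrightarrow> K (\<lambda>s. a * f s)"
    and shift: "\<And>f. K f \<Longrightarrow> K (\<lambda>s. s * f s)"
    and const: "\<And>a. K (\<lambda>s. \<phi> s * a)"
    and cong: "\<And>f g. K f \<Longrightarrow> (\<And>s. \<not> eigenvalue (cmat A) s \<Longrightarrow> f s = g s) \<Longrightarrow> K g"
    and inputs: "\<And>u. u \<in> carrier_vec m \<Longrightarrow> K (\<lambda>s. \<phi> s * Rform s (cmat B *\<^sub>v u) c)"
    and b: "b \<in> carrier_vec n" and c: "c \<in> carrier_vec n"
  shows "K (\<lambda>s. \<phi> s * Rform s b c)"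
proof -
  define S where "S = {b \<in> carrier_vec n. K (\<lambda>s. \<phi> s * Rform s b c)}"
  have "b \<in> S"
  proof (rule controllable_induct[OF _ _ _ b])
    show "vec_subspace n S"
    proof (rule vec_subspaceI)
      have "K (\<lambda>s. \<phi> s * ((R s *\<^sub>v 0\<^sub>v n) \<bullet>c c))"
        by (rule cong[OF const[of 0]]) (use c mult_mat_zero_vec[OF resolvent_carrier[OF dims(1)]] in simp)
      then show "0\<^sub>v n \<in> S" by (simp add: S_def)
    next
      fix x y assume xy: "x \<in> S" "y \<in> S"
      then have "K (\<lambda>s. \<phi> s * Rform s x c + \<phi> s * Rform s y c)"
        by (intro add) (auto simp: S_def)
      then have "K (\<lambda>s. \<phi> s * ((R s *\<^sub>v (x + y)) \<bullet>c c))"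
      proof (rule cong)
        fix s assume s: "\<not> eigenvalue (cmat A) s"
        have "R s *\<^sub>v (x + y) = R s *\<^sub>v x + R s *\<^sub>v y"
          using xy by (intro mult_add_distrib_mat_vec[OF resolvent_carrier[OF dims(1) s]]) (auto simp: S_def)
        then show "\<phi> s * Rform s x c + \<phi> s * Rform s y c = \<phi> s * ((R s *\<^sub>v (x + y)) \<bullet>c c)"
          using xy c s by (simp add: S_def add_scalar_prod_distrib[of _ n] distrib_left)
      qed
      then show "x + y \<in> S" using xy by (simp add: S_def)
    next
      fix a x assume x: "x \<in> S"
      then have "K (\<lambda>s. a * (\<phi> s * Rform s x c))"
        by (intro scale) (auto simp: S_def)
      then have "K (\<lambda>s. \<phi> s * ((R s *\<^sub>v (a \<cdot>\<^sub>v x)) \<bullet>c c))"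
      proof (rule cong)
        fix s assume s: "\<not> eigenvalue (cmat A) s"
        have "R s *\<^sub>v (a \<cdot>\<^sub>v x) = a \<cdot>\<^sub>v (R s *\<^sub>v x)"
          using x by (intro mult_mat_vec[OF resolvent_carrier[OF dims(1) s]]) (auto simp: S_def)
        then show "a * (\<phi> s * Rform s x c) = \<phi> s * ((R s *\<^sub>v (a \<cdot>\<^sub>v x)) \<bullet>c c)"
          using x c s by (simp add: S_def smult_scalar_prod_distrib[of _ n])
      qed
      then show "a \<cdot>\<^sub>v x \<in> S" using x by (simp add: S_def)
    qed (auto simp: S_def)
  next
    fix x assume x: "x \<in> S"
    \<comment> \<open>Replacing \<open>x\<close> by \<open>A x\<close> multiplies the form by
      \<open>s\<close> and subtracts a constant multiple of \<open>\<phi>\<close>, which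
      \<open>shift\<close> and \<open>const\<close> absorb.\<close>
    then have "K (\<lambda>s. s * (\<phi> s * Rform s x c) + \<phi> s * - (x \<bullet>c c))"
      by (intro add shift const) (auto simp: S_def)
    then have "K (\<lambda>s. \<phi> s * Rform s (cmat A *\<^sub>v x) c)"
      by (rule cong) (use x c in \<open>simp add: S_def resolvent_form_shift algebra_simps\<close>)
    then show "cmat A *\<^sub>v x \<in> S" using x by (simp add: S_def)
  qed (simp add: S_def inputs)
  then show ?thesis by (simp add: S_def)
qed

lemma resolvent_form_tendsto_0:
  assumes phi: "(\<phi> \<longlongrightarrow> 0) (at z)" and c: "c \<in> carrier_vec n"
    and inputs: "\<And>u. u \<in> carrier_vec m \<Longrightarrow>
      ((\<lambda>s. \<phi> s * Rform s (cmat B *\<^sub>v u) c) \<longlongrightarrow> 0) (at z)"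
    and b: "b \<in> carrier_vec n"
  shows "((\<lambda>s. \<phi> s * Rform s b c) \<longlongrightarrow> 0) (at z)"
proof (rule resolvent_form_induct[where K = "\<lambda>f. (f \<longlongrightarrow> 0) (at z)", OF _ _ _ _ _ inputs b c])
  show "((\<lambda>s. s * f s) \<longlongrightarrow> 0) (at z)" if "(f \<longlongrightarrow> 0) (at z)" for f
    using tendsto_mult[OF tendsto_ident_at that] by simp
qed (fact tendsto_off_spectrum | intro tendsto_add_zero tendsto_mult_right_zero tendsto_mult_left_zero phi; assumption?)+

text \<open>Controllability extends convergence from the inputs \<open>B u\<close> to all
  \<open>b\<close> while the output vector is \<open>C^T v\<close>; observability then extends it to
  all \<open>c\<close>. The weight \<open>\<phi> = 1\<close> links poles with eigenvalues, and
  \<open>\<phi>(s) = s - z\<close> bounds the order of a pole of the resolvent.\<close>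

lemma resolvent_form_converges:
  assumes phi: "(\<phi> \<longlongrightarrow> p) (at z)"
    and conv: "\<And>u v. u \<in> carrier_vec m \<Longrightarrow> v \<in> carrier_vec m \<Longrightarrow>
      \<exists>L. ((\<lambda>s. \<phi> s * Gform s u v) \<longlongrightarrow> L) (at z)"
    and b: "b \<in> carrier_vec n" and c: "c \<in> carrier_vec n"
  shows "\<exists>L. ((\<lambda>s. \<phi> s * Rform s b c) \<longlongrightarrow> L) (at z)"
proof -
  define cv where "cv f \<longleftrightarrow> (\<exists>L. (f \<longlongrightarrow> L) (at z))" for f :: "complex \<Rightarrow> complex"
  have cvI: "cv f" if "(f \<longlongrightarrow> L) (at z)" for f L using that by (auto simp: cv_def)
  have cong: "cv g" if "cv f" "\<And>s. \<not> eigenvalue (cmat A) s \<Longrightarrow> f s = g s" for f g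
    using tendsto_off_spectrum that unfolding cv_def by blast
  have add: "cv (\<lambda>s. f s + g s)" if "cv f" "cv g" for f g
    using that tendsto_add unfolding cv_def by blast
  have mult: "cv (\<lambda>s. f s * g s)" if "cv f" "cv g" for f g
    using that tendsto_mult unfolding cv_def by blast
  have const: "cv (\<lambda>s. a)" for a by (rule cvI[OF tendsto_const])
  have ident: "cv (\<lambda>s. s)" by (rule cvI[OF tendsto_ident_at])
  have phi': "cv \<phi>" by (rule cvI[OF phi])
  have outputs: "cv (\<lambda>s. \<phi> s * Rform s b (cmatT C *\<^sub>v v))"
    if b: "b \<in> carrier_vec n" and v: "v \<in> carrier_vec m" for b v
  proof (rule resolvent_form_induct[where K = cv])
    show "cv g" if "cv f" "\<And>s. \<not> eigenvalue (cmat A) s \<Longrightarrow> f s = g s" for f g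
      using that by (rule cong)
    fix u :: "complex vec" assume u: "u \<in> carrier_vec m"
    have "cv (\<lambda>s. \<phi> s * Gform s u v + \<phi> s * - ((cmat D *\<^sub>v u) \<bullet>c v))"
      using conv[OF u v] by (intro add mult[OF phi' const]) (simp add: cv_def)
    then show "cv (\<lambda>s. \<phi> s * Rform s (cmat B *\<^sub>v u) (cmatT C *\<^sub>v v))"
      by (rule cong) (use u v in \<open>simp add: G_form algebra_simps\<close>)
  qed (use b v in \<open>auto intro: add mult const ident phi'\<close>)
  define S where "S = {c \<in> carrier_vec n. \<forall>b\<in>carrier_vec n. cv (\<lambda>s. \<phi> s * Rform s b c)}"
  have SI: "c \<in> S" if "c \<in> carrier_vec n"
    "\<And>b. b \<in> carrier_vec n \<Longrightarrow> cv (f b)"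
    "\<And>b s. b \<in> carrier_vec n \<Longrightarrow> \<not> eigenvalue (cmat A) s \<Longrightarrow> f b s = \<phi> s * Rform s b c" for c f
    unfolding S_def using that(1) cong[OF that(2) that(3)] by blast
  have SD: "x \<in> carrier_vec n" "b \<in> carrier_vec n \<Longrightarrow> cv (\<lambda>s. \<phi> s * Rform s b x)" if "x \<in> S" for x b
    using that by (auto simp: S_def)
  have "c \<in> S"
  proof (rule observable_induct[OF _ _ _ c])
    show "vec_subspace n S"
    proof (rule vec_subspaceI)
      show "0\<^sub>v n \<in> S" by (rule SI[OF _ const[of 0]]) simp_all
      show "x + y \<in> S" if "x \<in> S" "y \<in> S" for x y
        by (rule SI[OF _ add[OF SD(2)[OF that(1)] SD(2)[OF that(2)]]])
           (use that SD(1) in \<open>simp_all add: cscalar_prod_add_right[of _ n] distrib_left\<close>)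
      show "a \<cdot>\<^sub>v x \<in> S" if "x \<in> S" for a x
        by (rule SI[where f = "\<lambda>b s. cnj a * (\<phi> s * Rform s b x)"])
           (use SD[OF that] in \<open>simp_all add: mult const cscalar_prod_smult_right[of _ n]\<close>)
    qed (auto simp: S_def)
  next
    fix x assume x: "x \<in> S"
    show "cmatT A *\<^sub>v x \<in> S"
      by (rule SI[where f = "\<lambda>b s. \<phi> s * Rform s (cmat A *\<^sub>v b) x"])
         (use SD[OF x] in \<open>simp_all add: resolvent_form_shift\<close>)
  qed (simp add: S_def outputs)
  then show ?thesis using b by (auto simp: S_def cv_def)
qed

lemma eigenvector_resolvent:
  assumes "x \<in> carrier_vec n" "cmat A *\<^sub>v x = z \<cdot>\<^sub>v x" "\<not> eigenvalue (cmat A) s" "s \<noteq> z"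
  shows "R s *\<^sub>v x = (1 / (s - z)) \<cdot>\<^sub>v x"
proof (rule resolvent_unique[OF dims(1)])
  show "s \<cdot>\<^sub>v ((1 / (s - z)) \<cdot>\<^sub>v x) = cmat A *\<^sub>v ((1 / (s - z)) \<cdot>\<^sub>v x) + x"
    using assms by (intro eq_vecI) (auto simp: mult_mat_vec[OF dims(1)] field_simps)
qed (use assms in auto)

text \<open>Without a pole every resolvent form would have a limit at \<open>z\<close>, but at an
  eigenvector \<open>x\<close> the form is \<open>|x|^2 / (s - z)\<close>.\<close>

lemma eigenvalue_imp_pole:
  assumes "eigenvalue (cmat A) z"
  shows "has_pole_at m G z"
proof (rule ccontr)
  assume np: "\<not> has_pole_at m G z"
  obtain x where x: "x \<in> carrier_vec n" "x \<noteq> 0\<^sub>v n" "cmat A *\<^sub>v x = z \<cdot>\<^sub>v x"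
    using eigenvalueE[OF dims(1) assms] by blast
  obtain L where "((\<lambda>s. 1 * Rform s x x) \<longlongrightarrow> L) (at z)"
    using resolvent_form_converges[OF tendsto_const[of 1 "at z"] _ x(1) x(1)]
      no_pole_form_tendsto[OF np] by auto
  then have "((\<lambda>s. (s - z) * Rform s x x) \<longlongrightarrow> (z - z) * L) (at z)"
    by (intro tendsto_intros) auto
  moreover have "eventually (\<lambda>s. (s - z) * Rform s x x = x \<bullet>c x) (at z)"
    using eventually_not_eigenvalue eventually_neq_at_within[of z z UNIV]
    by eventually_elim (use x in \<open>simp add: eigenvector_resolvent smult_scalar_prod_distrib[of _ n]\<close>)
  ultimately have "((\<lambda>s. x \<bullet>c x) \<longlongrightarrow> 0) (at z)"
    using tendsto_cong by force
  then have "x \<bullet>c x = 0" by (simp add: tendsto_const_iff)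
  then show False using x by simp
qed

text \<open>One direction of the Hautus test: the orthogonal complement of \<open>x\<close> is
  invariant under \<open>A^T\<close> and contains the range of \<open>C^T\<close>, hence is the
  whole space.\<close>

lemma observable_eigenvector:
  assumes x: "x \<in> carrier_vec n" "cmat A *\<^sub>v x = z \<cdot>\<^sub>v x" "cmat C *\<^sub>v x = 0\<^sub>v m"
  shows "x = 0\<^sub>v n"
proof (rule cscalar_prod_eq_0_imp_zero[OF x(1)])
  fix y :: "complex vec" assume y: "y \<in> carrier_vec n"
  have "y \<in> {y \<in> carrier_vec n. x \<bullet>c y = 0}"
  proof (rule observable_induct[OF _ _ _ y])
    show "vec_subspace n {y \<in> carrier_vec n. x \<bullet>c y = 0}"
      using x by (intro vec_subspaceI)
        (auto simp: cscalar_prod_add_right[of _ n] cscalar_prod_smult_right[of _ n])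
  next
    fix y assume "y \<in> {y \<in> carrier_vec n. x \<bullet>c y = 0}"
    then show "cmatT A *\<^sub>v y \<in> {y \<in> carrier_vec n. x \<bullet>c y = 0}"
      using x by (auto simp: A_adjoint[symmetric] smult_scalar_prod_distrib[of _ n])
  next
    fix u :: "complex vec" assume "u \<in> carrier_vec m"
    then show "cmatT C *\<^sub>v u \<in> {y \<in> carrier_vec n. x \<bullet>c y = 0}"
      using x by (auto simp: C_adjoint[symmetric])
  qed
  then show "x \<bullet>c y = 0" by simp
qed

end

section \<open>Strictly negative imaginary systems\<close>

text \<open>\<open>M\<close> is not assumed Hermitian; the conclusion says that its Hermitian part
  annihilates \<open>x\<close>. Moving from \<open>x\<close> by \<open>- e a v\<close> changes the
  quadratic form to \<open>- e |a|^2 + e^2 |a|^2 h\<close>, which is negative for small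
  \<open>e\<close> unless \<open>a = 0\<close>.\<close>

lemma semidefinite_form_kernel:
  fixes M :: "complex mat"
  assumes M: "M \<in> carrier_mat m m"
    and psd: "\<And>v. v \<in> carrier_vec m \<Longrightarrow> 0 \<le> Re ((M *\<^sub>v v) \<bullet>c v)"
    and x: "x \<in> carrier_vec m" "Re ((M *\<^sub>v x) \<bullet>c x) = 0" and v: "v \<in> carrier_vec m"
  shows "(M *\<^sub>v x) \<bullet>c v + cnj ((M *\<^sub>v v) \<bullet>c x) = 0"
proof -
  define a where "a = (M *\<^sub>v x) \<bullet>c v + cnj ((M *\<^sub>v v) \<bullet>c x)"
  define h where "h = Re ((M *\<^sub>v v) \<bullet>c v)"
  \<comment> \<open>This choice gives \<open>e * h \<le> 1/2\<close>, also when
    \<open>h = 0\<close>.\<close>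
  define e where "e = 1 / (2 * (1 + h))"
  define t where "t = - of_real e * a"
  have h: "0 \<le> h" using psd[OF v] by (simp add: h_def)
  have Mc: "M *\<^sub>v u \<in> carrier_vec m" if "u \<in> carrier_vec m" for u
    using mult_mat_vec_carrier[OF M that] .
  have "(M *\<^sub>v (x + t \<cdot>\<^sub>v v)) \<bullet>c (x + t \<cdot>\<^sub>v v) =
      (M *\<^sub>v x) \<bullet>c x + cnj t * ((M *\<^sub>v x) \<bullet>c v) + t * ((M *\<^sub>v v) \<bullet>c x) + t * cnj t * ((M *\<^sub>v v) \<bullet>c v)"
    using M x v Mc[OF x(1)] Mc[OF v]
    by (simp add: mult_add_distrib_mat_vec[of _ m m] mult_mat_vec[of _ m m]
        cscalar_prod_add_right[of _ m] cscalar_prod_smult_right[of _ m]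
        add_scalar_prod_distrib[of _ m] smult_scalar_prod_distrib[of _ m] algebra_simps)
  then have "Re ((M *\<^sub>v (x + t \<cdot>\<^sub>v v)) \<bullet>c (x + t \<cdot>\<^sub>v v)) = Re (cnj t * a) + (norm t)\<^sup>2 * h"
    unfolding complex_norm_square[symmetric] using x(2) by (simp add: a_def h_def algebra_simps)
  moreover have "0 \<le> Re ((M *\<^sub>v (x + t \<cdot>\<^sub>v v)) \<bullet>c (x + t \<cdot>\<^sub>v v))"
    using x v by (intro psd) simp
  moreover have "Re (cnj t * a) = - e * (norm a)\<^sup>2"
    unfolding t_def cmod_power2 by (simp add: power2_eq_square algebra_simps)
  moreover have "(norm t)\<^sup>2 = e\<^sup>2 * (norm a)\<^sup>2"
    by (simp add: t_def norm_mult power_mult_distrib)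
  ultimately have "e * (norm a)\<^sup>2 \<le> e * ((e * h) * (norm a)\<^sup>2)"
    by (simp add: power2_eq_square algebra_simps)
  moreover have "0 < e" using h by (simp add: e_def)
  ultimately have "(norm a)\<^sup>2 \<le> (e * h) * (norm a)\<^sup>2" by simp
  also have "\<dots> \<le> (1/2) * (norm a)\<^sup>2"
    using h by (intro mult_right_mono) (auto simp: e_def field_simps)
  finally have "a = 0" by simp
  then show ?thesis by (simp add: a_def)
qed

lemma half_plane_at_0: "at (0::complex) within {s. 0 < Re s} \<noteq> bot"
proof -
  have "(0::complex) islimpt {s. 0 < Re s}"
    unfolding islimpt_approachable
  proof (intro allI impI)
    fix e :: real assume "0 < e"
    then show "\<exists>y\<in>{s::complex. 0 < Re s}. y \<noteq> 0 \<and> dist y 0 < e"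
      by (intro bexI[of _ "of_real (e/2)"]) auto
  qed
  then show ?thesis by (simp add: trivial_limit_within)
qed

lemma constant_on_half_plane_limit_0:
  assumes "f constant_on {s. 0 < Re s}" and lim: "(f \<longlongrightarrow> (L::complex)) (at 0)" and s: "0 < Re s"
  shows "f s = L"
proof -
  obtain c where c: "\<And>s. 0 < Re s \<Longrightarrow> f s = c" using assms(1) by (auto simp: constant_on_def)
  have "(f \<longlongrightarrow> L) (at 0 within {s. 0 < Re s})"
    using lim by (rule tendsto_within_subset) simp
  moreover have "(f \<longlongrightarrow> c) (at 0 within {s. 0 < Re s})"
    by (rule tendsto_eventually) (auto simp: eventually_at_filter c)
  ultimately have "c = L" using tendsto_unique half_plane_at_0 by blast
  then show ?thesis using c s by simp
qed

text \<open>The vector algebra behind \<open>resolvent_input_output\<close>, where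
  \<open>w = A x\<close>, \<open>r = R(s) x\<close> and \<open>q = A r\<close>.\<close>

lemma resolvent_shift_identity:
  fixes x r q w b :: "complex vec"
  assumes "x \<in> carrier_vec n" "r \<in> carrier_vec n" "q \<in> carrier_vec n" "w \<in> carrier_vec n"
    "b \<in> carrier_vec n" and eq: "z \<cdot>\<^sub>v x = w + b" "s \<cdot>\<^sub>v r = q + x"
  shows "w + (z - s) \<cdot>\<^sub>v q + b = s \<cdot>\<^sub>v (x + (z - s) \<cdot>\<^sub>v r)"
proof (rule eq_vecI)
  fix i assume "i < dim_vec (s \<cdot>\<^sub>v (x + (z - s) \<cdot>\<^sub>v r))"
  then have i: "i < n" using assms by simp
  have wq: "w $ i = z * x $ i - b $ i" "q $ i = s * r $ i - x $ i"
    using arg_cong[OF eq(1), of "\<lambda>v. vec_index v i"] arg_cong[OF eq(2), of "\<lambda>v. vec_index v i"] i assms(1-5)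
    by auto
  have "w $ i + (z - s) * q $ i + b $ i = s * (x $ i + (z - s) * r $ i)"
    unfolding wq by (simp add: algebra_simps)
  then show "(w + (z - s) \<cdot>\<^sub>v q + b) $ i = (s \<cdot>\<^sub>v (x + (z - s) \<cdot>\<^sub>v r)) $ i"
    using i assms(1-5) by (simp add: add.assoc)
qed (use assms in auto)

context minimal_system
begin

lemma no_pole_of_not_eigenvalue:
  assumes "\<not> eigenvalue (cmat A) z"
  shows "\<not> has_pole_at m G z"
proof -
  have "\<not> is_pole (\<lambda>s. G s $$ (i, j)) z" if ij: "i < m" "j < m" for i j
  proof (rule not_is_pole_holomorphic)
    show "open {s. \<not> eigenvalue (cmat A) s}" by (rule open_non_eigenvalues[OF dims(1)])
    have "(\<lambda>s. Gform s (unit_vec m j) (unit_vec m i)) holomorphic_on {s. \<not> eigenvalue (cmat A) s}"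
      by (intro G_form_holomorphic) auto
    then show "(\<lambda>s. G s $$ (i, j)) holomorphic_on {s. \<not> eigenvalue (cmat A) s}"
      using form_unit_vec[OF dims(7) ij] by simp
  qed (use assms in simp)
  then show ?thesis by (auto simp: has_pole_at_def)
qed

text \<open>The identity \<open>R(s) B u = x - (s - z) R(s) x\<close> compares a state solving the
  equation at \<open>z\<close>, which may be an eigenvalue, with the resolvent at nearby
  points.\<close>

lemma resolvent_input_output:
  assumes s: "\<not> eigenvalue (cmat A) s" and x: "x \<in> carrier_vec n" and u: "u \<in> carrier_vec m"
    and eq: "z \<cdot>\<^sub>v x = cmat A *\<^sub>v x + cmat B *\<^sub>v u" and c: "c \<in> carrier_vec n"
  shows "Rform s (cmat B *\<^sub>v u) c = x \<bullet>c c - (s - z) * Rform s x c"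
proof -
  have Rx: "R s *\<^sub>v x \<in> carrier_vec n" using s x by simp
  have "R s *\<^sub>v (cmat B *\<^sub>v u) = x + (z - s) \<cdot>\<^sub>v (R s *\<^sub>v x)"
  proof (rule resolvent_unique[OF dims(1) s])
    have "cmat A *\<^sub>v (x + (z - s) \<cdot>\<^sub>v (R s *\<^sub>v x)) + cmat B *\<^sub>v u =
        (cmat A *\<^sub>v x + (z - s) \<cdot>\<^sub>v (cmat A *\<^sub>v (R s *\<^sub>v x))) + cmat B *\<^sub>v u"
      using x Rx by (simp add: mult_add_distrib_mat_vec[OF dims(1)] mult_mat_vec[OF dims(1)])
    also have "\<dots> = s \<cdot>\<^sub>v (x + (z - s) \<cdot>\<^sub>v (R s *\<^sub>v x))"
      using x Rx u eq resolvent_solves[OF dims(1) s x]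
      by (intro resolvent_shift_identity[of _ n]) auto
    finally show "s \<cdot>\<^sub>v (x + (z - s) \<cdot>\<^sub>v (R s *\<^sub>v x)) =
        cmat A *\<^sub>v (x + (z - s) \<cdot>\<^sub>v (R s *\<^sub>v x)) + cmat B *\<^sub>v u" ..
  qed (use x Rx u in auto)
  then show ?thesis
    using x Rx c by (simp add: add_scalar_prod_distrib[of _ n] smult_scalar_prod_distrib[of _ n] algebra_simps)
qed

end

locale sni_system = minimal_system +
  assumes SNI: "SNI m G"
begin

lemma stable: "0 \<le> Re s \<Longrightarrow> \<not> eigenvalue (cmat A) s"
  using SNI eigenvalue_imp_pole by (auto simp: SNI_def)

text \<open>The factor \<open>\<i> w\<close> makes the condition even in \<open>w\<close>, so
  conjugate symmetry carries it from positive to negative frequencies.\<close>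

lemma axis_positive:
  assumes w: "w \<noteq> 0" and x: "x \<in> carrier_vec m" "x \<noteq> 0\<^sub>v m"
  shows "0 < Re (axis w * ((G (axis w) *\<^sub>v x) \<bullet>c x))"
proof -
  have pos: "0 < - w * Im ((G (axis w) *\<^sub>v x) \<bullet>c x)" if w: "0 < w"
    and x: "x \<in> carrier_vec m" "x \<noteq> 0\<^sub>v m" for w x
  proof -
    let ?G = "G (axis w)"
    have "pd_mat (\<i> \<cdot>\<^sub>m (?G - mat_adjoint ?G))" using SNI w by (simp add: SNI_def)
    moreover have "dim_row (\<i> \<cdot>\<^sub>m (?G - mat_adjoint ?G)) = m"
      using carrier_matD(1)[OF mat_adjoint_form(1)[OF dims(7) x(1) x(1)]] by simp
    ultimately have "0 < Re (((\<i> \<cdot>\<^sub>m (?G - mat_adjoint ?G)) *\<^sub>v x) \<bullet>c x)"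
      using x unfolding pd_mat_def by metis
    then have "Im ((?G *\<^sub>v x) \<bullet>c x) < 0"
      using imaginary_part_form[OF dims(7) x(1)] by simp
    then show ?thesis using w by (simp add: mult_pos_neg)
  qed
  show ?thesis
  proof (cases "0 < w")
    case True
    then show ?thesis using pos[OF _ x] by simp
  next
    case False
    then show ?thesis
      using G_axis_form_cnj[OF stable x(1), of w] pos[of "- w" "conjugate x"] x w by simp
  qed
qed

lemma G_form_isCont_0:
  assumes "u \<in> carrier_vec m" "v \<in> carrier_vec m"
  shows "((\<lambda>s. Gform s u v) \<longlongrightarrow> (G 0 *\<^sub>v u) \<bullet>c v) (at 0)"
proof -
  have "isCont (\<lambda>s. Gform s u v) 0"
    using holomorphic_on_imp_continuous_on[OF G_form_holomorphic[OF assms]]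
      open_non_eigenvalues[OF dims(1)] stable[of 0]
    by (simp add: continuous_on_eq_continuous_at)
  then show ?thesis by (simp add: isCont_def)
qed

text \<open>On the axis the imaginary part has opposite signs for \<open>w > 0\<close> and
  \<open>w < 0\<close>, and continuity at \<open>0\<close> forces it to vanish there.\<close>

lemma dc_form_real:
  assumes x: "x \<in> carrier_vec m"
  shows "Im ((G 0 *\<^sub>v x) \<bullet>c x) = 0"
proof (cases "x = 0\<^sub>v m")
  case True
  have "G 0 *\<^sub>v 0\<^sub>v m = 0\<^sub>v m" by (rule mult_mat_zero_vec[OF dims(7)])
  then show ?thesis using True by simp
next
  case False
  let ?h = "\<lambda>t::real. - Im ((G (axis t) *\<^sub>v x) \<bullet>c x)"
  have "filterlim (\<lambda>t::real. axis t) (at 0) (at 0)"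
    using filterlim_vertical_line[of 0] by simp
  then have lim: "(?h \<longlongrightarrow> - Im ((G 0 *\<^sub>v x) \<bullet>c x)) (at 0)"
    by (intro tendsto_intros filterlim_compose[OF G_form_isCont_0[OF x x]])
  have sgn: "0 < t * ?h t" if "t \<noteq> 0" for t
    using axis_positive[OF that x False] by simp
  have h_right: "0 \<le> ?h t" if "0 < t" for t
    using sgn[of t] that by (simp add: zero_less_mult_iff mult_less_0_iff)
  have h_left: "?h t \<le> 0" if "t < 0" for t
    using sgn[of t] that by (simp add: zero_less_mult_iff mult_less_0_iff)
  have "0 \<le> - Im ((G 0 *\<^sub>v x) \<bullet>c x)"
  proof (rule tendsto_lowerbound)
    show "(?h \<longlongrightarrow> - Im ((G 0 *\<^sub>v x) \<bullet>c x)) (at_right 0)"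
      using lim by (rule tendsto_within_subset) simp
    show "eventually (\<lambda>t. 0 \<le> ?h t) (at_right 0)"
      unfolding eventually_at_filter using h_right by (intro always_eventually) blast
  qed simp
  moreover have "- Im ((G 0 *\<^sub>v x) \<bullet>c x) \<le> 0"
  proof (rule tendsto_upperbound)
    show "(?h \<longlongrightarrow> - Im ((G 0 *\<^sub>v x) \<bullet>c x)) (at_left 0)"
      using lim by (rule tendsto_within_subset) simp
    show "eventually (\<lambda>t. ?h t \<le> 0) (at_left 0)"
      unfolding eventually_at_filter using h_left by (intro always_eventually) blast
  qed simp
  ultimately show ?thesis by simp
qed

text \<open>Polarization: the quadratic form of \<open>\<i> G(0)\<close> has real part zero at every
  vector, so \<open>semidefinite_form_kernel\<close> applies to all of them.\<close>

lemma dc_form_hermitian: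
  assumes x: "x \<in> carrier_vec m" and y: "y \<in> carrier_vec m"
  shows "(G 0 *\<^sub>v x) \<bullet>c y = cnj ((G 0 *\<^sub>v y) \<bullet>c x)"
proof -
  have M: "\<i> \<cdot>\<^sub>m G 0 \<in> carrier_mat m m" by simp
  have form: "((\<i> \<cdot>\<^sub>m G 0) *\<^sub>v a) \<bullet>c b = \<i> * ((G 0 *\<^sub>v a) \<bullet>c b)"
    if "a \<in> carrier_vec m" "b \<in> carrier_vec m" for a b
    using smult_form[OF dims(7) that] .
  have "((\<i> \<cdot>\<^sub>m G 0) *\<^sub>v x) \<bullet>c y + cnj (((\<i> \<cdot>\<^sub>m G 0) *\<^sub>v y) \<bullet>c x) = 0"
    by (rule semidefinite_form_kernel[OF M _ x _ y]) (use x in \<open>simp_all add: form dc_form_real\<close>)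
  then have "\<i> * ((G 0 *\<^sub>v x) \<bullet>c y - cnj ((G 0 *\<^sub>v y) \<bullet>c x)) = 0"
    using x y by (simp add: form algebra_simps)
  then show ?thesis by simp
qed

text \<open>Subtracting the real number \<open>g 0\<close> leaves the imaginary part on the axis
  unchanged, and division by \<open>\<i> w\<close> turns its sign into a sign of the real part. The
  quotient has a limit at the origin, namely a derivative, and tends to \<open>0\<close> at
  infinity, so the half plane principle applies with every \<open>k = 0\<close>.\<close>

lemma difference_quotient_nonpos:
  assumes x: "x \<in> carrier_vec m" and s: "0 < Re s"
  shows "Re ((Gform s x x - (G 0 *\<^sub>v x) \<bullet>c x) / s) \<le> 0"
proof (cases "x = 0\<^sub>v m")
  case True
  have "G s *\<^sub>v 0\<^sub>v m = 0\<^sub>v m" for s by (rule mult_mat_zero_vec[OF dims(7)])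
  then show ?thesis using True by simp
next
  case False
  define g where "g = (\<lambda>s. Gform s x x)"
  define f where "f = (\<lambda>s. - (g s - g 0) / s)"
  let ?U = "{s. \<not> eigenvalue (cmat A) s}"
  have U: "open ?U" by (rule open_non_eigenvalues[OF dims(1)])
  have g: "g holomorphic_on ?U" unfolding g_def by (rule G_form_holomorphic[OF x x])
  have f: "f holomorphic_on ?U - {0}"
    unfolding f_def by (intro holomorphic_intros holomorphic_on_subset[OF g]) auto
  have "0 \<le> Re (f s)"
  proof (rule half_plane_Re_nonneg[where f = f and F = "{0}" and L = 0])
    show "f holomorphic_on {s. 0 < Re s}"
      by (rule holomorphic_on_subset[OF f]) (use stable in auto)
    show "finite {0::real}" by simp
    show "0 \<le> Re (f (axis w))" if "w \<notin> {0}" for w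
    proof -
      have "Im (g 0) = 0" using dc_form_real[OF x] by (simp add: g_def)
      moreover have "0 < - w * Im (g (axis w))"
        using axis_positive[OF _ x False, of w] that by (simp add: g_def)
      moreover have "Re (f (axis w)) = (Im (g 0) - Im (g (axis w))) * w / w\<^sup>2"
        using that by (simp add: f_def Re_divide power2_eq_square)
      ultimately show ?thesis by (simp add: mult.commute divide_nonpos_nonneg)
    qed
    show "\<exists>k\<ge>0. \<exists>L. ((\<lambda>s. f s - of_real k / (s - axis w)) \<longlongrightarrow> L) (at (axis w))" for w
    proof (rule exI[of _ 0], rule conjI[OF order_refl])
      have "\<exists>L. (f \<longlongrightarrow> L) (at (axis w))"
      proof (cases "w = 0")
        case True
        have "g field_differentiable at 0"
          using holomorphic_on_imp_differentiable_at[OF g U] stable[of 0] by simp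
        then obtain d where "(g has_field_derivative d) (at 0)"
          unfolding field_differentiable_def by blast
        then have "((\<lambda>s. - ((g s - g 0) / (s - 0))) \<longlongrightarrow> - d) (at 0)"
          by (intro tendsto_minus) (simp add: has_field_derivative_iff)
        then show ?thesis using True by (auto simp: f_def minus_divide_left)
      next
        case False
        then have "axis w \<in> ?U - {0}" using stable by auto
        then have "isCont f (axis w)"
          using holomorphic_on_imp_continuous_on[OF f] U
          by (subst (asm) continuous_on_eq_continuous_at) (auto intro: open_delete)
        then show ?thesis unfolding isCont_def by blast
      qed
      then show "\<exists>L. ((\<lambda>s. f s - of_real 0 / (s - axis w)) \<longlongrightarrow> L) (at (axis w))"
        by simp
    qed
    show "(f \<longlongrightarrow> 0) at_infinity"
    proof -
      have "((\<lambda>s. Rform s (cmat B *\<^sub>v x) (cmatT C *\<^sub>v x)) \<longlongrightarrow> 0) at_infinity"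
        using x by (intro resolvent_form_tendsto_0_at_infinity[OF dims(1)]) auto
      then have "((\<lambda>s. - (Rform s (cmat B *\<^sub>v x) (cmatT C *\<^sub>v x) +
          (cmat D *\<^sub>v x) \<bullet>c x - g 0) / s) \<longlongrightarrow> 0) at_infinity"
        by (rule tendsto_divide_0[OF tendsto_minus[OF tendsto_diff[OF tendsto_add[OF _ tendsto_const]
            tendsto_const]] filterlim_ident])
      moreover have "eventually (\<lambda>s. - (Rform s (cmat B *\<^sub>v x) (cmatT C *\<^sub>v x) +
          (cmat D *\<^sub>v x) \<bullet>c x - g 0) / s = f s) at_infinity"
        using eventually_non_eigenvalue_at_infinity[OF dims(1)]
        by eventually_elim (use x in \<open>simp add: f_def g_def G_form\<close>)
      ultimately show ?thesis by (rule Lim_transform_eventually)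
    qed
  qed (rule s)
  moreover have "f s = - ((Gform s x x - (G 0 *\<^sub>v x) \<bullet>c x) / s)"
    unfolding f_def g_def by (rule minus_divide_left[symmetric])
  ultimately show ?thesis by simp
qed

end

section \<open>Negative imaginary systems\<close>

text \<open>The hypothesis on null spaces concerns real vectors; this splits complex kernel vectors
  into real and imaginary parts.\<close>

lemma cmat_mult_eq_0_iff:
  assumes M: "M \<in> carrier_mat k n" and x: "x \<in> carrier_vec n"
  shows "cmat M *\<^sub>v x = 0\<^sub>v k \<longleftrightarrow>
    M *\<^sub>v map_vec Re x = 0\<^sub>v k \<and> M *\<^sub>v map_vec Im x = 0\<^sub>v k"
proof -
  have "(cmat M *\<^sub>v x) $ i = Complex ((M *\<^sub>v map_vec Re x) $ i) ((M *\<^sub>v map_vec Im x) $ i)"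
    if "i < k" for i
    using that M x by (simp add: complex_eq_iff scalar_prod_def)
  then show ?thesis using M by (auto simp: vec_eq_iff complex_eq_iff)
qed

lemma cmat_zero [simp]: "cmat (0\<^sub>m k n) = 0\<^sub>m k n"
  by (intro eq_matI) auto

lemma minus_smult_zero_mat [simp]:
  "M \<in> carrier_mat k n \<Longrightarrow> M - a \<cdot>\<^sub>m 0\<^sub>m k n = (M :: complex mat)"
  by (intro eq_matI) auto

lemma zero_mat_mult_vec [simp]:
  "x \<in> carrier_vec n \<Longrightarrow> 0\<^sub>m k n *\<^sub>v x = (0\<^sub>v k :: complex vec)"
  by (intro eq_vecI) auto

lemma cscalar_prod_ext:
  fixes a b :: "complex vec"
  assumes a: "a \<in> carrier_vec n" and b: "b \<in> carrier_vec n"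
    and eq: "\<And>c. c \<in> carrier_vec n \<Longrightarrow> a \<bullet>c c = b \<bullet>c c"
  shows "a = b"
proof -
  have "a - b = 0\<^sub>v n"
    using a b eq by (intro cscalar_prod_eq_0_imp_zero) (simp_all add: minus_scalar_prod_distrib[of _ n])
  then have "\<And>i. i < n \<Longrightarrow> (a - b) $ i = 0" by simp
  then show ?thesis using a b by (intro eq_vecI) auto
qed

locale ni_system = minimal_system +
  fixes G1 G0 :: "real mat"
  assumes D0: "D = 0\<^sub>m m m" and NI: "NI m G"
    and expansion: "expansion_at_0 m G (0\<^sub>m m m) G1 G0"
    and kernels: "mat_kernel (transpose_mat G1) \<subseteq> mat_kernel (transpose_mat G0)"
begin

lemma G1_dim: "G1 \<in> carrier_mat m m" and G0_dim: "G0 \<in> carrier_mat m m"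
  using expansion by (auto simp: expansion_at_0_def)

lemma cG_dims [simp]: "cmat G1 \<in> carrier_mat m m" "cmat G0 \<in> carrier_mat m m"
  using G1_dim G0_dim by auto

lemma cG_vec [simp]:
  "x \<in> carrier_vec m \<Longrightarrow> cmat G1 *\<^sub>v x \<in> carrier_vec m"
  "x \<in> carrier_vec m \<Longrightarrow> cmat G0 *\<^sub>v x \<in> carrier_vec m"
  by (rule mult_mat_vec_carrier, rule cG_dims, assumption)+

lemma G_form_strictly_proper:
  assumes "\<not> eigenvalue (cmat A) s" "u \<in> carrier_vec m" "v \<in> carrier_vec m"
  shows "Gform s u v = Rform s (cmat B *\<^sub>v u) (cmatT C *\<^sub>v v)"
proof -
  have "cmat D *\<^sub>v u = 0\<^sub>v m" using assms by (simp add: D0)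
  then show ?thesis using G_form[OF assms] assms by simp
qed

lemma no_unstable_eigenvalue: "0 < Re s \<Longrightarrow> \<not> eigenvalue (cmat A) s"
  using NI eigenvalue_imp_pole by (auto simp: NI_def)

section \<open>Expansion at the origin, sign and residues on the axis\<close>

lemma residue_at_0:
  assumes u: "u \<in> carrier_vec m" and v: "v \<in> carrier_vec m"
  shows "((\<lambda>s. s * Gform s u v) \<longlongrightarrow> (cmat G1 *\<^sub>v u) \<bullet>c v) (at 0)"
proof -
  let ?F = "\<lambda>s. s \<cdot>\<^sub>m (G s - (1 / s ^ 2) \<cdot>\<^sub>m 0\<^sub>m m m)"
  have "mat_tendsto m ?F (cmat G1) (at 0)"
    using expansion by (simp add: expansion_at_0_def)
  then have "((\<lambda>s. (?F s *\<^sub>v u) \<bullet>c v) \<longlongrightarrow> (cmat G1 *\<^sub>v u) \<bullet>c v) (at 0)"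
    by (rule mat_tendsto_form[OF _ _ u v]) (auto intro!: always_eventually)
  moreover have "(?F s *\<^sub>v u) \<bullet>c v = s * Gform s u v" for s
    using smult_form[OF dims(7) u v] by (simp only: minus_smult_zero_mat[OF dims(7)])
  ultimately show ?thesis by simp
qed

lemma constant_term_at_0:
  assumes u: "u \<in> carrier_vec m" and v: "v \<in> carrier_vec m"
  shows "((\<lambda>s. Gform s u v - (1 / s) * ((cmat G1 *\<^sub>v u) \<bullet>c v)) \<longlongrightarrow> (cmat G0 *\<^sub>v u) \<bullet>c v) (at 0)"
proof -
  let ?F = "\<lambda>s. G s - (1 / s ^ 2) \<cdot>\<^sub>m 0\<^sub>m m m - (1 / s) \<cdot>\<^sub>m cmat G1"
  have "mat_tendsto m ?F (cmat G0) (at 0)"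
    using expansion by (simp add: expansion_at_0_def)
  then have "((\<lambda>s. (?F s *\<^sub>v u) \<bullet>c v) \<longlongrightarrow> (cmat G0 *\<^sub>v u) \<bullet>c v) (at 0)"
    by (rule mat_tendsto_form[OF _ _ u v]) (use G1_dim in \<open>auto intro!: always_eventually minus_carrier_mat\<close>)
  moreover have "(?F s *\<^sub>v u) \<bullet>c v = Gform s u v - (1 / s) * ((cmat G1 *\<^sub>v u) \<bullet>c v)" for s
    using diff_form[OF dims(7) smult_carrier_mat[OF cG_dims(1)] u v] smult_form[OF cG_dims(1) u v]
    by (simp only: minus_smult_zero_mat[OF dims(7)])
  ultimately show ?thesis by simp
qed

lemma axis_nonneg:
  assumes w: "w \<noteq> 0" and ne: "\<not> eigenvalue (cmat A) (axis w)" and x: "x \<in> carrier_vec m"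
  shows "0 \<le> Re (axis w * ((G (axis w) *\<^sub>v x) \<bullet>c x))"
proof -
  have pos: "0 \<le> - w * Im ((G (axis w) *\<^sub>v x) \<bullet>c x)" if w: "0 < w"
    and ne: "\<not> eigenvalue (cmat A) (axis w)" and x: "x \<in> carrier_vec m" for w x
  proof -
    let ?G = "G (axis w)"
    have "psd_mat (\<i> \<cdot>\<^sub>m (?G - mat_adjoint ?G))"
      using NI w no_pole_of_not_eigenvalue[OF ne] by (simp add: NI_def)
    moreover have "dim_row (\<i> \<cdot>\<^sub>m (?G - mat_adjoint ?G)) = m"
      using carrier_matD(1)[OF mat_adjoint_form(1)[OF dims(7) x x]] by simp
    ultimately have "0 \<le> Re (((\<i> \<cdot>\<^sub>m (?G - mat_adjoint ?G)) *\<^sub>v x) \<bullet>c x)"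
      using x unfolding psd_mat_def by metis
    then have "Im ((?G *\<^sub>v x) \<bullet>c x) \<le> 0"
      using imaginary_part_form[OF dims(7) x] by simp
    then show ?thesis using w by (simp add: mult_nonneg_nonpos)
  qed
  show ?thesis
  proof (cases "0 < w")
    case True
    then show ?thesis using pos[OF _ ne x] by simp
  next
    case False
    have ne': "\<not> eigenvalue (cmat A) (cnj (axis w))"
      using ne eigenvalue_cnj_iff[OF real_dims(1)] by blast
    then show ?thesis
      using G_axis_form_cnj[OF ne x] pos[of "- w" "conjugate x"] x w False by simp
  qed
qed

text \<open>The residue of \<open>s G(s)\<close>, not of \<open>G(s)\<close>: the factor
  \<open>s\<close> turns the matrix \<open>K\<close> of the pole condition, a limit of
  \<open>\<i> (s - z) G(s)\<close>, into \<open>w K\<close> and gives both signs of \<open>w\<close>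
  the same condition. At a regular point the zero matrix qualifies.\<close>

definition psd_residue :: "real \<Rightarrow> complex mat \<Rightarrow> bool" where
  "psd_residue w L \<longleftrightarrow> L \<in> carrier_mat m m \<and>
     (\<forall>u\<in>carrier_vec m. \<forall>v\<in>carrier_vec m.
       ((\<lambda>s. (s - axis w) * (s * Gform s u v)) \<longlongrightarrow> (L *\<^sub>v u) \<bullet>c v) (at (axis w)) \<and>
       (L *\<^sub>v u) \<bullet>c v = cnj ((L *\<^sub>v v) \<bullet>c u)) \<and>
     (\<forall>u\<in>carrier_vec m. 0 \<le> Re ((L *\<^sub>v u) \<bullet>c u))"

lemma psd_residueD:
  assumes "psd_residue w L" "u \<in> carrier_vec m" "v \<in> carrier_vec m"
  shows "((\<lambda>s. (s - axis w) * (s * Gform s u v)) \<longlongrightarrow> (L *\<^sub>v u) \<bullet>c v) (at (axis w))"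
    "(L *\<^sub>v u) \<bullet>c v = cnj ((L *\<^sub>v v) \<bullet>c u)" "0 \<le> Re ((L *\<^sub>v u) \<bullet>c u)"
  using assms unfolding psd_residue_def by blast+

lemma residue_on_axis_pos:
  assumes w: "0 < w"
  shows "\<exists>L. psd_residue w L"
proof (cases "has_pole_at m G (axis w)")
  case True
  let ?z = "axis w"
  obtain K where K: "mat_tendsto m (\<lambda>s. ((s - ?z) * \<i>) \<cdot>\<^sub>m G s) K (at ?z)" "psd_mat K"
    using NI w True unfolding NI_def by blast
  have Kd: "K \<in> carrier_mat m m" using K(1) by (simp add: mat_tendsto_def)
  have form: "((of_real w \<cdot>\<^sub>m K) *\<^sub>v u) \<bullet>c v = of_real w * ((K *\<^sub>v u) \<bullet>c v)"
    if "u \<in> carrier_vec m" "v \<in> carrier_vec m" for u v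
    using smult_form[OF Kd that] .
  have "psd_residue w (of_real w \<cdot>\<^sub>m K)"
    unfolding psd_residue_def
  proof (intro conjI ballI)
    fix u v :: "complex vec" assume u: "u \<in> carrier_vec m" and v: "v \<in> carrier_vec m"
    have "((\<lambda>s. ((((s - ?z) * \<i>) \<cdot>\<^sub>m G s) *\<^sub>v u) \<bullet>c v) \<longlongrightarrow> (K *\<^sub>v u) \<bullet>c v) (at ?z)"
      by (rule mat_tendsto_form[OF K(1) _ u v]) (simp add: always_eventually)
    \<comment> \<open>The factor \<open>s / \<i>\<close> cancels the \<open>\<i>\<close> of the pole
      condition, supplies the missing \<open>s\<close>, and tends to \<open>w\<close>.\<close>
    then have "((\<lambda>s. ((s - ?z) * \<i>) * Gform s u v * (s / \<i>)) \<longlongrightarrow> (K *\<^sub>v u) \<bullet>c v * (?z / \<i>)) (at ?z)"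
      unfolding smult_form[OF dims(7) u v] by (intro tendsto_intros) auto
    then show "((\<lambda>s. (s - ?z) * (s * Gform s u v)) \<longlongrightarrow> ((of_real w \<cdot>\<^sub>m K) *\<^sub>v u) \<bullet>c v) (at ?z)"
      unfolding form[OF u v] by (simp add: mult_ac)
    show "((of_real w \<cdot>\<^sub>m K) *\<^sub>v u) \<bullet>c v = cnj (((of_real w \<cdot>\<^sub>m K) *\<^sub>v v) \<bullet>c u)"
      using hermitian_form[OF _ Kd u v] K(2) u v by (simp add: form psd_mat_def)
  next
    fix u :: "complex vec" assume u: "u \<in> carrier_vec m"
    then show "0 \<le> Re (((of_real w \<cdot>\<^sub>m K) *\<^sub>v u) \<bullet>c u)"
      using K(2) w Kd unfolding form[OF u u] psd_mat_def by auto
  qed (use Kd in simp)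
  then show ?thesis by blast
next
  case False
  let ?z = "axis w"
  have Z: "(0\<^sub>m m m *\<^sub>v u) \<bullet>c v = (0 :: complex)" if "u \<in> carrier_vec m" "v \<in> carrier_vec m" for u v
    using that by simp
  have "psd_residue w (0\<^sub>m m m)"
    unfolding psd_residue_def
  proof (intro conjI ballI)
    fix u v :: "complex vec" assume u: "u \<in> carrier_vec m" and v: "v \<in> carrier_vec m"
    obtain L where "((\<lambda>s. Gform s u v) \<longlongrightarrow> L) (at ?z)"
      using no_pole_form_tendsto[OF False u v] by blast
    then have "((\<lambda>s. (s - ?z) * (s * Gform s u v)) \<longlongrightarrow> (?z - ?z) * (?z * L)) (at ?z)"
      by (intro tendsto_intros)
    then show "((\<lambda>s. (s - ?z) * (s * Gform s u v)) \<longlongrightarrow> (0\<^sub>m m m *\<^sub>v u) \<bullet>c v) (at ?z)"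
      using Z[OF u v] by simp
  qed (simp_all add: Z)
  then show ?thesis by blast
qed

text \<open>For negative \<open>w\<close> the residue is the entrywise conjugate of the one at
  \<open>- w\<close>, because the realization is real.\<close>

lemma residue_on_axis:
  assumes w: "w \<noteq> 0"
  obtains L where "psd_residue w L"
proof (cases "0 < w")
  case True
  then show thesis using residue_on_axis_pos that by blast
next
  case False
  then have "0 < - w" using w by simp
  then obtain K where res: "psd_residue (- w) K" using residue_on_axis_pos by blast
  then have K: "K \<in> carrier_mat m m" by (simp add: psd_residue_def)
  let ?z = "axis w"
  define L where "L = map_mat cnj K"
  have L: "L \<in> carrier_mat m m" using K by (simp add: L_def)
  have form: "(L *\<^sub>v u) \<bullet>c v = cnj ((K *\<^sub>v conjugate u) \<bullet>c conjugate v)"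
    if "u \<in> carrier_vec m" "v \<in> carrier_vec m" for u v
    by (subst form_eq_sum[OF L that], subst form_eq_sum[OF K]) (use that K in \<open>auto simp: L_def\<close>)
  have "psd_residue w L"
    unfolding psd_residue_def
  proof (intro conjI ballI L)
    fix u v :: "complex vec" assume u: "u \<in> carrier_vec m" and v: "v \<in> carrier_vec m"
    let ?f = "\<lambda>s. (s - axis (- w)) * (s * ((G s *\<^sub>v conjugate u) \<bullet>c conjugate v))"
    have "filterlim cnj (at (axis (- w))) (at ?z)"
      using filterlim_cnj_at[of ?z] by simp
    then have "((\<lambda>s. cnj (?f (cnj s))) \<longlongrightarrow> cnj ((K *\<^sub>v conjugate u) \<bullet>c conjugate v)) (at ?z)"
      using u v by (intro tendsto_cnj filterlim_compose[OF psd_residueD(1)[OF res]]) auto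
    then show "((\<lambda>s. (s - ?z) * (s * Gform s u v)) \<longlongrightarrow> (L *\<^sub>v u) \<bullet>c v) (at ?z)"
      unfolding form[OF u v] by (rule tendsto_off_spectrum) (use G_form_cnj u v in simp)
    show "(L *\<^sub>v u) \<bullet>c v = cnj ((L *\<^sub>v v) \<bullet>c u)"
      using psd_residueD(2)[OF res, of "conjugate u" "conjugate v"] u v by (simp add: form)
  next
    fix u :: "complex vec" assume u: "u \<in> carrier_vec m"
    then show "0 \<le> Re ((L *\<^sub>v u) \<bullet>c u)"
      using psd_residueD(3)[OF res, of "conjugate u" "conjugate u"] by (simp add: form)
  qed
  then show thesis by (rule that)
qed

section \<open>Positive realness on the half plane\<close>

lemma finite_axis_eigenvalues: "finite {w::real. eigenvalue (cmat A) (axis w)}"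
proof -
  have "inj (\<lambda>w::real. axis w)" by (auto simp: inj_def)
  then show ?thesis
    using finite_vimageI[OF finite_eigenvalues[OF dims(1)]] by (simp add: vimage_def)
qed

text \<open>The two instances \<open>h s = s\<close> and \<open>h s = - 1 / s\<close> say that \<open>s G(s)\<close> is positive real, and
  that so is \<open>- G(s) / s\<close> in the directions in which it has no pole at the origin.\<close>

lemma half_plane_nonneg_weighted:
  assumes x: "x \<in> carrier_vec m" and h: "h holomorphic_on - {0}"
    and axis: "\<And>w. w \<noteq> 0 \<Longrightarrow> \<exists>k\<ge>0. h (axis w) = of_real k * axis w"
    and zero: "((\<lambda>s. s * (h s * Gform s x x)) \<longlongrightarrow> 0) (at 0)"
    and inf: "((\<lambda>s. h s * Gform s x x) \<longlongrightarrow> M) at_infinity"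
    and s: "0 < Re s"
  shows "0 \<le> Re (h s * Gform s x x)"
proof -
  define g where "g = (\<lambda>s. Gform s x x)"
  define f where "f = (\<lambda>s. h s * g s)"
  let ?U = "{s. \<not> eigenvalue (cmat A) s}"
  have U: "open ?U" by (rule open_non_eigenvalues[OF dims(1)])
  have g: "g holomorphic_on ?U" unfolding g_def by (rule G_form_holomorphic[OF x x])
  have f: "f holomorphic_on ?U - {0}"
    unfolding f_def by (intro holomorphic_intros holomorphic_on_subset[OF g] holomorphic_on_subset[OF h]) auto
  have "0 \<le> Re (f s)"
  proof (rule half_plane_Re_nonneg[where f = f and L = M and F = "{w. eigenvalue (cmat A) (axis w)} \<union> {0}"])
    show "f holomorphic_on {s. 0 < Re s}"
      by (rule holomorphic_on_subset[OF f]) (use no_unstable_eigenvalue in auto)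
    show "finite ({w::real. eigenvalue (cmat A) (axis w)} \<union> {0})"
      using finite_axis_eigenvalues by simp
    show "0 \<le> Re (f (axis w))" if "w \<notin> {w. eigenvalue (cmat A) (axis w)} \<union> {0}" for w
    proof -
      obtain k where k: "0 \<le> k" "h (axis w) = of_real k * axis w"
        using axis[of w] \<open>w \<notin> _\<close> by auto
      have "0 \<le> Re (axis w * g (axis w))"
        unfolding g_def using that by (intro axis_nonneg[OF _ _ x]) auto
      from mult_nonneg_nonneg[OF k(1) this]
      have "0 \<le> k * Re (axis w * g (axis w))" .
      also have "\<dots> = Re (of_real k * (axis w * g (axis w)))" by simp
      finally show ?thesis by (simp only: f_def k(2) mult.assoc)
    qed
    show "\<exists>k\<ge>0. \<exists>L. ((\<lambda>s. f s - of_real k / (s - axis w)) \<longlongrightarrow> L) (at (axis w))" for w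
    proof -
      let ?z = "axis w"
      obtain k where k: "0 \<le> k" "((\<lambda>s. (s - ?z) * f s) \<longlongrightarrow> of_real k) (at ?z)"
      proof (cases "w = 0")
        case True
        then show thesis using that[of 0] zero by (simp add: f_def g_def)
      next
        case False
        obtain l where l: "0 \<le> l" "h ?z = of_real l * ?z" using axis[OF False] by blast
        obtain L where res: "psd_residue w L" by (rule residue_on_axis[OF False])
        have lim: "((\<lambda>s. (s - ?z) * (s * g s)) \<longlongrightarrow> (L *\<^sub>v x) \<bullet>c x) (at ?z)"
          unfolding g_def by (rule psd_residueD(1)[OF res x x])
        note herm = psd_residueD(2)[OF res x x] and psd = psd_residueD(3)[OF res x x]
        \<comment> \<open>Near \<open>?z\<close> the function \<open>f\<close> is
          \<open>s g(s)\<close> times \<open>h(s) / s\<close>, and the second factor tends to the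
          real number \<open>l \<ge> 0\<close>, so the residue stays nonnegative.\<close>
        have "isCont h ?z"
          using holomorphic_on_imp_continuous_on[OF h] False
          by (subst (asm) continuous_on_eq_continuous_at) auto
        then have "((\<lambda>s. (s - ?z) * (s * g s) * (h s / s)) \<longlongrightarrow> (L *\<^sub>v x) \<bullet>c x * (h ?z / ?z)) (at ?z)"
          unfolding isCont_def using False by (intro tendsto_intros lim) auto
        moreover have "eventually (\<lambda>s. (s - ?z) * (s * g s) * (h s / s) = (s - ?z) * f s) (at ?z)"
          using eventually_neq_at_within[of 0 ?z UNIV] by eventually_elim (simp add: f_def)
        ultimately have "((\<lambda>s. (s - ?z) * f s) \<longlongrightarrow> (L *\<^sub>v x) \<bullet>c x * (h ?z / ?z)) (at ?z)"
          by (rule Lim_transform_eventually)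
        moreover have "(L *\<^sub>v x) \<bullet>c x * (h ?z / ?z) = of_real (Re ((L *\<^sub>v x) \<bullet>c x) * l)"
          using herm False by (simp add: l(2) complex_eq_iff)
        ultimately show thesis using that[of "Re ((L *\<^sub>v x) \<bullet>c x) * l"] psd l(1) by simp
      qed
      have "open (?U - {0} \<union> {?z})"
      proof -
        have "?U - {0} \<union> {?z} = - (({s. eigenvalue (cmat A) s} \<union> {0}) - {?z})" by auto
        moreover have "finite (({s. eigenvalue (cmat A) s} \<union> {0}) - {?z})"
          using finite_eigenvalues[OF dims(1)] by simp
        ultimately show ?thesis using finite_imp_closed by (metis open_Compl)
      qed
      moreover have "f holomorphic_on (?U - {0} \<union> {?z}) - {?z}"
        by (rule holomorphic_on_subset[OF f]) auto
      ultimately show ?thesis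
        using simple_pole_remainder_tendsto[of f "?U - {0} \<union> {?z}" ?z "of_real k"] k by auto
    qed
    show "(f \<longlongrightarrow> M) at_infinity" using inf by (simp add: f_def g_def)
  qed (rule s)
  then show ?thesis by (simp add: f_def g_def)
qed

text \<open>At the origin \<open>s G(s)\<close> is bounded because \<open>G2 = 0\<close>, and at
  infinity because \<open>D = 0\<close>.\<close>

lemma positive_real:
  assumes x: "x \<in> carrier_vec m" and s: "0 < Re s"
  shows "0 \<le> Re (s * Gform s x x)"
proof (rule half_plane_nonneg_weighted[where h = "\<lambda>s. s", OF x _ _ _ _ s])
  show "\<exists>k\<ge>0. axis w = of_real k * axis w" for w :: real
    by (rule exI[of _ 1]) simp
  have "((\<lambda>s. s * (s * Gform s x x)) \<longlongrightarrow> 0 * ((cmat G1 *\<^sub>v x) \<bullet>c x)) (at 0)"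
    by (intro tendsto_mult residue_at_0 x tendsto_ident_at)
  then show "((\<lambda>s. s * (s * Gform s x x)) \<longlongrightarrow> 0) (at 0)" by simp
  have "((\<lambda>s. s * Rform s (cmat B *\<^sub>v x) (cmatT C *\<^sub>v x)) \<longlongrightarrow>
      (cmat B *\<^sub>v x) \<bullet>c (cmatT C *\<^sub>v x)) at_infinity"
    using x by (intro mult_resolvent_form_tendsto_at_infinity[OF dims(1)]) auto
  moreover have "eventually (\<lambda>s. s * Rform s (cmat B *\<^sub>v x) (cmatT C *\<^sub>v x) =
      s * Gform s x x) at_infinity"
    using eventually_non_eigenvalue_at_infinity[OF dims(1)]
    by eventually_elim (use x in \<open>simp add: G_form_strictly_proper\<close>)
  ultimately show "((\<lambda>s. s * Gform s x x) \<longlongrightarrow>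
      (cmat B *\<^sub>v x) \<bullet>c (cmatT C *\<^sub>v x)) at_infinity"
    by (rule Lim_transform_eventually)
qed (auto intro!: holomorphic_intros)

text \<open>Division by \<open>s\<close> could produce a double pole at the origin; as both
  coefficients vanish at \<open>x\<close>, the form of \<open>G(s)\<close> tends to \<open>0\<close>
  there and no residue is left. On the axis, \<open>- 1 / (\<i> w)\<close> is the positive multiple
  \<open>1 / w^2\<close> of \<open>\<i> w\<close>.\<close>

lemma reciprocal_positive_real:
  assumes x: "x \<in> carrier_vec m" and G1x: "(cmat G1 *\<^sub>v x) \<bullet>c x = 0"
    and G0x: "(cmat G0 *\<^sub>v x) \<bullet>c x = 0" and s: "0 < Re s"
  shows "0 \<le> Re (- 1 / s * Gform s x x)"
proof (rule half_plane_nonneg_weighted[where h = "\<lambda>s. - 1 / s", OF x _ _ _ _ s])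
  show "\<exists>k\<ge>0. - 1 / (axis w) = of_real k * axis w" if "w \<noteq> 0" for w :: real
    using that by (intro exI[of _ "1 / w\<^sup>2"]) (simp add: field_simps power2_eq_square)
  have "((\<lambda>s. - Gform s x x) \<longlongrightarrow> - 0) (at 0)"
    using constant_term_at_0[OF x x] by (intro tendsto_minus) (simp add: G1x G0x)
  moreover have "eventually (\<lambda>s. - Gform s x x = s * (- 1 / s * Gform s x x)) (at 0)"
    by (auto simp: eventually_at_filter)
  ultimately show "((\<lambda>s. s * (- 1 / s * Gform s x x)) \<longlongrightarrow> 0) (at 0)"
    by (simp add: Lim_transform_eventually)
  have "((\<lambda>s. Rform s (cmat B *\<^sub>v x) (cmatT C *\<^sub>v x)) \<longlongrightarrow> 0) at_infinity"
    using x by (intro resolvent_form_tendsto_0_at_infinity[OF dims(1)]) auto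
  then have "((\<lambda>s. - Rform s (cmat B *\<^sub>v x) (cmatT C *\<^sub>v x) / s) \<longlongrightarrow> 0) at_infinity"
    by (rule tendsto_divide_0[OF tendsto_minus filterlim_ident])
  moreover have "eventually (\<lambda>s. - Rform s (cmat B *\<^sub>v x) (cmatT C *\<^sub>v x) / s =
      - 1 / s * Gform s x x) at_infinity"
    using eventually_non_eigenvalue_at_infinity[OF dims(1)]
    by eventually_elim (use x in \<open>simp add: G_form_strictly_proper\<close>)
  ultimately show "((\<lambda>s. - 1 / s * Gform s x x) \<longlongrightarrow> 0) at_infinity"
    by (rule Lim_transform_eventually)
qed (auto intro!: holomorphic_intros)

lemma G1_form_nonneg:
  assumes x: "x \<in> carrier_vec m"
  shows "0 \<le> Re ((cmat G1 *\<^sub>v x) \<bullet>c x)"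
proof (rule tendsto_lowerbound)
  show "((\<lambda>s. Re (s * Gform s x x)) \<longlongrightarrow> Re ((cmat G1 *\<^sub>v x) \<bullet>c x)) (at 0 within {s. 0 < Re s})"
    by (rule tendsto_within_subset[OF tendsto_Re[OF residue_at_0[OF x x]]]) simp
  show "eventually (\<lambda>s. 0 \<le> Re (s * Gform s x x)) (at 0 within {s. 0 < Re s})"
    unfolding eventually_at_filter using positive_real[OF x] by (intro always_eventually) blast
qed (rule half_plane_at_0)

section \<open>The kernel of \<open>G1\<close>\<close>

lemma G1_adjoint:
  "x \<in> carrier_vec m \<Longrightarrow> y \<in> carrier_vec m \<Longrightarrow>
    (cmat G1 *\<^sub>v x) \<bullet>c y = x \<bullet>c (cmatT G1 *\<^sub>v y)"
  using cmat_adjoint[OF G1_dim] by blast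

text \<open>What is available is semidefiniteness of the Hermitian part of \<open>G1\<close>, not
  symmetry; by \<open>semidefinite_form_kernel\<close> it already makes a kernel vector orthogonal
  to the range.\<close>

lemma G1_kernel_transpose:
  assumes x: "x \<in> carrier_vec m" and k: "cmat G1 *\<^sub>v x = 0\<^sub>v m"
  shows "cmatT G1 *\<^sub>v x = 0\<^sub>v m"
proof -
  have T: "cmatT G1 \<in> carrier_mat m m" using G1_dim by simp
  have "(cmatT G1 *\<^sub>v x) \<bullet>c v = 0" if v: "v \<in> carrier_vec m" for v
  proof -
    have "(cmat G1 *\<^sub>v x) \<bullet>c v + cnj ((cmat G1 *\<^sub>v v) \<bullet>c x) = 0"
      by (rule semidefinite_form_kernel[OF cG_dims(1) G1_form_nonneg x _ v]) (simp_all add: k x)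
    then have "(cmat G1 *\<^sub>v v) \<bullet>c x = 0" using k v by simp
    then have "v \<bullet>c (cmatT G1 *\<^sub>v x) = 0" using G1_adjoint[OF v x] by (simp only:)
    then show ?thesis
      unfolding cscalar_commute[OF mult_mat_vec_carrier[OF T x] v] by (simp only: complex_cnj_zero)
  qed
  then show ?thesis
    by (rule cscalar_prod_eq_0_imp_zero[OF mult_mat_vec_carrier[OF T x]])
qed

lemma G1_kernel_form:
  assumes x: "x \<in> carrier_vec m" and k: "cmat G1 *\<^sub>v x = 0\<^sub>v m" and v: "v \<in> carrier_vec m"
  shows "(cmat G1 *\<^sub>v v) \<bullet>c x = 0"
  using G1_adjoint[OF v x] G1_kernel_transpose[OF x k] v by simp

text \<open>Here the inclusion of null spaces enters, applied to the real and imaginary parts of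
  \<open>x\<close>.\<close>

lemma G1_kernel_G0_form:
  assumes x: "x \<in> carrier_vec m" and k: "cmat G1 *\<^sub>v x = 0\<^sub>v m" and v: "v \<in> carrier_vec m"
  shows "(cmat G0 *\<^sub>v v) \<bullet>c x = 0"
proof -
  have "map_vec Re x \<in> mat_kernel (transpose_mat G1)" "map_vec Im x \<in> mat_kernel (transpose_mat G1)"
    using G1_kernel_transpose[OF x k] x G1_dim
    by (simp_all add: cmat_mult_eq_0_iff[of "transpose_mat G1" m m x] mat_kernel_def)
  then have "map_vec Re x \<in> mat_kernel (transpose_mat G0)" "map_vec Im x \<in> mat_kernel (transpose_mat G0)"
    using kernels by blast+
  then have "cmatT G0 *\<^sub>v x = 0\<^sub>v m"
    using x G0_dim by (simp add: cmat_mult_eq_0_iff[of "transpose_mat G0" m m x] mat_kernel_def)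
  then show ?thesis using cmat_adjoint[OF G0_dim v x] v by simp
qed

text \<open>At \<open>s = 1\<close> the weights \<open>s\<close> and \<open>- 1 / s\<close> are
  opposite, so the two positive real functions together give \<open>Re (f 1) = 0\<close>. The
  minimum is attained inside, \<open>f\<close> is constant, and its limit at the origin is
  \<open>0\<close>.\<close>

lemma G1_kernel_quadratic:
  assumes x: "x \<in> carrier_vec m" and k: "cmat G1 *\<^sub>v x = 0\<^sub>v m" and s: "0 < Re s"
  shows "Gform s x x = 0"
proof -
  define f where "f = (\<lambda>s. s * Gform s x x)"
  have "(\<lambda>s. Gform s x x) holomorphic_on {s. 0 < Re s}"
    using no_unstable_eigenvalue by (intro holomorphic_on_subset[OF G_form_holomorphic[OF x x]]) auto
  then have f: "f holomorphic_on {s. 0 < Re s}"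
    unfolding f_def by (intro holomorphic_intros)
  have pr: "0 \<le> Re (f s)" if "0 < Re s" for s
    unfolding f_def using positive_real[OF x that] .
  have "0 \<le> Re (- 1 / 1 * ((G 1 *\<^sub>v x) \<bullet>c x))"
    using reciprocal_positive_real[OF x, of 1] G1_kernel_form[OF x k x] G1_kernel_G0_form[OF x k x] by simp
  then have "Re (f 1) = 0" using pr[of 1] by (simp add: f_def)
  then have "f constant_on {s. 0 < Re s}"
    using pr by (intro Re_minimum_imp_constant_on[OF f, of 1]) auto
  moreover have "(f \<longlongrightarrow> 0) (at 0)"
    using residue_at_0[OF x x] k x by (simp add: f_def)
  ultimately have "f s = 0" using constant_on_half_plane_limit_0 s by blast
  then show ?thesis using s by (auto simp: f_def)
qed

text \<open>Off-diagonal blocks: \<open>\<phi>(s) = - \<psi>(s)\<^sup>*\<close> with both sides holomorphic forces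
  \<open>\<phi>\<close> and \<open>\<psi>\<close> to be constant.\<close>

lemma G1_kernel_forms:
  assumes x: "x \<in> carrier_vec m" and k: "cmat G1 *\<^sub>v x = 0\<^sub>v m" and v: "v \<in> carrier_vec m"
    and s: "0 < Re s"
  shows "Gform s x v = 0" "Gform s v x = 0"
proof -
  define \<phi> where "\<phi> = (\<lambda>s. s * Gform s x v)"
  define \<psi> where "\<psi> = (\<lambda>s. s * Gform s v x)"
  have hol: "\<phi> holomorphic_on {s. 0 < Re s}" "\<psi> holomorphic_on {s. 0 < Re s}"
    unfolding \<phi>_def \<psi>_def using no_unstable_eigenvalue
    by (intro holomorphic_intros holomorphic_on_subset[OF G_form_holomorphic[OF x v]]
        holomorphic_on_subset[OF G_form_holomorphic[OF v x]]; auto)+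
  have rel: "\<phi> s = - cnj (\<psi> s)" if s: "0 < Re s" for s
  proof -
    have form: "((s \<cdot>\<^sub>m G s) *\<^sub>v a) \<bullet>c b = s * Gform s a b"
      if "a \<in> carrier_vec m" "b \<in> carrier_vec m" for a b
      using smult_form[OF dims(7) that] .
    have "((s \<cdot>\<^sub>m G s) *\<^sub>v x) \<bullet>c v + cnj (((s \<cdot>\<^sub>m G s) *\<^sub>v v) \<bullet>c x) = 0"
      by (rule semidefinite_form_kernel[of _ m])
         (use x v positive_real[OF _ s] G1_kernel_quadratic[OF x k s] in \<open>simp_all add: form\<close>)
    then show ?thesis using x v by (simp add: form \<phi>_def \<psi>_def add_eq_0_iff)
  qed
  have lim: "(\<phi> \<longlongrightarrow> 0) (at 0)" "(\<psi> \<longlongrightarrow> 0) (at 0)"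
    using residue_at_0[OF x v] residue_at_0[OF v x] k v G1_kernel_form[OF x k v]
    by (simp_all add: \<phi>_def \<psi>_def)
  \<comment> \<open>By \<open>rel\<close>, the sum equals \<open>\<psi> - cnj \<psi>\<close>, which
    is purely imaginary; \<open>\<phi> - \<psi>\<close> is real, whence the factor
    \<open>\<i>\<close> below.\<close>
  have "(\<lambda>s. \<phi> s + \<psi> s) constant_on {s. 0 < Re s}"
    by (rule Re_minimum_imp_constant_on[where z = 1]) (auto simp: rel intro!: holomorphic_intros hol)
  from constant_on_half_plane_limit_0[OF this tendsto_add_zero[OF lim] s]
  have sum: "\<phi> s + \<psi> s = 0" .
  have "(\<lambda>s. \<i> * (\<phi> s - \<psi> s)) constant_on {s. 0 < Re s}"
    by (rule Re_minimum_imp_constant_on[where z = 1]) (auto simp: rel intro!: holomorphic_intros hol)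
  from constant_on_half_plane_limit_0[OF this _ s, of 0]
  have "\<i> * (\<phi> s - \<psi> s) = 0"
    using tendsto_mult[OF tendsto_const[of \<i>] tendsto_diff[OF lim]] by simp
  then have "\<phi> s = 0" "\<psi> s = 0" using sum by auto
  then show "Gform s x v = 0" "Gform s v x = 0"
    using s by (auto simp: \<phi>_def \<psi>_def)
qed

text \<open>Observability strengthens the vanishing of the output to that of the whole response
  \<open>R(s) B u\<close>, and \<open>B u\<close> is recovered as the limit of
  \<open>s R(s) B u\<close>.\<close>

lemma G1_kernel_B:
  assumes u: "u \<in> carrier_vec m" and k: "cmat G1 *\<^sub>v u = 0\<^sub>v m"
  shows "cmat B *\<^sub>v u = 0\<^sub>v n"
proof (rule cscalar_prod_eq_0_imp_zero)
  let ?b = "cmat B *\<^sub>v u"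
  show b: "?b \<in> carrier_vec n" using u by simp
  \<comment> \<open>Proved for a single \<open>c\<close>, because the invariance of \<open>S\<close>
    under \<open>A^T\<close> already uses it: there the form becomes
    \<open>s * 0 - ?b \<bullet>c c\<close>.\<close>
  have orth: "?b \<bullet>c c = 0" if c: "c \<in> carrier_vec n"
    and z: "\<And>s. 0 < Re s \<Longrightarrow> Rform s ?b c = 0" for c
  proof -
    have "((\<lambda>t::real. of_real t * ((R (of_real t) *\<^sub>v ?b) \<bullet>c c)) \<longlongrightarrow> ?b \<bullet>c c) at_top"
      by (rule filterlim_compose[OF mult_resolvent_form_tendsto_at_infinity[OF dims(1) b c]
          filterlim_of_real_at_infinity])
    moreover have "((\<lambda>t::real. of_real t * ((R (of_real t) *\<^sub>v ?b) \<bullet>c c)) \<longlongrightarrow> 0) at_top"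
      by (rule tendsto_eventually) (use z in \<open>intro eventually_mono[OF eventually_gt_at_top[of 0]], simp\<close>)
    ultimately show ?thesis using tendsto_unique trivial_limit_at_top_linorder by blast
  qed
  define S where "S = {c \<in> carrier_vec n. \<forall>s. 0 < Re s \<longrightarrow> Rform s ?b c = 0}"
  have Rb: "R s *\<^sub>v ?b \<in> carrier_vec n" if "0 < Re s" for s
    using no_unstable_eigenvalue[OF that] b by simp
  fix c :: "complex vec" assume c: "c \<in> carrier_vec n"
  have "c \<in> S"
  proof (rule observable_induct[OF _ _ _ c])
    show "vec_subspace n S"
    proof (rule vec_subspaceI)
      show "x + y \<in> S" if "x \<in> S" "y \<in> S" for x y
        using that Rb cscalar_prod_add_right[of _ n] by (auto simp: S_def)
      show "a \<cdot>\<^sub>v x \<in> S" if "x \<in> S" for a x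
        using that Rb cscalar_prod_smult_right[of _ n] by (auto simp: S_def)
      show "0\<^sub>v n \<in> S" using Rb by (auto simp: S_def)
    qed (auto simp: S_def)
  next
    fix x assume x: "x \<in> S"
    have "Rform s ?b (cmatT A *\<^sub>v x) = 0" if s: "0 < Re s" for s
      using A_adjoint[OF Rb[OF s], of x] mult_resolvent_form[OF dims(1) no_unstable_eigenvalue[OF s] b, of x]
        orth[of x] x s by (simp add: S_def)
    then show "cmatT A *\<^sub>v x \<in> S" using x by (simp add: S_def)
  next
    fix v :: "complex vec" assume v: "v \<in> carrier_vec m"
    then show "cmatT C *\<^sub>v v \<in> S"
      using G1_kernel_forms(1)[OF u k v] G_form_strictly_proper[OF no_unstable_eigenvalue u v]
      by (auto simp: S_def)
  qed
  then show "?b \<bullet>c c = 0" using orth c by (simp add: S_def)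
qed

text \<open>Minimality transfers the pole bound from \<open>G\<close> to the resolvent:
  \<open>0\<close> is at most a semisimple eigenvalue of \<open>A\<close>.\<close>

lemma simple_eigenvalue_at_0:
  assumes "b \<in> carrier_vec n" "c \<in> carrier_vec n"
  shows "\<exists>L. ((\<lambda>s. s * Rform s b c) \<longlongrightarrow> L) (at 0)"
  by (rule resolvent_form_converges[OF tendsto_ident_at _ assms]) (use residue_at_0 in blast)

text \<open>An input that admits an equilibrium does not excite the pole at the origin:
  \<open>s R(s) B u = s x - s (s R(s) x)\<close> tends to \<open>0\<close>, because
  \<open>s R(s) x\<close> converges.\<close>

lemma equilibrium_input:
  assumes x: "x \<in> carrier_vec n" and u: "u \<in> carrier_vec m"
    and eq: "0\<^sub>v n = cmat A *\<^sub>v x + cmat B *\<^sub>v u"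
  shows "cmat G1 *\<^sub>v u = 0\<^sub>v m"
proof (rule cscalar_prod_eq_0_imp_zero)
  show "cmat G1 *\<^sub>v u \<in> carrier_vec m" using u by simp
  fix v :: "complex vec" assume v: "v \<in> carrier_vec m"
  let ?c = "cmatT C *\<^sub>v v"
  have c: "?c \<in> carrier_vec n" using v by simp
  obtain L where L: "((\<lambda>s. s * Rform s x ?c) \<longlongrightarrow> L) (at 0)"
    using simple_eigenvalue_at_0[OF x c] by blast
  have "((\<lambda>s. s * (x \<bullet>c ?c) - s * (s * Rform s x ?c)) \<longlongrightarrow> 0 * (x \<bullet>c ?c) - 0 * L) (at 0)"
    by (intro tendsto_intros L)
  then have "((\<lambda>s. s * Gform s u v) \<longlongrightarrow> 0 * (x \<bullet>c ?c) - 0 * L) (at 0)"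
  proof (rule tendsto_off_spectrum)
    fix s assume s: "\<not> eigenvalue (cmat A) s"
    have "0 \<cdot>\<^sub>v x = 0\<^sub>v n" using x by (intro eq_vecI) auto
    then have r: "Rform s (cmat B *\<^sub>v u) ?c = x \<bullet>c ?c - (s - 0) * Rform s x ?c"
      using eq by (intro resolvent_input_output[OF s x u _ c]) simp
    show "s * (x \<bullet>c ?c) - s * (s * Rform s x ?c) = s * Gform s u v"
      unfolding G_form_strictly_proper[OF s u v] r by (simp add: algebra_simps)
  qed
  then have "((\<lambda>s. s * Gform s u v) \<longlongrightarrow> 0) (at 0)" by simp
  then show "(cmat G1 *\<^sub>v u) \<bullet>c v = 0"
    using residue_at_0[OF u v] tendsto_unique at_neq_bot by blast
qed

text \<open>For \<open>A x = 0\<close> one has \<open>s R(s) x = x\<close>, so the form is a limit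
  of resolvent forms; controllability reduces that limit to inputs \<open>B u\<close>, where it is a
  form of \<open>G1\<close>.\<close>

lemma equilibrium_output:
  assumes x: "x \<in> carrier_vec n" and Ax: "cmat A *\<^sub>v x = 0\<^sub>v n"
    and k: "k \<in> carrier_vec m" "cmat G1 *\<^sub>v k = 0\<^sub>v m"
  shows "(cmat C *\<^sub>v x) \<bullet>c k = 0"
proof -
  let ?c = "cmatT C *\<^sub>v k"
  have "((\<lambda>s. s * Rform s x ?c) \<longlongrightarrow> 0) (at 0)"
  proof (rule resolvent_form_tendsto_0[OF tendsto_ident_at _ _ x])
    fix u :: "complex vec" assume u: "u \<in> carrier_vec m"
    have "((\<lambda>s. s * Gform s u k) \<longlongrightarrow> 0) (at 0)"
      using residue_at_0[OF u k(1)] G1_kernel_form[OF k u] by simp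
    then show "((\<lambda>s. s * Rform s (cmat B *\<^sub>v u) ?c) \<longlongrightarrow> 0) (at 0)"
      by (rule tendsto_off_spectrum) (use u k in \<open>simp add: G_form_strictly_proper\<close>)
  qed (use k in simp)
  moreover have "eventually (\<lambda>s. s * Rform s x ?c = x \<bullet>c ?c) (at 0)"
  proof -
    have Ax0: "cmat A *\<^sub>v x = 0 \<cdot>\<^sub>v x" unfolding Ax using x by (intro eq_vecI) auto
    show ?thesis
      using eventually_not_eigenvalue eventually_neq_at_within[of 0 0 UNIV]
      by eventually_elim
        (use x k eigenvector_resolvent[OF x Ax0] in \<open>simp add: smult_scalar_prod_distrib[of _ n]\<close>)
  qed
  ultimately have "((\<lambda>s::complex. x \<bullet>c ?c) \<longlongrightarrow> 0) (at 0)"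
    by (rule Lim_transform_eventually)
  then show ?thesis using C_adjoint[OF x k(1)] by (simp add: tendsto_const_iff)
qed

text \<open>The witness is the residue of \<open>R(s) B v\<close> at the origin: \<open>A\<close>
  annihilates it because the pole is at most simple, and \<open>C\<close> maps it to the residue of
  \<open>G(s) v\<close>.\<close>

lemma G1_range_state:
  assumes v: "v \<in> carrier_vec m"
  obtains x where "x \<in> carrier_vec n" "cmat A *\<^sub>v x = 0\<^sub>v n" "cmat C *\<^sub>v x = cmat G1 *\<^sub>v v"
proof -
  let ?b = "cmat B *\<^sub>v v"
  have b: "?b \<in> carrier_vec n" using v by simp
  obtain l where l: "\<And>i. ((\<lambda>s. s * Rform s ?b (unit_vec n i)) \<longlongrightarrow> l i) (at 0)"
    using simple_eigenvalue_at_0[OF b unit_vec_carrier] by metis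
  define x where "x = vec n l"
  have x: "x \<in> carrier_vec n" by (simp add: x_def)
  have lim: "((\<lambda>s. s * Rform s ?b c) \<longlongrightarrow> x \<bullet>c c) (at 0)" if c: "c \<in> carrier_vec n" for c
  proof -
    have "((\<lambda>s. \<Sum>i<n. s * Rform s ?b (unit_vec n i) * cnj (c $ i)) \<longlongrightarrow> (\<Sum>i<n. l i * cnj (c $ i))) (at 0)"
      by (intro tendsto_intros l)
    moreover have "(\<Sum>i<n. l i * cnj (c $ i)) = x \<bullet>c c"
      using c by (auto simp: x_def scalar_prod_def atLeast0LessThan)
    moreover have "(\<Sum>i<n. s * Rform s ?b (unit_vec n i) * cnj (c $ i)) = s * Rform s ?b c" for s
    proof -
      have "conjugate (unit_vec n i) = (unit_vec n i :: complex vec)" for i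
        by (intro eq_vecI) (auto simp: unit_vec_def)
      then show ?thesis using c
        by (simp add: scalar_prod_def[of "R s *\<^sub>v ?b" "conjugate c"] atLeast0LessThan sum_distrib_left mult.assoc
            del: index_mult_mat_vec)
    qed
    ultimately show ?thesis by simp
  qed
  have "(cmat A *\<^sub>v x) \<bullet>c c = 0" if c: "c \<in> carrier_vec n" for c
  proof -
    have "((\<lambda>s. s * (s * Rform s ?b c) - s * (?b \<bullet>c c)) \<longlongrightarrow> 0 * (x \<bullet>c c) - 0 * (?b \<bullet>c c)) (at 0)"
      by (intro tendsto_intros lim c)
    then have "((\<lambda>s. s * Rform s ?b (cmatT A *\<^sub>v c)) \<longlongrightarrow> 0 * (x \<bullet>c c) - 0 * (?b \<bullet>c c)) (at 0)"
      by (rule tendsto_off_spectrum) (simp add: resolvent_form_shift(2)[OF _ b c] right_diff_distrib)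
    then have "((\<lambda>s. s * Rform s ?b (cmatT A *\<^sub>v c)) \<longlongrightarrow> 0) (at 0)" by simp
    then have "x \<bullet>c (cmatT A *\<^sub>v c) = 0"
      using lim[OF vec_dims(5)[OF c]] tendsto_unique at_neq_bot by blast
    then show ?thesis using A_adjoint[OF x c] by simp
  qed
  then have Ax: "cmat A *\<^sub>v x = 0\<^sub>v n" using x by (intro cscalar_prod_eq_0_imp_zero) auto
  have "(cmat C *\<^sub>v x) \<bullet>c c = (cmat G1 *\<^sub>v v) \<bullet>c c" if c: "c \<in> carrier_vec m" for c
  proof -
    have "((\<lambda>s. s * Gform s v c) \<longlongrightarrow> x \<bullet>c (cmatT C *\<^sub>v c)) (at 0)"
      by (rule tendsto_off_spectrum[OF lim[OF vec_dims(6)[OF c]]])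
         (use v c in \<open>simp add: G_form_strictly_proper\<close>)
    then have "x \<bullet>c (cmatT C *\<^sub>v c) = (cmat G1 *\<^sub>v v) \<bullet>c c"
      using residue_at_0[OF v c] tendsto_unique at_neq_bot by blast
    then show ?thesis using C_adjoint[OF x c] by simp
  qed
  then have "cmat C *\<^sub>v x = cmat G1 *\<^sub>v v" using x v by (intro cscalar_prod_ext) auto
  then show thesis by (rule that[OF x Ax])
qed

text \<open>This covers axis poles of \<open>G\<close>. Solvability of the state equation at
  \<open>z\<close> forces the residue there to annihilate \<open>u\<close>, so
  \<open>u\<^sup>* G(s) u\<close> has the finite limit \<open>u\<^sup>* C x\<close>, whose sign is
  inherited along the axis.\<close>

lemma axis_state_nonneg:
  assumes w: "w \<noteq> 0" and x: "x \<in> carrier_vec n" and u: "u \<in> carrier_vec m"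
    and eq: "(axis w) \<cdot>\<^sub>v x = cmat A *\<^sub>v x + cmat B *\<^sub>v u"
  shows "0 \<le> Re (axis w * ((cmat C *\<^sub>v x) \<bullet>c u))"
proof -
  define z where "z = \<i> * complex_of_real w"
  have z: "z \<noteq> 0" using w by (simp add: z_def)
  obtain L where res: "psd_residue w L" by (rule residue_on_axis[OF w])
  note L = psd_residueD(1)[OF res, folded z_def] and herm = psd_residueD(2)[OF res]
  have lim: "((\<lambda>s. (s - z) * Gform s u v) \<longlongrightarrow> (L *\<^sub>v u) \<bullet>c v / z) (at z)"
    if u: "u \<in> carrier_vec m" and v: "v \<in> carrier_vec m" for u v
  proof -
    have "((\<lambda>s. (s - z) * (s * Gform s u v) / s) \<longlongrightarrow> (L *\<^sub>v u) \<bullet>c v / z) (at z)"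
      by (intro tendsto_intros L u v z)
    moreover have "eventually (\<lambda>s. (s - z) * (s * Gform s u v) / s = (s - z) * Gform s u v) (at z)"
      using eventually_neq_at_within[of 0 z UNIV] by eventually_elim simp
    ultimately show ?thesis by (rule Lim_transform_eventually)
  qed
  have phi: "((\<lambda>s. s - z) \<longlongrightarrow> 0) (at z)" by (auto intro!: tendsto_eq_intros)
  have out: "Gform s u v = x \<bullet>c (cmatT C *\<^sub>v v) -
      (s - z) * Rform s x (cmatT C *\<^sub>v v)"
    if s: "\<not> eigenvalue (cmat A) s" and v: "v \<in> carrier_vec m" for s v
    unfolding G_form_strictly_proper[OF s u v]
    using resolvent_input_output[OF s x u _ vec_dims(6)[OF v]] eq unfolding z_def .
  \<comment> \<open>Because \<open>(s - z) R(s) x\<close> converges, the identity \<open>out\<close>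
    shows that \<open>(s - z) G(s) u\<close> tends to \<open>0\<close>.\<close>
  have Lu: "(L *\<^sub>v u) \<bullet>c v = 0" if v: "v \<in> carrier_vec m" for v
  proof -
    let ?c = "cmatT C *\<^sub>v v"
    have c: "?c \<in> carrier_vec n" using v by simp
    obtain M where M: "((\<lambda>s. (s - z) * Rform s x ?c) \<longlongrightarrow> M) (at z)"
      using resolvent_form_converges[OF phi _ x c] lim by blast
    have "((\<lambda>s. (s - z) * (x \<bullet>c ?c - (s - z) * Rform s x ?c)) \<longlongrightarrow> 0 * (x \<bullet>c ?c - M)) (at z)"
      by (intro tendsto_intros M phi)
    then have "((\<lambda>s. (s - z) * Gform s u v) \<longlongrightarrow> 0 * (x \<bullet>c ?c - M)) (at z)"
      by (rule tendsto_off_spectrum) (simp add: out[OF _ v])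
    then have "(L *\<^sub>v u) \<bullet>c v / z = 0 * (x \<bullet>c ?c - M)"
      using lim[OF u v] tendsto_unique at_neq_bot by blast
    then show ?thesis using z by simp
  qed
  let ?c = "cmatT C *\<^sub>v u"
  \<comment> \<open>Hermitian symmetry of the residue moves the vanishing from the input side to the
    output side, which is what pairing with \<open>C^T u\<close> requires.\<close>
  have "((\<lambda>s. (s - z) * Rform s x ?c) \<longlongrightarrow> 0) (at z)"
  proof (rule resolvent_form_tendsto_0[OF phi _ _ x])
    show "?c \<in> carrier_vec n" using u by simp
    fix v :: "complex vec" assume v: "v \<in> carrier_vec m"
    have "((\<lambda>s. (s - z) * Gform s v u) \<longlongrightarrow> 0) (at z)"
      using lim[OF v u] herm[OF v u] Lu[OF v] by simp
    then show "((\<lambda>s. (s - z) * Rform s (cmat B *\<^sub>v v) ?c) \<longlongrightarrow> 0) (at z)"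
      by (rule tendsto_off_spectrum) (use u v in \<open>simp add: G_form_strictly_proper\<close>)
  qed
  from tendsto_diff[OF tendsto_const this, of "x \<bullet>c ?c"]
  have "((\<lambda>s. x \<bullet>c ?c - (s - z) * Rform s x ?c) \<longlongrightarrow> (cmat C *\<^sub>v x) \<bullet>c u) (at z)"
    using C_adjoint[OF x u] by simp
  then have G: "((\<lambda>s. Gform s u u) \<longlongrightarrow> (cmat C *\<^sub>v x) \<bullet>c u) (at z)"
    by (rule tendsto_off_spectrum) (simp add: out[OF _ u])
  have "((\<lambda>s. Re (s * Gform s u u)) \<longlongrightarrow> Re (z * ((cmat C *\<^sub>v x) \<bullet>c u))) (at z)"
    by (intro tendsto_intros G)
  from filterlim_compose[OF this[unfolded z_def] filterlim_vertical_line[of w]]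
  have "((\<lambda>t. Re (axis (w + t) * ((G (axis (w + t)) *\<^sub>v u) \<bullet>c u))) \<longlongrightarrow>
      Re (axis w * ((cmat C *\<^sub>v x) \<bullet>c u))) (at 0)" .
  moreover have "eventually (\<lambda>t. 0 \<le> Re (axis (w + t) * ((G (axis (w + t)) *\<^sub>v u) \<bullet>c u))) (at 0)"
  proof -
    have "finite ({w. eigenvalue (cmat A) (axis w)} \<union> {0})" using finite_axis_eigenvalues by simp
    from eventually_not_in_finite_line[OF this, of w] show ?thesis
      by eventually_elim (rule axis_nonneg, use u in auto)
  qed
  ultimately show ?thesis by (intro tendsto_lowerbound) auto
qed

end

section \<open>The feedback loop\<close>

context ni_system
begin

text \<open>The converse of \<open>G1_kernel_transpose\<close>, phrased as orthogonality to the
  range, by the same argument.\<close>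

lemma G1_transpose_kernel:
  assumes u: "u \<in> carrier_vec m" and k: "\<And>v. v \<in> carrier_vec m \<Longrightarrow> (cmat G1 *\<^sub>v v) \<bullet>c u = 0"
  shows "cmat G1 *\<^sub>v u = 0\<^sub>v m"
proof (rule cscalar_prod_eq_0_imp_zero)
  show "cmat G1 *\<^sub>v u \<in> carrier_vec m" using u by simp
  fix v :: "complex vec" assume v: "v \<in> carrier_vec m"
  have "(cmat G1 *\<^sub>v u) \<bullet>c v + cnj ((cmat G1 *\<^sub>v v) \<bullet>c u) = 0"
    by (rule semidefinite_form_kernel[OF cG_dims(1) G1_form_nonneg u _ v]) (simp_all add: k u)
  then show "(cmat G1 *\<^sub>v u) \<bullet>c v = 0" using k[OF v] by simp
qed

end

lemma minv_one: "minv (1\<^sub>m n) = (1\<^sub>m n :: 'a::field mat)"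
  by (rule minv_unique[of _ n]) auto

lemma append_vec_cancel:
  fixes v x :: "complex vec"
  assumes "v \<in> carrier_vec n" "x \<in> carrier_vec (n + p)"
  shows "0 \<cdot>\<^sub>v x = (v @\<^sub>v 0\<^sub>v p) + (((-1) \<cdot>\<^sub>v v) @\<^sub>v 0\<^sub>v p)"
  using assms by (intro eq_vecI) (auto simp: append_vec_def Let_def)

lemma add_vec_shuffle:
  fixes a b c :: "'a::comm_monoid_add vec"
  assumes "a \<in> carrier_vec n" "b \<in> carrier_vec n" "c \<in> carrier_vec n"
  shows "a + c + b = a + (b + c)"
  using assms by (intro eq_vecI) (auto simp: ac_simps)

lemma append_zero_cscalar_prod:
  fixes x x' c :: "complex vec"
  assumes "x \<in> carrier_vec n" "x' \<in> carrier_vec p" "c \<in> carrier_vec n"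
  shows "(x @\<^sub>v x') \<bullet>c (c @\<^sub>v 0\<^sub>v p) = x \<bullet>c c"
proof -
  have "conjugate (c @\<^sub>v 0\<^sub>v p) = conjugate c @\<^sub>v 0\<^sub>v p"
    by (intro eq_vecI) (auto simp: append_vec_def Let_def)
  then show ?thesis using assms by (simp add: scalar_prod_append[of _ n _ p])
qed

section \<open>The closed loop and its state equation\<close>

locale feedback = P: ni_system m n A B C D G1 G0 + Q: sni_system m p A' B' C' D'
  for m n p :: nat and A B C D A' B' C' D' G1 G0 :: "real mat"
begin

abbreviation Acl where "Acl \<equiv> cmat (closed_loop A B C D A' B' C' D')"

text \<open>Input and output vectors of the loop on the side of \<open>G\<close>: an external signal
  is added to the input of \<open>G\<close>, and the output of \<open>G\<close> is observed. The
  loop transfer matrix of the overview is formed with these.\<close>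

abbreviation Bcl where "Bcl e \<equiv> (cmat B *\<^sub>v e) @\<^sub>v 0\<^sub>v p"
abbreviation Ccl where "Ccl e \<equiv> (cmatT C *\<^sub>v e) @\<^sub>v 0\<^sub>v p"
abbreviation Rcl where "Rcl \<equiv> resolvent Acl"
abbreviation loop_stable where "loop_stable \<equiv> hurwitz (closed_loop A B C D A' B' C' D')"

text \<open>With \<open>D = 0\<close> the matrix to be inverted is the identity, and both terms
  containing \<open>E * D\<close> vanish.\<close>

lemma closed_loop_eq:
  "closed_loop A B C D A' B' C' D' = four_block_mat (A + B * D' * C) (B * C') (B' * C) A'"
proof -
  note d = P.real_dims Q.real_dims
  have Z: "0\<^sub>m m m * D' = 0\<^sub>m m m" using d by simp
  have E: "1\<^sub>m m - 0\<^sub>m m m = (1\<^sub>m m :: real mat)" by (intro eq_matI) auto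
  have "B * D' * 1\<^sub>m m = B * D'" "B' * 1\<^sub>m m = B'" using d by (auto intro: right_mult_one_mat)
  moreover have "B * D' * 1\<^sub>m m * 0\<^sub>m m m * C' = 0\<^sub>m n p" "B' * 1\<^sub>m m * 0\<^sub>m m m * C' = 0\<^sub>m p p"
    using d by auto
  moreover have "B * C' + 0\<^sub>m n p = B * C'" "A' + 0\<^sub>m p p = A'" using d by auto
  ultimately show ?thesis
    by (simp add: closed_loop_def P.D0 Z E minv_one Let_def)
qed

lemma Acl_dim [simp]: "Acl \<in> carrier_mat (n + p) (n + p)"
  using P.real_dims Q.real_dims by (simp add: closed_loop_eq)

lemma Acl_mult:
  assumes x: "x \<in> carrier_vec n" and x': "x' \<in> carrier_vec p"
  shows "Acl *\<^sub>v (x @\<^sub>v x') =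
    (cmat A *\<^sub>v x + cmat B *\<^sub>v (cmat C' *\<^sub>v x' + cmat D' *\<^sub>v (cmat C *\<^sub>v x))) @\<^sub>v
    (cmat A' *\<^sub>v x' + cmat B' *\<^sub>v (cmat C *\<^sub>v x))"
proof -
  note d = P.real_dims Q.real_dims
  have y: "cmat C *\<^sub>v x \<in> carrier_vec m" using x by simp
  have DC: "cmat D' *\<^sub>v (cmat C *\<^sub>v x) \<in> carrier_vec m" "cmat C' *\<^sub>v x' \<in> carrier_vec m"
    using y x' by simp_all
  have 1: "cmat (A + B * D' * C) = cmat A + cmat B * (cmat D' * cmat C)"
  proof -
    have "B * D' * C = B * (D' * C)" using d by (intro assoc_mult_mat)
    then have "cmat (B * D' * C) = cmat B * (cmat D' * cmat C)"
      using d by (simp add: of_real_hom.mat_hom_mult[of _ n m _ n] of_real_hom.mat_hom_mult[of _ m m _ n])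
    moreover have "cmat (A + B * D' * C) = cmat A + cmat (B * D' * C)"
      using d by (intro eq_matI) auto
    ultimately show ?thesis by (simp only:)
  qed
  have "Acl = four_block_mat (cmat A + cmat B * (cmat D' * cmat C)) (cmat B * cmat C') (cmat B' * cmat C) (cmat A')"
    unfolding closed_loop_eq using d
    by (subst map_four_block_mat[of _ n n _ p _ p])
       (auto simp: 1 of_real_hom.mat_hom_mult[of _ n m _ p] of_real_hom.mat_hom_mult[of _ p m _ n]
         simp del: assoc_mult_mat)
  then have "Acl *\<^sub>v (x @\<^sub>v x') =
      ((cmat A + cmat B * (cmat D' * cmat C)) *\<^sub>v x + (cmat B * cmat C') *\<^sub>v x') @\<^sub>v
      ((cmat B' * cmat C) *\<^sub>v x + cmat A' *\<^sub>v x')"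
    using d x x' by (simp only:) (intro four_block_mat_mult_vec[of _ n n _ p _ p], auto)
  moreover have "(cmat A + cmat B * (cmat D' * cmat C)) *\<^sub>v x =
      cmat A *\<^sub>v x + cmat B *\<^sub>v (cmat D' *\<^sub>v (cmat C *\<^sub>v x))"
    using d x DC
    by (simp add: add_mult_distrib_mat_vec[of _ n n] assoc_mult_mat_vec[of _ n m _ n] assoc_mult_mat_vec[of _ m m _ n])
  moreover have "(cmat B * cmat C') *\<^sub>v x' = cmat B *\<^sub>v (cmat C' *\<^sub>v x')"
    using d x' by (simp add: assoc_mult_mat_vec[of _ n m _ p])
  moreover have "(cmat B' * cmat C) *\<^sub>v x = cmat B' *\<^sub>v (cmat C *\<^sub>v x)"
    using d x by (simp add: assoc_mult_mat_vec[of _ p m _ n])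
  moreover have "cmat B *\<^sub>v (cmat C' *\<^sub>v x' + cmat D' *\<^sub>v (cmat C *\<^sub>v x)) =
      cmat B *\<^sub>v (cmat C' *\<^sub>v x') + cmat B *\<^sub>v (cmat D' *\<^sub>v (cmat C *\<^sub>v x))"
    using DC by (intro mult_add_distrib_mat_vec[OF P.dims(2)])
  moreover have "cmat A *\<^sub>v x + cmat B *\<^sub>v (cmat D' *\<^sub>v (cmat C *\<^sub>v x)) + cmat B *\<^sub>v (cmat C' *\<^sub>v x') =
      cmat A *\<^sub>v x + (cmat B *\<^sub>v (cmat C' *\<^sub>v x') + cmat B *\<^sub>v (cmat D' *\<^sub>v (cmat C *\<^sub>v x)))"
    by (rule add_vec_shuffle[of _ n]) (use x y DC in simp_all)
  moreover have "cmat B' *\<^sub>v (cmat C *\<^sub>v x) + cmat A' *\<^sub>v x' = cmat A' *\<^sub>v x' + cmat B' *\<^sub>v (cmat C *\<^sub>v x)"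
    by (rule comm_add_vec[of _ p]) (use x' y in simp_all)
  ultimately show ?thesis by (simp only:)
qed

lemma Acl_equation:
  assumes e: "e \<in> carrier_vec (n + p)" and b: "b \<in> carrier_vec n"
    and eq: "s \<cdot>\<^sub>v e = Acl *\<^sub>v e + (b @\<^sub>v 0\<^sub>v p)"
  obtains x x' where "e = x @\<^sub>v x'" "x \<in> carrier_vec n" "x' \<in> carrier_vec p"
    "s \<cdot>\<^sub>v x = cmat A *\<^sub>v x + cmat B *\<^sub>v (cmat C' *\<^sub>v x' + cmat D' *\<^sub>v (cmat C *\<^sub>v x)) + b"
    "s \<cdot>\<^sub>v x' = cmat A' *\<^sub>v x' + cmat B' *\<^sub>v (cmat C *\<^sub>v x)"
proof -
  define x where "x = vec_first e n"
  define x' where "x' = vec_last e p"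
  have ex: "e = x @\<^sub>v x'" using e by (simp add: x_def x'_def)
  have x: "x \<in> carrier_vec n" and x': "x' \<in> carrier_vec p" by (auto simp: x_def x'_def)
  define q where "q = cmat A *\<^sub>v x + cmat B *\<^sub>v (cmat C' *\<^sub>v x' + cmat D' *\<^sub>v (cmat C *\<^sub>v x))"
  define q' where "q' = cmat A' *\<^sub>v x' + cmat B' *\<^sub>v (cmat C *\<^sub>v x)"
  have q: "q \<in> carrier_vec n" "q' \<in> carrier_vec p" using x x' by (simp_all add: q_def q'_def)
  have "(s \<cdot>\<^sub>v x) @\<^sub>v (s \<cdot>\<^sub>v x') = s \<cdot>\<^sub>v e" unfolding ex by (intro eq_vecI) auto
  also note eq
  also have "Acl *\<^sub>v e + (b @\<^sub>v 0\<^sub>v p) = (q + b) @\<^sub>v (q' + 0\<^sub>v p)"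
    unfolding ex Acl_mult[OF x x'] q_def[symmetric] q'_def[symmetric]
    by (rule append_vec_add[OF q(1) b q(2) zero_carrier_vec])
  finally have "s \<cdot>\<^sub>v x = q + b" "s \<cdot>\<^sub>v x' = q' + 0\<^sub>v p"
    using append_vec_eq[of "s \<cdot>\<^sub>v x" n "q + b"] x q b by auto
  then show thesis using that[OF ex x x'] q by (simp add: q_def q'_def)
qed

lemma controller_output:
  assumes z: "0 \<le> Re z" and x': "x' \<in> carrier_vec p" and y: "y \<in> carrier_vec m"
    and eq: "z \<cdot>\<^sub>v x' = cmat A' *\<^sub>v x' + cmat B' *\<^sub>v y"
  shows "cmat C' *\<^sub>v x' + cmat D' *\<^sub>v y = Q.G z *\<^sub>v y"
proof -
  have "Q.R z *\<^sub>v (cmat B' *\<^sub>v y) = x'"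
    by (rule resolvent_unique[OF Q.dims(1) Q.stable[OF z] x' eq]) (use y in simp)
  then show ?thesis using Q.G_mult_vec[OF Q.stable[OF z] y] by simp
qed

text \<open>The sign condition on the range of \<open>G1\<close>, independent of the chosen singular
  value decomposition.\<close>

definition dc_negative :: bool where
  "dc_negative \<longleftrightarrow> (\<forall>v\<in>carrier_vec m. cmat G1 *\<^sub>v v \<noteq> 0\<^sub>v m \<longrightarrow>
     Re ((Q.G 0 *\<^sub>v (cmat G1 *\<^sub>v v)) \<bullet>c (cmat G1 *\<^sub>v v)) < 0)"

text \<open>The assumption \<open>range\<close> identifies the orthogonal complement of the kernel
  of \<open>G1\<close> with its range; it is discharged later from the singular value
  decomposition.\<close>

lemma loop_no_closed_right_half_plane:
  assumes neg: "dc_negative"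
    and range: "\<And>y. y \<in> carrier_vec m \<Longrightarrow>
      (\<And>x. x \<in> carrier_vec m \<Longrightarrow> cmat G1 *\<^sub>v x = 0\<^sub>v m \<Longrightarrow> y \<bullet>c x = 0) \<Longrightarrow>
      \<exists>v\<in>carrier_vec m. y = cmat G1 *\<^sub>v v"
    and z: "0 \<le> Re z"
    and x: "x \<in> carrier_vec n" and u: "u \<in> carrier_vec m"
    and eq: "z \<cdot>\<^sub>v x = cmat A *\<^sub>v x + cmat B *\<^sub>v u"
    and u_def: "u = Q.G z *\<^sub>v (cmat C *\<^sub>v x)"
  shows "cmat C *\<^sub>v x = 0\<^sub>v m"
proof (rule ccontr)
  let ?y = "cmat C *\<^sub>v x"
  assume y0: "?y \<noteq> 0\<^sub>v m"
  have y: "?y \<in> carrier_vec m" using x by simp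
  define a where "a = ?y \<bullet>c u"
  have uy: "u \<bullet>c ?y = cnj a" unfolding a_def by (rule cscalar_commute[OF u y])
  have negv: "Re ((Q.G 0 *\<^sub>v ?y) \<bullet>c ?y) < 0" if "v \<in> carrier_vec m" "?y = cmat G1 *\<^sub>v v" for v
    using neg that y0 unfolding dc_negative_def by metis
  consider "0 < Re z" | "Re z = 0" "z \<noteq> 0" | "z = 0" using z by fastforce
  then show False
  proof cases
    case 1
    have ne: "\<not> eigenvalue (cmat A) z" by (rule P.no_unstable_eigenvalue[OF 1])
    have "P.R z *\<^sub>v (cmat B *\<^sub>v u) = x"
      using x u eq by (intro resolvent_unique[OF P.dims(1) ne]) auto
    moreover have "cmat D *\<^sub>v u = 0\<^sub>v m" using u by (simp add: P.D0)
    ultimately have Gu: "P.G z *\<^sub>v u = ?y" using P.G_mult_vec[OF ne u] y by simp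
    have "?y \<bullet>c k = 0" if "k \<in> carrier_vec m" "cmat G1 *\<^sub>v k = 0\<^sub>v m" for k
      using P.G1_kernel_forms(2)[OF that u 1] Gu by simp
    then obtain v where "v \<in> carrier_vec m" "?y = cmat G1 *\<^sub>v v" using range[OF y] by blast
    then have q: "Re ((Q.G 0 *\<^sub>v ?y) \<bullet>c ?y) < 0" by (rule negv)
    define q where "q = Re ((Q.G 0 *\<^sub>v ?y) \<bullet>c ?y)"
    have qc: "(Q.G 0 *\<^sub>v ?y) \<bullet>c ?y = of_real q"
      using Q.dc_form_real[OF y] by (simp add: q_def complex_eq_iff)
    have pr: "0 \<le> Re (z * a)" using P.positive_real[OF u 1] Gu by (simp add: a_def)
    have "Re ((cnj a - of_real q) / z) \<le> 0"
      using Q.difference_quotient_nonpos[OF y 1] u_def uy qc by simp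
    \<comment> \<open>Multiplication by \<open>|z|^2\<close> turns the inequality into
      \<open>Re (z * a) \<le> q * Re z < 0\<close>, against \<open>pr\<close>.\<close>
    moreover have "Re ((cnj a - of_real q) / z) = (Re (z * a) - q * Re z) / ((Re z)\<^sup>2 + (Im z)\<^sup>2)"
      by (simp add: Re_divide algebra_simps)
    moreover have "0 < (Re z)\<^sup>2 + (Im z)\<^sup>2" using 1 by (simp add: sum_power2_gt_zero_iff)
    ultimately have "Re (z * a) - q * Re z \<le> 0"
      by (metis divide_pos_pos not_le)
    moreover have "q * Re z < 0" using q 1 by (simp add: q_def mult_neg_pos)
    ultimately show False using pr by simp
  next
    case 2
    define w where "w = Im z"
    have zw: "z = axis w" and w: "w \<noteq> 0"
      using 2 by (auto simp: w_def complex_eq_iff)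
    have "0 \<le> Re (z * a)"
      unfolding a_def zw by (rule P.axis_state_nonneg[OF w x u]) (use eq zw in simp)
    moreover have "0 < Re (z * cnj a)"
      using Q.axis_positive[OF w y y0] u_def uy by (simp add: zw)
    \<comment> \<open>As \<open>z\<close> is imaginary,
      \<open>Re (z * a) = - Re (z * cnj a)\<close>.\<close>
    ultimately show False using 2 by simp
  next
    case 3
    \<comment> \<open>At the origin, \<open>G1 u = 0\<close> gives \<open>B u = 0\<close> and then
      \<open>A x = 0\<close>. So the output lies in the range of \<open>G1\<close>, to which
      \<open>u\<close> is orthogonal, and the form of \<open>G'(0)\<close> at the output is zero
      rather than negative.\<close>
    have "0 \<cdot>\<^sub>v x = 0\<^sub>v n" using x by (intro eq_vecI) auto
    then have e0: "0\<^sub>v n = cmat A *\<^sub>v x + cmat B *\<^sub>v u" using eq 3 by simp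
    have G1u: "cmat G1 *\<^sub>v u = 0\<^sub>v m" by (rule P.equilibrium_input[OF x u e0])
    then have "cmat B *\<^sub>v u = 0\<^sub>v n" by (rule P.G1_kernel_B[OF u])
    then have "0\<^sub>v n = cmat A *\<^sub>v x + 0\<^sub>v n" using e0 by (simp only:)
    then have "cmat A *\<^sub>v x = 0\<^sub>v n" using x by simp
    then obtain v where v: "v \<in> carrier_vec m" "?y = cmat G1 *\<^sub>v v"
      using P.equilibrium_output[OF x] range[OF y] by blast
    have "a = 0" unfolding a_def v(2) by (rule P.G1_kernel_form[OF u G1u v(1)])
    then show False using negv[OF v] u_def uy 3 by simp
  qed
qed

text \<open>Once the output of \<open>G\<close> is known to vanish, the loop decouples: both halves
  of the eigenvector satisfy their own eigenvalue equations. Observability removes the first half,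
  stability of the \<open>SNI\<close> system the second.\<close>

lemma hurwitz_if_dc_negative:
  assumes neg: "dc_negative"
    and range: "\<And>y. y \<in> carrier_vec m \<Longrightarrow>
      (\<And>x. x \<in> carrier_vec m \<Longrightarrow> cmat G1 *\<^sub>v x = 0\<^sub>v m \<Longrightarrow> y \<bullet>c x = 0) \<Longrightarrow>
      \<exists>v\<in>carrier_vec m. y = cmat G1 *\<^sub>v v"
  shows loop_stable
  unfolding hurwitz_def
proof (intro allI impI)
  fix z assume "eigenvalue Acl z"
  then obtain e where e: "e \<in> carrier_vec (n + p)" "e \<noteq> 0\<^sub>v (n + p)" "Acl *\<^sub>v e = z \<cdot>\<^sub>v e"
    by (rule eigenvalueE[OF Acl_dim])
  have z0: "0\<^sub>v n @\<^sub>v 0\<^sub>v p = (0\<^sub>v (n + p) :: complex vec)" by (intro eq_vecI) auto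
  \<comment> \<open>A zero input is added so that \<open>Acl_equation\<close> also splits
    eigenvectors.\<close>
  have "z \<cdot>\<^sub>v e = Acl *\<^sub>v e + (0\<^sub>v n @\<^sub>v 0\<^sub>v p)"
    unfolding z0 e(3) using e(1) by simp
  then obtain x x' where ex: "e = x @\<^sub>v x'" and x: "x \<in> carrier_vec n" and x': "x' \<in> carrier_vec p"
    and eq1: "z \<cdot>\<^sub>v x = cmat A *\<^sub>v x + cmat B *\<^sub>v (cmat C' *\<^sub>v x' + cmat D' *\<^sub>v (cmat C *\<^sub>v x)) + 0\<^sub>v n"
    and eq2: "z \<cdot>\<^sub>v x' = cmat A' *\<^sub>v x' + cmat B' *\<^sub>v (cmat C *\<^sub>v x)"
    by (rule Acl_equation[OF e(1) zero_carrier_vec])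
  define u where "u = cmat C' *\<^sub>v x' + cmat D' *\<^sub>v (cmat C *\<^sub>v x)"
  have y: "cmat C *\<^sub>v x \<in> carrier_vec m" using x by simp
  have u: "u \<in> carrier_vec m" using x' y by (simp add: u_def)
  have eqs: "z \<cdot>\<^sub>v x = cmat A *\<^sub>v x + cmat B *\<^sub>v u"
    using eq1 x u unfolding u_def[symmetric] by simp
  show "Re z < 0"
  proof (rule ccontr)
    assume "\<not> Re z < 0"
    then have z: "0 \<le> Re z" by simp
    have uG: "u = Q.G z *\<^sub>v (cmat C *\<^sub>v x)"
      unfolding u_def by (rule controller_output[OF z x' y eq2])
    have y0: "cmat C *\<^sub>v x = 0\<^sub>v m"
      by (rule loop_no_closed_right_half_plane[OF neg range z x u eqs uG])
    then have u0: "u = 0\<^sub>v m" using uG mult_mat_zero_vec[OF Q.dims(7)] by simp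
    have "cmat B *\<^sub>v 0\<^sub>v m = 0\<^sub>v n" "cmat B' *\<^sub>v 0\<^sub>v m = 0\<^sub>v p"
      using mult_mat_zero_vec[OF P.dims(2)] mult_mat_zero_vec[OF Q.dims(2)] by auto
    then have Ax: "cmat A *\<^sub>v x = z \<cdot>\<^sub>v x" and Ax': "cmat A' *\<^sub>v x' = z \<cdot>\<^sub>v x'"
      using eqs eq2 x x' by (simp_all add: u0 y0)
    have "x = 0\<^sub>v n" by (rule P.observable_eigenvector[OF x Ax y0])
    moreover have "x' = 0\<^sub>v p"
      using Q.stable[OF z] eigenvalueI[OF Q.dims(1) x' _ Ax'] by blast
    ultimately show False using e(2) ex z0 by simp
  qed
qed

text \<open>An energy balance: \<open>G\<close> is driven by \<open>g + e\<close>, where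
  \<open>g\<close> is the answer of the controller to \<open>y\<close>. The form of \<open>y\<close>
  against \<open>g + e\<close> is nonnegative, its part against \<open>g\<close> is nonpositive, so
  the part against \<open>e\<close> is nonnegative.\<close>

lemma closed_loop_axis:
  assumes hw: loop_stable and e: "e \<in> carrier_vec m"
    and w: "w \<noteq> 0" and s: "s = axis w"
  shows "0 \<le> Re (s * ((Rcl s *\<^sub>v Bcl e) \<bullet>c
    Ccl e))"
proof -
  have ne: "\<not> eigenvalue Acl s" using hw by (auto simp: hurwitz_def s)
  have b: "Bcl e \<in> carrier_vec (n + p)" using e by (intro append_carrier_vec) auto
  obtain x x' where xx: "Rcl s *\<^sub>v Bcl e = x @\<^sub>v x'"
    and x: "x \<in> carrier_vec n" and x': "x' \<in> carrier_vec p"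
    and eq: "s \<cdot>\<^sub>v x = cmat A *\<^sub>v x + cmat B *\<^sub>v (cmat C' *\<^sub>v x' + cmat D' *\<^sub>v (cmat C *\<^sub>v x)) + cmat B *\<^sub>v e"
    and eq': "s \<cdot>\<^sub>v x' = cmat A' *\<^sub>v x' + cmat B' *\<^sub>v (cmat C *\<^sub>v x)"
    by (rule Acl_equation[OF resolvent_vec_carrier[OF Acl_dim ne b] P.vec_dims(2)[OF e] resolvent_solves[OF Acl_dim ne b]])
  let ?y = "cmat C *\<^sub>v x"
  have y: "?y \<in> carrier_vec m" using x by simp
  define g where "g = Q.G s *\<^sub>v ?y"
  have g: "g \<in> carrier_vec m" using y by (simp add: g_def)
  have "cmat C' *\<^sub>v x' + cmat D' *\<^sub>v ?y = g"
    unfolding g_def by (rule controller_output[OF _ x' y eq']) (simp add: s)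
  moreover have "cmat B *\<^sub>v (g + e) = cmat B *\<^sub>v g + cmat B *\<^sub>v e"
    by (rule mult_add_distrib_mat_vec[OF P.dims(2) g e])
  ultimately have "s \<cdot>\<^sub>v x = cmat A *\<^sub>v x + cmat B *\<^sub>v (g + e)"
    using eq x g e by (simp add: assoc_add_vec[of _ n])
  then have "0 \<le> Re (s * (?y \<bullet>c (g + e)))"
    using P.axis_state_nonneg[OF w x, of "g + e"] g e unfolding s by simp
  then have 1: "0 \<le> Re (s * (?y \<bullet>c g)) + Re (s * (?y \<bullet>c e))"
    using y g e by (simp add: cscalar_prod_add_right[of _ m] algebra_simps)
  have "0 \<le> Re (s * (g \<bullet>c ?y))"
  proof (cases "?y = 0\<^sub>v m")
    case True
    then show ?thesis using g by simp
  next
    case False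
    then show ?thesis using Q.axis_positive[OF w y False] unfolding s g_def by (simp only: less_imp_le)
  qed
  then have "Re (s * (?y \<bullet>c g)) \<le> 0"
    unfolding cscalar_commute[OF y g] s by simp
  moreover have "(x @\<^sub>v x') \<bullet>c Ccl e = ?y \<bullet>c e"
    unfolding append_zero_cscalar_prod[OF x x' P.vec_dims(6)[OF e]] using P.C_adjoint[OF x e] by simp
  ultimately show ?thesis using 1 unfolding xx by simp
qed

text \<open>Stability leaves no poles on the axis, so the half plane principle applies to
  \<open>s r(s)\<close> with every \<open>k = 0\<close>. On the positive real line the factor
  \<open>s\<close> can be divided out, and continuity reaches \<open>0\<close>.\<close>

lemma closed_loop_dc:
  assumes hw: loop_stable and e: "e \<in> carrier_vec m"
  shows "0 \<le> Re ((Rcl 0 *\<^sub>v Bcl e) \<bullet>c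
    Ccl e)"
proof -
  define b where "b = Bcl e"
  define c where "c = Ccl e"
  have b: "b \<in> carrier_vec (n + p)" and c: "c \<in> carrier_vec (n + p)"
    unfolding b_def c_def using e by (auto intro!: append_carrier_vec)
  define r where "r = (\<lambda>s. (Rcl s *\<^sub>v b) \<bullet>c c)"
  let ?U = "{s. \<not> eigenvalue Acl s}"
  have U: "open ?U" by (rule open_non_eigenvalues[OF Acl_dim])
  have ne: "\<not> eigenvalue Acl s" if "0 \<le> Re s" for s using hw that by (auto simp: hurwitz_def)
  have r: "r holomorphic_on ?U" unfolding r_def by (rule resolvent_form_holomorphic[OF Acl_dim b c])
  have rc: "isCont r s" if "0 \<le> Re s" for s
    using holomorphic_on_imp_continuous_on[OF r] U ne[OF that]
    by (simp add: continuous_on_eq_continuous_at)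
  have pr: "0 \<le> Re (s * r s)" if s: "0 < Re s" for s
  proof (rule half_plane_Re_nonneg[where f = "\<lambda>s. s * r s" and F = "{0}" and L = "b \<bullet>c c"])
    show "(\<lambda>s. s * r s) holomorphic_on {s. 0 < Re s}"
      using ne by (intro holomorphic_intros holomorphic_on_subset[OF r]) auto
    show "0 \<le> Re (axis w * r (axis w))" if "w \<notin> {0}" for w
      unfolding r_def b_def c_def using that by (intro closed_loop_axis[OF hw e]) auto
    show "\<exists>k\<ge>0. \<exists>L. ((\<lambda>s. s * r s - of_real k / (s - axis w)) \<longlongrightarrow> L) (at (axis w))" for w
    proof (rule exI[of _ 0], rule conjI[OF order_refl], rule exI)
      have "isCont (\<lambda>s. s * r s) (axis w)"
        using rc[of "axis w"] by (intro continuous_intros) auto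
      then show "((\<lambda>s. s * r s - of_real 0 / (s - axis w)) \<longlongrightarrow> axis w * r (axis w)) (at (axis w))"
        by (simp add: isCont_def)
    qed
    show "((\<lambda>s. s * r s) \<longlongrightarrow> b \<bullet>c c) at_infinity"
      unfolding r_def by (rule mult_resolvent_form_tendsto_at_infinity[OF Acl_dim b c])
  qed (use s in auto)
  have "0 \<le> Re (r 0)"
  proof (rule tendsto_lowerbound)
    have line: "filterlim complex_of_real (at 0) (at_right 0)"
      unfolding filterlim_at by (auto intro!: tendsto_eq_intros simp: eventually_at_filter)
    have "(r \<longlongrightarrow> r 0) (at 0)" using rc[of 0] by (simp add: isCont_def)
    from tendsto_Re[OF filterlim_compose[OF this line]]
    show "((\<lambda>t. Re (r (of_real t))) \<longlongrightarrow> Re (r 0)) (at_right 0)" .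
    have "0 \<le> Re (r (of_real t))" if "0 < t" for t
      using pr[of "of_real t"] that by (simp add: zero_le_mult_iff)
    then show "eventually (\<lambda>t. 0 \<le> Re (r (of_real t))) (at_right 0)"
      unfolding eventually_at_filter by (intro always_eventually) blast
  qed simp
  then show ?thesis by (simp add: r_def b_def c_def)
qed

lemma dc_congruence_form:
  assumes F: "F \<in> carrier_mat m r" and w: "w \<in> carrier_vec r" and w': "w' \<in> carrier_vec r"
  shows "cmatT F * Q.G 0 * cmat F \<in> carrier_mat r r"
    "((cmatT F * Q.G 0 * cmat F) *\<^sub>v w) \<bullet>c w' =
      (Q.G 0 *\<^sub>v (cmat F *\<^sub>v w)) \<bullet>c (cmat F *\<^sub>v w')"
proof -
  have T: "cmatT F \<in> carrier_mat r m" and cF: "cmat F \<in> carrier_mat m r" using F by auto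
  have TG: "cmatT F * Q.G 0 \<in> carrier_mat r m" by (rule mult_carrier_mat[OF T Q.dims(7)])
  show "cmatT F * Q.G 0 * cmat F \<in> carrier_mat r r" by (rule mult_carrier_mat[OF TG cF])
  have Fw: "cmat F *\<^sub>v w \<in> carrier_vec m" using mult_mat_vec_carrier[OF cF w] .
  have "(cmatT F * Q.G 0 * cmat F) *\<^sub>v w = cmatT F *\<^sub>v (Q.G 0 *\<^sub>v (cmat F *\<^sub>v w))"
    unfolding assoc_mult_mat_vec[OF TG cF w] assoc_mult_mat_vec[OF T Q.dims(7) Fw] ..
  then show "((cmatT F * Q.G 0 * cmat F) *\<^sub>v w) \<bullet>c w' =
      (Q.G 0 *\<^sub>v (cmat F *\<^sub>v w)) \<bullet>c (cmat F *\<^sub>v w')"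
    using cmat_adjoint[of "transpose_mat F" r m "Q.G 0 *\<^sub>v (cmat F *\<^sub>v w)" w'] F w' Q.vec_dims(7)[OF Fw]
    by simp
qed

lemma dc_negative_if_hurwitz:
  assumes hw: loop_stable
  shows "dc_negative"
proof -
  \<comment> \<open>\<open>G\<close> rests at an equilibrium with output \<open>G1 v\<close> and the
    controller at the matching one; the only unbalanced term is the controller output entering
    through \<open>B\<close>.\<close>
  have state: "\<exists>x x'. x \<in> carrier_vec n \<and> x' \<in> carrier_vec p \<and> cmat C *\<^sub>v x = cmat G1 *\<^sub>v v \<and>
      Acl *\<^sub>v (x @\<^sub>v x') = (cmat B *\<^sub>v (Q.G 0 *\<^sub>v (cmat G1 *\<^sub>v v))) @\<^sub>v 0\<^sub>v p"
    if v: "v \<in> carrier_vec m" for v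
  proof -
    obtain x where x: "x \<in> carrier_vec n" and Ax: "cmat A *\<^sub>v x = 0\<^sub>v n" and Cx: "cmat C *\<^sub>v x = cmat G1 *\<^sub>v v"
      by (rule P.G1_range_state[OF v])
    let ?y = "cmat G1 *\<^sub>v v"
    have y: "?y \<in> carrier_vec m" using v by simp
    define x' where "x' = Q.R 0 *\<^sub>v (cmat B' *\<^sub>v ?y)"
    have st: "\<not> eigenvalue (cmat A') 0" using Q.stable[of 0] by simp
    have x': "x' \<in> carrier_vec p" unfolding x'_def using st y by simp
    have "0 \<cdot>\<^sub>v x' = cmat A' *\<^sub>v x' + cmat B' *\<^sub>v ?y"
      unfolding x'_def by (rule resolvent_solves[OF Q.dims(1) st]) (use y in simp)
    moreover from this have "cmat C' *\<^sub>v x' + cmat D' *\<^sub>v ?y = Q.G 0 *\<^sub>v ?y"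
      by (intro controller_output[OF _ x' y]) simp_all
    moreover have "0 \<cdot>\<^sub>v x' = 0\<^sub>v p" using x' by (intro eq_vecI) auto
    ultimately have "Acl *\<^sub>v (x @\<^sub>v x') = (cmat B *\<^sub>v (Q.G 0 *\<^sub>v ?y)) @\<^sub>v 0\<^sub>v p"
      unfolding Acl_mult[OF x x'] Ax Cx using y by simp
    then show ?thesis using x x' Cx by blast
  qed
  have nonpos: "Re ((Q.G 0 *\<^sub>v (cmat G1 *\<^sub>v v)) \<bullet>c (cmat G1 *\<^sub>v v)) \<le> 0" if v: "v \<in> carrier_vec m" for v
  proof -
    let ?y = "cmat G1 *\<^sub>v v"
    \<comment> \<open>The external input that cancels this term, so that the joint equilibrium is
      the response of the loop to \<open>e\<close> at \<open>s = 0\<close>.\<close>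
    define e where "e = (-1) \<cdot>\<^sub>v (Q.G 0 *\<^sub>v ?y)"
    have y: "?y \<in> carrier_vec m" and g: "Q.G 0 *\<^sub>v ?y \<in> carrier_vec m" using v by simp_all
    then have e: "e \<in> carrier_vec m" by (simp add: e_def)
    obtain x x' where x: "x \<in> carrier_vec n" and x': "x' \<in> carrier_vec p" and Cx: "cmat C *\<^sub>v x = ?y"
      and Ax: "Acl *\<^sub>v (x @\<^sub>v x') = (cmat B *\<^sub>v (Q.G 0 *\<^sub>v ?y)) @\<^sub>v 0\<^sub>v p"
      using state[OF v] by blast
    have xx: "x @\<^sub>v x' \<in> carrier_vec (n + p)" using x x' by simp
    have b: "Bcl e \<in> carrier_vec (n + p)" using e by (intro append_carrier_vec) auto
    have "cmat B *\<^sub>v e = (-1) \<cdot>\<^sub>v (cmat B *\<^sub>v (Q.G 0 *\<^sub>v ?y))"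
      unfolding e_def by (rule mult_mat_vec[OF P.dims(2) g])
    then have "0 \<cdot>\<^sub>v (x @\<^sub>v x') = Acl *\<^sub>v (x @\<^sub>v x') + Bcl e"
      unfolding Ax using append_vec_cancel[OF P.vec_dims(2)[OF g] xx] by (simp only:)
    then have "Rcl 0 *\<^sub>v Bcl e = x @\<^sub>v x'"
      using hw by (intro resolvent_unique[OF Acl_dim _ xx _ b]) (auto simp: hurwitz_def)
    then have "0 \<le> Re ((x @\<^sub>v x') \<bullet>c Ccl e)"
      using closed_loop_dc[OF hw e] by simp
    then have "0 \<le> Re (?y \<bullet>c e)"
      unfolding append_zero_cscalar_prod[OF x x' P.vec_dims(6)[OF e]] using P.C_adjoint[OF x e] Cx by simp
    then have "Re (?y \<bullet>c (Q.G 0 *\<^sub>v ?y)) \<le> 0"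
      using y g by (simp add: e_def cscalar_prod_smult_right[of _ m])
    then show ?thesis unfolding cscalar_commute[OF y g] by simp
  qed
  show ?thesis unfolding dc_negative_def
  proof (intro ballI impI)
    fix v :: "complex vec" assume v: "v \<in> carrier_vec m" and nz: "cmat G1 *\<^sub>v v \<noteq> 0\<^sub>v m"
    let ?u = "Q.G 0 *\<^sub>v (cmat G1 *\<^sub>v v)"
    have u: "?u \<in> carrier_vec m" using v by simp
    show "Re (?u \<bullet>c (cmat G1 *\<^sub>v v)) < 0"
    proof (rule ccontr)
      assume "\<not> Re (?u \<bullet>c (cmat G1 *\<^sub>v v)) < 0"
      then have zero: "Re (?u \<bullet>c (cmat G1 *\<^sub>v v)) = 0" using nonpos[OF v] by simp
      \<comment> \<open>By \<open>nonpos\<close> the form of \<open>M\<close> is nonnegative;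
        equality at \<open>v\<close> makes \<open>v\<close> a kernel vector, so
        \<open>G'(0) G1 v\<close> is orthogonal to the range of \<open>G1\<close>.\<close>
      define M where "M = (-1) \<cdot>\<^sub>m (cmatT G1 * Q.G 0 * cmat G1)"
      note cong = dc_congruence_form[OF P.G1_dim]
      have M: "M \<in> carrier_mat m m" unfolding M_def by (rule smult_carrier_mat[OF cong(1)[OF v v]])
      have form: "(M *\<^sub>v a) \<bullet>c c = - ((Q.G 0 *\<^sub>v (cmat G1 *\<^sub>v a)) \<bullet>c (cmat G1 *\<^sub>v c))"
        if a: "a \<in> carrier_vec m" and c: "c \<in> carrier_vec m" for a c
        unfolding M_def smult_form[OF cong(1)[OF a c] a c] cong(2)[OF a c] by simp
      have "(cmat G1 *\<^sub>v c) \<bullet>c ?u = 0" if c: "c \<in> carrier_vec m" for c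
      proof -
        have "(M *\<^sub>v v) \<bullet>c c + cnj ((M *\<^sub>v c) \<bullet>c v) = 0"
          by (rule semidefinite_form_kernel[OF M _ v _ c]) (use nonpos zero v form in simp_all)
        moreover have "(Q.G 0 *\<^sub>v (cmat G1 *\<^sub>v c)) \<bullet>c (cmat G1 *\<^sub>v v) = cnj (?u \<bullet>c (cmat G1 *\<^sub>v c))"
          using v c by (intro Q.dc_form_hermitian) auto
        ultimately have "?u \<bullet>c (cmat G1 *\<^sub>v c) = 0" using v c form by simp
        then show ?thesis using cscalar_commute[OF P.cG_vec(1)[OF c] u] by simp
      qed
      \<comment> \<open>Then \<open>B\<close> annihilates the controller output as well, and the
        joint equilibrium is an eigenvector of the loop for \<open>0\<close>.\<close>
      then have "cmat G1 *\<^sub>v ?u = 0\<^sub>v m" by (rule P.G1_transpose_kernel[OF u])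
      then have Bu: "cmat B *\<^sub>v ?u = 0\<^sub>v n" by (rule P.G1_kernel_B[OF u])
      obtain x x' where x: "x \<in> carrier_vec n" and x': "x' \<in> carrier_vec p"
        and Cx: "cmat C *\<^sub>v x = cmat G1 *\<^sub>v v"
        and Ax: "Acl *\<^sub>v (x @\<^sub>v x') = (cmat B *\<^sub>v ?u) @\<^sub>v 0\<^sub>v p"
        using state[OF v] by blast
      have xx: "x @\<^sub>v x' \<in> carrier_vec (n + p)" using x x' by simp
      have O: "0\<^sub>v n @\<^sub>v 0\<^sub>v p = (0\<^sub>v (n + p) :: complex vec)" by (intro eq_vecI) auto
      have "x \<noteq> 0\<^sub>v n" using Cx nz mult_mat_zero_vec[OF P.dims(3)] by metis
      then have "x @\<^sub>v x' \<noteq> 0\<^sub>v (n + p)"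
        using append_vec_eq[OF x zero_carrier_vec, of x' "0\<^sub>v p"] O by metis
      moreover have "Acl *\<^sub>v (x @\<^sub>v x') = 0 \<cdot>\<^sub>v (x @\<^sub>v x')"
        unfolding Ax Bu O using x x' by (intro eq_vecI) auto
      ultimately have "eigenvalue Acl 0" by (intro eigenvalueI[OF Acl_dim xx])
      then show False using hw by (auto simp: hurwitz_def)
    qed
  qed
qed

end

section \<open>Singular value decomposition\<close>

lemma append_cols_carrier:
  assumes "X \<in> carrier_mat m r" "Y \<in> carrier_mat m q"
  shows "append_cols X Y \<in> carrier_mat m (r + q)"
  using assms by (auto simp: append_cols_def)

lemma col_append_cols:
  assumes "X \<in> carrier_mat m r" "Y \<in> carrier_mat m q" "j < r + q"
  shows "col (append_cols X Y) j = (if j < r then col X j else col Y (j - r))"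
  using assms by (intro eq_vecI) (auto simp: append_cols_def)

text \<open>Two blocks of \<open>W^T W = I\<close>, and \<open>W W^T = I\<close> with its sum split
  at column \<open>r\<close>.\<close>

lemma orthonormal_append_cols:
  assumes X: "X \<in> carrier_mat m r" and Y: "Y \<in> carrier_mat m (m - r)" and r: "r \<le> m"
    and orth: "orthonormal_mat m (append_cols X Y)"
  shows "transpose_mat X * X = 1\<^sub>m r" "transpose_mat X * Y = 0\<^sub>m r (m - r)"
    "X * transpose_mat X + Y * transpose_mat Y = 1\<^sub>m m"
proof -
  define W where "W = append_cols X Y"
  have W: "W \<in> carrier_mat m m" using append_cols_carrier[OF X Y] r by (simp add: W_def)
  have dot: "col W i \<bullet> col W j = (if i = j then 1 else 0)" if "i < m" "j < m" for i j
  proof -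
    have "(transpose_mat W * W) $$ (i, j) = 1\<^sub>m m $$ (i, j)"
      using orth by (simp add: orthonormal_mat_def W_def)
    then show ?thesis using that W by simp
  qed
  have colX: "col W j = col X j" if "j < r" for j
    using col_append_cols[OF X Y, of j] that by (simp add: W_def)
  have colY: "col W (j + r) = col Y j" if "j < m - r" for j
    using col_append_cols[OF X Y, of "j + r"] that r by (simp add: W_def)
  show "transpose_mat X * X = 1\<^sub>m r"
  proof (rule eq_matI)
    fix i j assume "i < dim_row (1\<^sub>m r)" "j < dim_col (1\<^sub>m r)"
    then have ij: "i < r" "j < r" by auto
    then show "(transpose_mat X * X) $$ (i, j) = 1\<^sub>m r $$ (i, j)"
      using dot[of i j] colX[of i] colX[of j] r X by simp
  qed (use X in auto)
  show "transpose_mat X * Y = 0\<^sub>m r (m - r)"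
  proof (rule eq_matI)
    fix i j assume "i < dim_row (0\<^sub>m r (m - r))" "j < dim_col (0\<^sub>m r (m - r))"
    then have ij: "i < r" "j < m - r" by auto
    then show "(transpose_mat X * Y) $$ (i, j) = 0\<^sub>m r (m - r) $$ (i, j)"
      using dot[of i "j + r"] colX[of i] colY[of j] r X Y by simp
  qed (use X Y in auto)
  have "W * transpose_mat W = X * transpose_mat X + Y * transpose_mat Y"
  proof (rule eq_matI)
    fix i j assume "i < dim_row (X * transpose_mat X + Y * transpose_mat Y)"
      "j < dim_col (X * transpose_mat X + Y * transpose_mat Y)"
    then have ij: "i < m" "j < m" using Y by auto
    have split: "{0..<m} = {0..<r} \<union> {r..<m}" using r by auto
    have "(W * transpose_mat W) $$ (i, j) = (\<Sum>k = 0..<m. W $$ (i, k) * W $$ (j, k))"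
      using ij W by (simp add: scalar_prod_def)
    also have "\<dots> = (\<Sum>k = 0..<r. W $$ (i, k) * W $$ (j, k)) + (\<Sum>k = r..<m. W $$ (i, k) * W $$ (j, k))"
      unfolding split by (rule sum.union_disjoint) auto
    also have "(\<Sum>k = 0..<r. W $$ (i, k) * W $$ (j, k)) = (\<Sum>k = 0..<r. X $$ (i, k) * X $$ (j, k))"
      using ij X Y r by (intro sum.cong) (auto simp: W_def append_cols_def)
    also have "(\<Sum>k = r..<m. W $$ (i, k) * W $$ (j, k)) = (\<Sum>k = 0..<m - r. Y $$ (i, k) * Y $$ (j, k))"
      using ij X Y r by (intro sum.reindex_bij_witness[of _ "\<lambda>k. k + r" "\<lambda>k. k - r"]) (auto simp: W_def append_cols_def)
    finally show "(W * transpose_mat W) $$ (i, j) = (X * transpose_mat X + Y * transpose_mat Y) $$ (i, j)"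
      using ij X Y by (simp add: scalar_prod_def)
  qed (use W X Y in auto)
  then show "X * transpose_mat X + Y * transpose_mat Y = 1\<^sub>m m"
    using orth by (simp add: orthonormal_mat_def W_def)
qed

text \<open>With \<open>F1 = U1 S\<close>, the left inverse is \<open>L = S^-1 U1^T\<close>, and
  \<open>F1 L\<close> is the orthogonal projection complementary to \<open>U2 U2^T\<close>.\<close>

lemma svd_factors:
  assumes svd: "is_svd m r M U1 U2 S V1 V2"
  shows "U1 * S \<in> carrier_mat m r" "V1 \<in> carrier_mat m r" "M = (U1 * S) * transpose_mat V1"
    "M * V1 = U1 * S"
    "\<exists>L\<in>carrier_mat r m. L * (U1 * S) = 1\<^sub>m r \<and>
       1\<^sub>m m = (U1 * S) * L + U2 * transpose_mat U2"
    "transpose_mat M * U2 = 0\<^sub>m m (m - r)" "U2 \<in> carrier_mat m (m - r)"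
proof -
  from svd have r: "r \<le> m" and U1: "U1 \<in> carrier_mat m r" and U2: "U2 \<in> carrier_mat m (m - r)"
    and V1: "V1 \<in> carrier_mat m r" and V2: "V2 \<in> carrier_mat m (m - r)"
    and U: "orthonormal_mat m (append_cols U1 U2)" and V: "orthonormal_mat m (append_cols V1 V2)"
    and S: "S \<in> carrier_mat r r" and diag: "diagonal_mat S" and pos: "\<And>i. i < r \<Longrightarrow> S $$ (i, i) > 0"
    and M: "M = append_cols U1 U2
         * four_block_mat S (0\<^sub>m r (m - r)) (0\<^sub>m (m - r) r) (0\<^sub>m (m - r) (m - r))
         * (transpose_mat V1 @\<^sub>r transpose_mat V2)"
    unfolding is_svd_def by auto
  note Uo = orthonormal_append_cols[OF U1 U2 r U] and Vo = orthonormal_append_cols[OF V1 V2 r V]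
  show F: "U1 * S \<in> carrier_mat m r" using U1 S by simp
  show "V1 \<in> carrier_mat m r" "U2 \<in> carrier_mat m (m - r)" by fact+
  \<comment> \<open>\<open>append_cols\<close> is a block matrix whose lower blocks have no rows, so
    block multiplication is instantiated with row count \<open>0\<close>.\<close>
  have "append_cols U1 U2 * four_block_mat S (0\<^sub>m r (m - r)) (0\<^sub>m (m - r) r) (0\<^sub>m (m - r) (m - r)) =
      four_block_mat (U1 * S + U2 * 0\<^sub>m (m - r) r) (U1 * 0\<^sub>m r (m - r) + U2 * 0\<^sub>m (m - r) (m - r))
        (0\<^sub>m 0 r * S + 0\<^sub>m 0 (m - r) * 0\<^sub>m (m - r) r) (0\<^sub>m 0 r * 0\<^sub>m r (m - r) + 0\<^sub>m 0 (m - r) * 0\<^sub>m (m - r) (m - r))"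
    using U1 U2 S unfolding append_cols_def
    by (subst mult_four_block_mat[of _ m r _ "m - r" _ 0 _ _ r _ "m - r"]) auto
  also have "\<dots> = four_block_mat (U1 * S) (0\<^sub>m m (m - r)) (0\<^sub>m 0 r) (0\<^sub>m 0 (m - r))"
    using U1 U2 S F by simp
  also have "\<dots> * (transpose_mat V1 @\<^sub>r transpose_mat V2) =
      four_block_mat (U1 * S * transpose_mat V1 + 0\<^sub>m m (m - r) * transpose_mat V2) (U1 * S * 0\<^sub>m r 0 + 0\<^sub>m m (m - r) * 0\<^sub>m (m - r) 0)
        (0\<^sub>m 0 r * transpose_mat V1 + 0\<^sub>m 0 (m - r) * transpose_mat V2) (0\<^sub>m 0 r * 0\<^sub>m r 0 + 0\<^sub>m 0 (m - r) * 0\<^sub>m (m - r) 0)"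
    using F V1 V2 unfolding append_rows_def
    by (subst mult_four_block_mat[of _ m r _ "m - r" _ 0 _ _ m _ 0]) auto
  also have "\<dots> = U1 * S * transpose_mat V1"
    using F U1 S V1 V2 by (intro eq_matI) auto
  finally show MF: "M = (U1 * S) * transpose_mat V1" using M by simp
  have Vt: "transpose_mat V1 \<in> carrier_mat r m" and Ut: "transpose_mat U1 \<in> carrier_mat r m"
    using U1 V1 by auto
  show "M * V1 = U1 * S"
    unfolding MF assoc_mult_mat[OF F Vt V1] Vo(1) by (rule right_mult_one_mat[OF F])
  \<comment> \<open>The inverse of the diagonal matrix \<open>S\<close>.\<close>
  define T where "T = mat r r (\<lambda>(i, j). if i = j then 1 / S $$ (i, i) else 0)"
  have T: "T \<in> carrier_mat r r" by (simp add: T_def)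
  have prod: "(\<Sum>k = 0..<r. f i k * g k j) = f i i * g i j"
    if "i < r" "\<And>k. k < r \<Longrightarrow> k \<noteq> i \<Longrightarrow> f i k = 0" for f g :: "nat \<Rightarrow> nat \<Rightarrow> real" and i j
  proof -
    have "(\<Sum>k = 0..<r. f i k * g k j) = (\<Sum>k\<in>{i}. f i k * g k j)"
      using that by (intro sum.mono_neutral_right) auto
    then show ?thesis by simp
  qed
  have Sd: "S $$ (i, j) = 0" if "i < r" "j < r" "i \<noteq> j" for i j
    using diag S that unfolding diagonal_mat_def by auto
  have TS: "T * S = 1\<^sub>m r"
  proof (rule eq_matI)
    fix i j assume "i < dim_row (1\<^sub>m r)" "j < dim_col (1\<^sub>m r)"
    then have ij: "i < r" "j < r" by auto
    have "(T * S) $$ (i, j) = (\<Sum>k = 0..<r. T $$ (i, k) * S $$ (k, j))"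
      using ij S T by (simp add: scalar_prod_def)
    also have "\<dots> = T $$ (i, i) * S $$ (i, j)"
      using ij by (intro prod[of i "\<lambda>i k. T $$ (i, k)" "\<lambda>k j. S $$ (k, j)"]) (auto simp: T_def)
    finally show "(T * S) $$ (i, j) = 1\<^sub>m r $$ (i, j)"
      using ij pos[of i] Sd[of i j] by (cases "i = j") (simp_all add: T_def)
  qed (use S T in auto)
  have ST: "S * T = 1\<^sub>m r" using mat_mult_left_right_inverse[OF T S TS] .
  have TU: "T * transpose_mat U1 \<in> carrier_mat r m" using T Ut by simp
  have "(T * transpose_mat U1) * (U1 * S) = T * (transpose_mat U1 * U1 * S)"
    using T Ut U1 S F by (simp add: assoc_mult_mat[of _ r r _ m _ r] assoc_mult_mat[of _ r m _ r _ r])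
  also have "\<dots> = 1\<^sub>m r" unfolding Uo(1) using S TS by simp
  finally have L: "(T * transpose_mat U1) * (U1 * S) = 1\<^sub>m r" .
  have "(U1 * S) * (T * transpose_mat U1) = U1 * (S * T * transpose_mat U1)"
    using T Ut U1 S by (simp add: assoc_mult_mat[of _ m r _ r _ m] assoc_mult_mat[of _ r r _ r _ m])
  also have "\<dots> = U1 * transpose_mat U1" unfolding ST using Ut by simp
  finally have "1\<^sub>m m = (U1 * S) * (T * transpose_mat U1) + U2 * transpose_mat U2"
    using Uo(3) by simp
  then show "\<exists>L\<in>carrier_mat r m. L * (U1 * S) = 1\<^sub>m r \<and>
       1\<^sub>m m = (U1 * S) * L + U2 * transpose_mat U2"
    using L TU by blast
  have "transpose_mat M = V1 * (transpose_mat S * transpose_mat U1)"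
    unfolding MF transpose_mult[OF F Vt] transpose_mult[OF U1 S] by simp
  then have "transpose_mat M * U2 = V1 * (transpose_mat S * (transpose_mat U1 * U2))"
    using V1 S Ut U2
    by (simp add: assoc_mult_mat[of _ m r _ m _ "m - r"] assoc_mult_mat[of _ r r _ m _ "m - r"])
  then show "transpose_mat M * U2 = 0\<^sub>m m (m - r)"
    unfolding Uo(2) using V1 S by simp
qed


section \<open>The criterion in terms of the singular value decomposition\<close>

context feedback
begin

lemma internally_stable_iff:
  "internally_stable A B C D A' B' C' D' \<longleftrightarrow> loop_stable"
proof -
  have "0\<^sub>m m m * D' = 0\<^sub>m m m" using Q.real_dims by simp
  then have "1\<^sub>m (dim_row D) - D * D' = 1\<^sub>m m"
    unfolding P.D0 by (intro eq_matI) auto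
  moreover have "invertible_mat (1\<^sub>m m :: real mat)"
    unfolding invertible_mat_def inverts_mat_def by (auto intro!: exI[of _ "1\<^sub>m m"])
  ultimately show ?thesis by (simp add: internally_stable_def)
qed

text \<open>Hermitian symmetry, which \<open>nd_mat\<close> includes, is inherited from
  \<open>G'(0)\<close>, so only the quadratic form remains.\<close>

lemma nd_mat_congruence:
  assumes F: "F \<in> carrier_mat m r"
  shows "nd_mat (cmatT F * Q.G 0 * cmat F) \<longleftrightarrow>
    (\<forall>w\<in>carrier_vec r. w \<noteq> 0\<^sub>v r \<longrightarrow> Re ((Q.G 0 *\<^sub>v (cmat F *\<^sub>v w)) \<bullet>c (cmat F *\<^sub>v w)) < 0)"
proof -
  define N where "N = cmatT F * Q.G 0 * cmat F"
  have N: "N \<in> carrier_mat r r"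
    unfolding N_def by (rule dc_congruence_form(1)[OF F zero_carrier_vec zero_carrier_vec])
  have Fw: "cmat F *\<^sub>v w \<in> carrier_vec m" if "w \<in> carrier_vec r" for w
    using F that by (intro mult_mat_vec_carrier[of _ m r]) auto
  note form = dc_congruence_form(2)[OF F, folded N_def]
  have "hermitian_mat N"
    unfolding hermitian_mat_def
  proof (rule eq_matI)
    fix i j assume "i < dim_row N" "j < dim_col N"
    then have ij: "i < r" "j < r" using N by auto
    note a = mat_adjoint_form[OF N unit_vec_carrier[of r j] unit_vec_carrier[of r i]]
    have "mat_adjoint N $$ (i, j) = cnj ((N *\<^sub>v unit_vec r i) \<bullet>c unit_vec r j)"
      using form_unit_vec[OF a(1) ij] a(2) by simp
    also have "\<dots> = (N *\<^sub>v unit_vec r j) \<bullet>c unit_vec r i"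
      using Q.dc_form_hermitian[OF Fw[of "unit_vec r j"] Fw[of "unit_vec r i"]] by (simp only: form unit_vec_carrier)
    also have "\<dots> = N $$ (i, j)" by (rule form_unit_vec[OF N ij])
    finally show "mat_adjoint N $$ (i, j) = N $$ (i, j)" .
  qed (use N carrier_matD[OF mat_adjoint_form(1)[OF N zero_carrier_vec zero_carrier_vec]] in auto)
  then have "nd_mat N \<longleftrightarrow> (\<forall>w\<in>carrier_vec r. w \<noteq> 0\<^sub>v r \<longrightarrow> Re ((N *\<^sub>v w) \<bullet>c w) < 0)"
    using N by (simp add: nd_mat_def)
  then show ?thesis using form unfolding N_def[symmetric] by auto
qed

end

theorem theorem4:
  fixes m n p r :: nat
    and A B C D A' B' C' D' :: "real mat"
    and G G' :: "complex \<Rightarrow> complex mat"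
    and G2 G1 G0 F1t F2t S2 V1 V2 F1 :: "real mat"
  assumes "minimal_realization m n A B C D" and "G = transfer A B C D"
    and "minimal_realization m p A' B' C' D'" and "G' = transfer A' B' C' D'"
    and "SNI m G'"
    and "D = 0\<^sub>m m m" and "NI m G"
    and "expansion_at_0 m G G2 G1 G0"
    and "G2 = 0\<^sub>m m m" and "G1 \<noteq> 0\<^sub>m m m"
    and "mat_kernel (transpose_mat G1) \<subseteq> mat_kernel (transpose_mat G0)"
    and "is_svd m r G1 F1t F2t S2 V1 V2" and "F1 = F1t * S2"
  shows "internally_stable A B C D A' B' C' D' \<longleftrightarrow>
         nd_mat (cmat (transpose_mat F1) * G' 0 * cmat F1)"
proof -
  interpret feedback m n p A B C D A' B' C' D' G1 G0
    using assms by unfold_locales simp_all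
  note svd = svd_factors[OF assms(12), folded assms(13)]
  obtain L where L: "L \<in> carrier_mat r m" "L * F1 = 1\<^sub>m r" "1\<^sub>m m = F1 * L + F2t * transpose_mat F2t"
    using svd(5) by blast
  let ?F = "cmat F1" and ?V = "cmat V1" and ?L = "cmat L" and ?U = "cmat F2t"
  have c: "?F \<in> carrier_mat m r" "?V \<in> carrier_mat m r" "?L \<in> carrier_mat r m" "?U \<in> carrier_mat m (m - r)"
    "cmatT V1 \<in> carrier_mat r m" "cmatT F2t \<in> carrier_mat (m - r) m"
    using svd(1,2,7) L(1) by auto
  have FV: "?F *\<^sub>v w = cmat G1 *\<^sub>v (?V *\<^sub>v w)" if "w \<in> carrier_vec r" for w
  proof -
    have "?F = cmat G1 * ?V"
      unfolding svd(4)[symmetric] by (rule of_real_hom.mat_hom_mult[OF P.G1_dim svd(2)])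
    then show ?thesis using assoc_mult_mat_vec[OF P.cG_dims(1) c(2) that] by simp
  qed
  have GF: "cmat G1 *\<^sub>v v = ?F *\<^sub>v (cmatT V1 *\<^sub>v v)" if "v \<in> carrier_vec m" for v
  proof -
    have "cmat G1 = ?F * cmatT V1"
      unfolding svd(3) by (rule of_real_hom.mat_hom_mult[of _ m r _ m]) (use svd(1,2) in auto)
    then show ?thesis using assoc_mult_mat_vec[OF c(1) c(5) that] by simp
  qed
  have inj: "w = 0\<^sub>v r" if w: "w \<in> carrier_vec r" and 0: "?F *\<^sub>v w = 0\<^sub>v m" for w
  proof -
    have "?L * ?F = 1\<^sub>m r"
      using of_real_hom.mat_hom_mult[OF L(1) svd(1)] unfolding L(2) of_real_hom.mat_hom_one by (rule sym)
    then have "w = ?L *\<^sub>v (?F *\<^sub>v w)" using assoc_mult_mat_vec[OF c(3) c(1) w] w by simp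
    then show ?thesis unfolding 0 using mult_mat_zero_vec[OF c(3)] by simp
  qed
  \<comment> \<open>Split \<open>y\<close> by \<open>I = F1 L + F2t F2t^T\<close>. The columns of
    \<open>F2t\<close> lie in the kernel of \<open>G1\<close>, so \<open>perp\<close> removes the
    second part, and \<open>F1 = G1 V1\<close> places the first in the range of
    \<open>G1\<close>.\<close>
  have range: "\<exists>v\<in>carrier_vec m. y = cmat G1 *\<^sub>v v" if y: "y \<in> carrier_vec m"
    and perp: "\<And>x. x \<in> carrier_vec m \<Longrightarrow> cmat G1 *\<^sub>v x = 0\<^sub>v m \<Longrightarrow> y \<bullet>c x = 0" for y
  proof -
    have "cmatT F2t *\<^sub>v y = 0\<^sub>v (m - r)"
    proof (rule cscalar_prod_eq_0_imp_zero[OF mult_mat_vec_carrier[OF c(6) y]])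
      fix q :: "complex vec" assume q: "q \<in> carrier_vec (m - r)"
      have Uq: "?U *\<^sub>v q \<in> carrier_vec m" by (rule mult_mat_vec_carrier[OF c(4) q])
      have GU: "cmatT G1 *\<^sub>v (?U *\<^sub>v q) = 0\<^sub>v m"
      proof -
        have T: "cmatT G1 \<in> carrier_mat m m" using P.G1_dim by simp
        have "cmat (transpose_mat G1 * F2t) = cmatT G1 * ?U"
          by (rule of_real_hom.mat_hom_mult[of _ m m _ "m - r"]) (use P.G1_dim svd(7) in auto)
        then have "cmatT G1 * ?U = 0\<^sub>m m (m - r)"
          unfolding svd(6) cmat_zero by (rule sym)
        then show ?thesis using assoc_mult_mat_vec[OF T c(4) q] q by simp
      qed
      have "cmat G1 *\<^sub>v (?U *\<^sub>v q) = 0\<^sub>v m"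
        by (rule P.G1_transpose_kernel[OF Uq]) (simp add: P.G1_adjoint[OF _ Uq] GU)
      then show "(cmatT F2t *\<^sub>v y) \<bullet>c q = 0"
        using perp[OF Uq] cmat_adjoint[of "transpose_mat F2t" "m - r" m y q] svd(7) y q by simp
    qed
    moreover have "y = ?F *\<^sub>v (?L *\<^sub>v y) + ?U *\<^sub>v (cmatT F2t *\<^sub>v y)"
    proof -
      have "cmat (1\<^sub>m m) = cmat (F1 * L) + cmat (F2t * transpose_mat F2t)"
        unfolding L(3) using L(1) svd(1,7) by (intro eq_matI) auto
      moreover have "cmat (F1 * L) = ?F * ?L"
        by (rule of_real_hom.mat_hom_mult[OF svd(1) L(1)])
      moreover have "cmat (F2t * transpose_mat F2t) = ?U * cmatT F2t"
        by (rule of_real_hom.mat_hom_mult[of _ m "m - r" _ m]) (use svd(7) in auto)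
      ultimately have "1\<^sub>m m = ?F * ?L + ?U * cmatT F2t"
        by (simp only: of_real_hom.mat_hom_one)
      then have "y = (?F * ?L + ?U * cmatT F2t) *\<^sub>v y"
        using one_mult_mat_vec[OF y] by metis
      also have "\<dots> = (?F * ?L) *\<^sub>v y + (?U * cmatT F2t) *\<^sub>v y"
        by (rule add_mult_distrib_mat_vec[OF mult_carrier_mat[OF c(1,3)] mult_carrier_mat[OF c(4,6)] y])
      finally show ?thesis
        unfolding assoc_mult_mat_vec[OF c(1,3) y] assoc_mult_mat_vec[OF c(4,6) y] .
    qed
    ultimately have "y = ?F *\<^sub>v (?L *\<^sub>v y)"
      using mult_mat_zero_vec[OF c(4)] mult_mat_vec_carrier[OF c(1) mult_mat_vec_carrier[OF c(3) y]] by simp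
    also have "\<dots> = cmat G1 *\<^sub>v (?V *\<^sub>v (?L *\<^sub>v y))"
      by (rule FV[OF mult_mat_vec_carrier[OF c(3) y]])
    finally show ?thesis
      using mult_mat_vec_carrier[OF c(2) mult_mat_vec_carrier[OF c(3) y]] by blast
  qed
  \<comment> \<open>Nonzero vectors correspond in both directions: \<open>F1 w = G1 (V1 w)\<close>
    with \<open>F1\<close> injective, and \<open>G1 v = F1 (V1^T v)\<close>.\<close>
  have "dc_negative \<longleftrightarrow> nd_mat (cmatT F1 * Q.G 0 * cmat F1)"
    unfolding nd_mat_congruence[OF svd(1)] dc_negative_def
  proof (intro iffI ballI impI)
    fix w :: "complex vec"
    assume neg: "\<forall>v\<in>carrier_vec m. cmat G1 *\<^sub>v v \<noteq> 0\<^sub>v m \<longrightarrow>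
        Re ((Q.G 0 *\<^sub>v (cmat G1 *\<^sub>v v)) \<bullet>c (cmat G1 *\<^sub>v v)) < 0"
      and w: "w \<in> carrier_vec r" "w \<noteq> 0\<^sub>v r"
    show "Re ((Q.G 0 *\<^sub>v (?F *\<^sub>v w)) \<bullet>c (?F *\<^sub>v w)) < 0"
      using neg mult_mat_vec_carrier[OF c(2) w(1)] inj[OF w(1)] w(2) unfolding FV[OF w(1)] by blast
  next
    fix v :: "complex vec"
    assume neg: "\<forall>w\<in>carrier_vec r. w \<noteq> 0\<^sub>v r \<longrightarrow> Re ((Q.G 0 *\<^sub>v (?F *\<^sub>v w)) \<bullet>c (?F *\<^sub>v w)) < 0"
      and v: "v \<in> carrier_vec m" "cmat G1 *\<^sub>v v \<noteq> 0\<^sub>v m"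
    have "cmatT V1 *\<^sub>v v \<noteq> 0\<^sub>v r"
      using v(2) mult_mat_zero_vec[OF c(1)] unfolding GF[OF v(1)] by metis
    then show "Re ((Q.G 0 *\<^sub>v (cmat G1 *\<^sub>v v)) \<bullet>c (cmat G1 *\<^sub>v v)) < 0"
      using neg mult_mat_vec_carrier[OF c(5) v(1)] unfolding GF[OF v(1)] by blast
  qed
  moreover have "internally_stable A B C D A' B' C' D' \<longleftrightarrow> dc_negative"
    unfolding internally_stable_iff
    using hurwitz_if_dc_negative[OF _ range] dc_negative_if_hurwitz by blast
  ultimately show ?thesis by (simp add: assms(4))
qed

end
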